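(* Let $(\mathcal{K},\varphi)$ be an OCP map on a $C^*$-algebra $\mathcal{A}$. Then $\mathbf{Stine}_{\mathcal{A}}(\mathcal{K},\varphi)\equiv(\mathcal{K},\mathcal{H}_\varphi,\pi_\varphi,V_\varphi)$ is a minimal Stinespring representation of $\varphi$. Conversely, given any minimal Stinespring representation $(\mathcal{K},\mathcal{H},\pi,V)$ of $\varphi$, there exists a unique isomorphism $(\mathcal{K},\mathcal{H}_\varphi,\pi_\varphi,V_\varphi)\to(\mathcal{K},\mathcal{H},\pi,V)$ of anchored representations. In fact, this isomorphism consists of two unitaries.
   Context: All $C^*$-algebras and $^*$-homomorphisms (in particular all representations) are unital. CP means completely positive; $\mathcal{B}(\mathcal{K})$ denotes the bounded operators on a Hilbert space $\mathcal{K}$; inner products are linear in the right variable and conjugate linear in the left variable. An OCP map (operator-valued CP map) on $\mathcal{A}$ is a pair $(\mathcal{K},\varphi)$ with $\mathcal{K}$ a Hilbert space and $\varphi:\mathcal{A}\to\mathcal{B}(\mathcal{K})$ a CP linear map (not necessarily unital). An anchored representation of $\mathcal{A}$ is a quadruple $(\mathcal{K},\mathcal{H},\pi,V)$ with $\mathcal{K},\mathcal{H}$ Hilbert spaces, $\pi:\mathcal{A}\to\mathcal{B}(\mathcal{H})$ a $^*$-homomorphism, and $V:\mathcal{K}\to\mathcal{H}$ a bounded linear map. A morphism of anchored representations $(T,L):(\mathcal{K},\mathcal{H},\pi,V)\to(\mathcal{L},\mathcal{I},\rho,W)$ consists of bounded linear maps $T:\mathcal{K}\to\mathcal{L}$ and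 $L:\mathcal{H}\to\mathcal{I}$ with $L\pi(a)=\rho(a)L$ for all $a\in\mathcal{A}$, $LV=WT$, and $TV^*=W^*L$. Morphisms compose by $(S,M)\circ(T,L)=(ST,ML)$, the identity of $(\mathcal{K},\mathcal{H},\pi,V)$ is $(\mathrm{id}_{\mathcal{K}},\mathrm{id}_{\mathcal{H}})$, and an isomorphism is an invertible morphism. A Stinespring representation of an OCP map $(\mathcal{K},\varphi)$ on $\mathcal{A}$ is an anchored representation $(\mathcal{K},\mathcal{H},\pi,V)$ of $\mathcal{A}$ with $\varphi(a)=V^*\pi(a)V$ for all $a\in\mathcal{A}$. It is minimal if $\mathrm{span}\{\pi(a)V(v):a\in\mathcal{A},\,v\in\mathcal{K}\}$ is dense in $\mathcal{H}$. $\mathbf{Stine}_{\mathcal{A}}(\mathcal{K},\varphi)=(\mathcal{K},\mathcal{H}_\varphi,\pi_\varphi,V_\varphi)$ is Stinespring's construction: on the algebraic tensor product $\mathcal{A}\otimes\mathcal{K}$ put the sesquilinear form $\langle\!\langle\sum_i a_i\otimes v_i,\sum_j b_j\otimes w_j\rangle\!\rangle_\varphi=\sum_{i,j}\langle v_i,\varphi(a_i^*b_j)w_j\rangle_{\mathcal{K}}$; let $\mathcal{N}_\varphi=\{\zeta\in\mathcal{A}\otimes\mathcal{K}:\langle\!\langle\zeta,\zeta\rangle\!\rangle_\varphi=0\}$; let $\mathcal{H}_\varphi$ be the Hilbert space completion of $(\mathcal{A}\otimes\mathcal{K})/\mathcal{N}_\varphi$ with respect to the induced inner product; let $\pi_\varphi(a)$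 be the bounded operator on $\mathcal{H}_\varphi$ determined by $[\sum_i a_i\otimes v_i]\mapsto[\sum_i aa_i\otimes v_i]$; and let $V_\varphi:\mathcal{K}\to\mathcal{H}_\varphi$ be $V_\varphi(w)=[1_{\mathcal{A}}\otimes w]$.
   Formalization: Uniqueness and unitarity are stated for the isomorphism (T,L) whose first component T is the identity of K; without this, uniqueness fails for K ≠ 0, since (cT,cL) is again an isomorphism for every nonzero scalar c. *)

theory Defs
  imports "HOL-Analysis.Analysis" "HOL-Algebra.Module" "HOL-Algebra.AbelCoset"
    "HOL-Algebra.RingHom" "HOL-Library.Poly_Mapping"
begin

section \<open>C*-algebras\<close>

text \<open>
  C*-algebras are unital. The superclasses do not force \<open>1 \<noteq> 0\<close>, so the zero algebra is included.
\<close>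

class cstar_algebra = real_normed_algebra + monoid_mult + banach +
  fixes scaleC :: "complex \<Rightarrow> 'a \<Rightarrow> 'a" (infixr \<open>*\<^sub>C\<close> 75)
    and cstar :: "'a \<Rightarrow> 'a"
  assumes scaleC_add_right: "c *\<^sub>C (x + y) = c *\<^sub>C x + c *\<^sub>C y"
    and scaleC_add_left: "(c + d) *\<^sub>C x = c *\<^sub>C x + d *\<^sub>C x"
    and scaleC_scaleC: "c *\<^sub>C d *\<^sub>C x = (c * d) *\<^sub>C x"
    and scaleR_scaleC: "r *\<^sub>R x = complex_of_real r *\<^sub>C x"
    and mult_scaleC_left: "(c *\<^sub>C x) * y = c *\<^sub>C (x * y)"
    and mult_scaleC_right: "x * (c *\<^sub>C y) = c *\<^sub>C (x * y)"
    and norm_scaleC: "norm (c *\<^sub>C x) = cmod c * norm x"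
    and cstar_add: "cstar (x + y) = cstar x + cstar y"
    and cstar_scaleC: "cstar (c *\<^sub>C x) = cnj c *\<^sub>C cstar x"
    and cstar_mult: "cstar (x * y) = cstar y * cstar x"
    and cstar_cstar: "cstar (cstar x) = x"
    and cstar_norm: "norm (cstar x * x) = (norm x)\<^sup>2"

definition complex_field :: "complex ring" where
  "complex_field = \<lparr>carrier = UNIV, mult = (*), one = 1, zero = 0, add = (+)\<rparr>"

text \<open>
  Unital complex *-algebras as structures with a carrier. A C*-algebra given by a type, the bounded
  operators on a Hilbert space and the matrices over such algebras are all of this kind.
\<close>

record 'a star_algebra = "(complex, 'a) module" +
  star :: "'a \<Rightarrow> 'a"

definition cstar_alg :: "'a::cstar_algebra star_algebra" where
  "cstar_alg = \<lparr>carrier = UNIV, mult = (*), one = 1, zero = 0, add = (+), smult = scaleC,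
     star = cstar\<rparr>"

definition star_hom :: "'a star_algebra \<Rightarrow> 'b star_algebra \<Rightarrow> ('a \<Rightarrow> 'b) set" where
  "star_hom A B = {h \<in> ring_hom A B.
     (\<forall>c. \<forall>x\<in>carrier A. h (c \<odot>\<^bsub>A\<^esub> x) = c \<odot>\<^bsub>B\<^esub> h x) \<and>
     (\<forall>x\<in>carrier A. h (star A x) = star B (h x))}"

definition linear_maps :: "(complex, 'v, 'm) module_scheme \<Rightarrow> (complex, 'w, 'n) module_scheme
    \<Rightarrow> ('v \<Rightarrow> 'w) set" where
  "linear_maps V W = {f \<in> carrier V \<rightarrow> carrier W.
     (\<forall>x\<in>carrier V. \<forall>y\<in>carrier V. f (x \<oplus>\<^bsub>V\<^esub> y) = f x \<oplus>\<^bsub>W\<^esub> f y) \<and>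
     (\<forall>c. \<forall>x\<in>carrier V. f (c \<odot>\<^bsub>V\<^esub> x) = c \<odot>\<^bsub>W\<^esub> f x)}"

definition positive_elements :: "'a star_algebra \<Rightarrow> 'a set" where
  "positive_elements A = {star A x \<otimes>\<^bsub>A\<^esub> x | x. x \<in> carrier A}"

definition mat_alg :: "nat \<Rightarrow> 'a star_algebra \<Rightarrow> (nat \<times> nat \<Rightarrow> 'a) star_algebra" where
  "mat_alg n A = (let I = {..<n} \<times> {..<n} in
    \<lparr>carrier = I \<rightarrow>\<^sub>E carrier A,
     mult = (\<lambda>M N. \<lambda>(i, j)\<in>I. \<Oplus>\<^bsub>A\<^esub>k\<in>{..<n}. M (i, k) \<otimes>\<^bsub>A\<^esub> N (k, j)),
     one = (\<lambda>(i, j)\<in>I. if i = j then \<one>\<^bsub>A\<^esub> else \<zero>\<^bsub>A\<^esub>),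
     zero = (\<lambda>p\<in>I. \<zero>\<^bsub>A\<^esub>),
     add = (\<lambda>M N. \<lambda>p\<in>I. M p \<oplus>\<^bsub>A\<^esub> N p),
     smult = (\<lambda>c M. \<lambda>p\<in>I. c \<odot>\<^bsub>A\<^esub> M p),
     star = (\<lambda>M. \<lambda>(i, j)\<in>I. star A (M (j, i)))\<rparr>)"

definition completely_positive :: "'a star_algebra \<Rightarrow> 'b star_algebra \<Rightarrow> ('a \<Rightarrow> 'b) \<Rightarrow> bool" where
  "completely_positive A B \<phi> \<longleftrightarrow> \<phi> \<in> linear_maps A B \<and>
     (\<forall>n. \<forall>M\<in>positive_elements (mat_alg n A).
        compose ({..<n} \<times> {..<n}) \<phi> M \<in> positive_elements (mat_alg n B))"

section \<open>Hilbert spaces\<close>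

text \<open>
  Hilbert spaces are structures with a carrier rather than types, since the Stinespring space
  depends on \<open>\<phi>\<close>. The fields \<open>mult\<close> and \<open>one\<close> inherited from \<open>module\<close> play no role.
\<close>

record 'h hilb = "(complex, 'h) module" +
  cinner :: "'h \<Rightarrow> 'h \<Rightarrow> complex"  (\<open>\<langle>_, _\<rangle>\<index>\<close>)

locale pre_hilbert_space = Module.module complex_field H for H :: "'h hilb" (structure) +
  assumes cinner_add_right: "\<lbrakk>x \<in> carrier H; y \<in> carrier H; z \<in> carrier H\<rbrakk> \<Longrightarrow>
      \<langle>x, y \<oplus> z\<rangle> = \<langle>x, y\<rangle> + \<langle>x, z\<rangle>"
    and cinner_smult_right: "\<lbrakk>x \<in> carrier H; y \<in> carrier H\<rbrakk> \<Longrightarrow> \<langle>x, c \<odot> y\<rangle> = c * \<langle>x, y\<rangle>"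
    and cinner_commute: "\<lbrakk>x \<in> carrier H; y \<in> carrier H\<rbrakk> \<Longrightarrow> \<langle>y, x\<rangle> = cnj \<langle>x, y\<rangle>"
    and cinner_nonneg: "x \<in> carrier H \<Longrightarrow> 0 \<le> Re \<langle>x, x\<rangle>"
    and cinner_definite: "\<lbrakk>x \<in> carrier H; \<langle>x, x\<rangle> = 0\<rbrakk> \<Longrightarrow> x = \<zero>"

definition hnorm :: "'h hilb \<Rightarrow> 'h \<Rightarrow> real" where
  "hnorm H x = sqrt (Re \<langle>x, x\<rangle>\<^bsub>H\<^esub>)"

text \<open>
  The value 0 off the carrier is there because \<^locale>\<open>Metric_space\<close> asks for a symmetric and
  non-negative distance on the whole type.
\<close>

definition hdist :: "'h hilb \<Rightarrow> 'h \<Rightarrow> 'h \<Rightarrow> real" where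
  "hdist H x y = (if x \<in> carrier H \<and> y \<in> carrier H then hnorm H (x \<ominus>\<^bsub>H\<^esub> y) else 0)"

locale hilbert_space = pre_hilbert_space +
  assumes complete: "Metric_space.mcomplete (carrier H) (hdist H)"

definition htopology :: "'h hilb \<Rightarrow> 'h topology" where
  "htopology H = Metric_space.mtopology (carrier H) (hdist H)"

text \<open>
  Operators are extensional functions (undefined off the domain), so that equality of operators is
  equality of functions; accordingly they are composed with \<^const>\<open>compose\<close>.
\<close>

definition bounded_ops :: "'h hilb \<Rightarrow> 'i hilb \<Rightarrow> ('h \<Rightarrow> 'i) set" where
  "bounded_ops H I = {T \<in> linear_maps H I. T \<in> extensional (carrier H) \<and>
     (\<exists>C. \<forall>x\<in>carrier H. hnorm I (T x) \<le> C * hnorm H x)}"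

definition id_op :: "'h hilb \<Rightarrow> 'h \<Rightarrow> 'h" where
  "id_op H = (\<lambda>x\<in>carrier H. x)"

definition adjoint_op :: "'h hilb \<Rightarrow> 'i hilb \<Rightarrow> ('h \<Rightarrow> 'i) \<Rightarrow> 'i \<Rightarrow> 'h" where
  "adjoint_op H I T = (THE S. S \<in> bounded_ops I H \<and>
     (\<forall>x\<in>carrier H. \<forall>y\<in>carrier I. \<langle>y, T x\<rangle>\<^bsub>I\<^esub> = \<langle>S y, x\<rangle>\<^bsub>H\<^esub>))"

definition unitary_op :: "'h hilb \<Rightarrow> 'i hilb \<Rightarrow> ('h \<Rightarrow> 'i) \<Rightarrow> bool" where
  "unitary_op H I U \<longleftrightarrow> U \<in> bounded_ops H I \<and>
     compose (carrier H) (adjoint_op H I U) U = id_op H \<and>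
     compose (carrier I) U (adjoint_op H I U) = id_op I"

definition op_alg :: "'h hilb \<Rightarrow> ('h \<Rightarrow> 'h) star_algebra" where
  "op_alg H =
    \<lparr>carrier = bounded_ops H H,
     mult = compose (carrier H),
     one = id_op H,
     zero = (\<lambda>x\<in>carrier H. \<zero>\<^bsub>H\<^esub>),
     add = (\<lambda>S T. \<lambda>x\<in>carrier H. S x \<oplus>\<^bsub>H\<^esub> T x),
     smult = (\<lambda>c T. \<lambda>x\<in>carrier H. c \<odot>\<^bsub>H\<^esub> T x),
     star = adjoint_op H H\<rparr>"

section \<open>Spans, quotients, tensor products and completions\<close>

definition vspan :: "(complex, 'v, 'm) module_scheme \<Rightarrow> 'v set \<Rightarrow> 'v set" where
  "vspan V S = \<Inter>{N. submodule N complex_field V \<and> S \<subseteq> N}"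

definition vquot :: "(complex, 'v, 'm) module_scheme \<Rightarrow> 'v set \<Rightarrow> (complex, 'v set) module" where
  "vquot V N =
    \<lparr>carrier = a_rcosets\<^bsub>V\<^esub> N,
     mult = undefined,
     one = undefined,
     zero = N,
     add = set_add V,
     smult = (\<lambda>c X. \<Union>x\<in>X. N +>\<^bsub>V\<^esub> (c \<odot>\<^bsub>V\<^esub> x))\<rparr>"

text \<open>
  The common value of \<open>f\<close> on representatives of two cosets.
\<close>

definition lift2 :: "('x \<Rightarrow> 'y \<Rightarrow> 'c) \<Rightarrow> 'x set \<Rightarrow> 'y set \<Rightarrow> 'c" where
  "lift2 f X Y = the_elem ((\<lambda>(x, y). f x y) ` (X \<times> Y))"

definition free_space :: "'x set \<Rightarrow> (complex, 'x \<Rightarrow>\<^sub>0 complex) module" where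
  "free_space X =
    \<lparr>carrier = {f. Poly_Mapping.keys f \<subseteq> X},
     mult = undefined,
     one = undefined,
     zero = 0,
     add = (+),
     smult = (\<lambda>c. Poly_Mapping.map ((*) c))\<rparr>"

abbreviation gen :: "'x \<Rightarrow> 'x \<Rightarrow>\<^sub>0 complex" where
  "gen x \<equiv> Poly_Mapping.single x 1"

definition bilinear_relations :: "(complex, 'v, 'm) module_scheme \<Rightarrow>
    (complex, 'w, 'n) module_scheme \<Rightarrow> ('v \<times> 'w \<Rightarrow>\<^sub>0 complex) set" where
  "bilinear_relations V W =
     {gen (x \<oplus>\<^bsub>V\<^esub> y, w) - gen (x, w) - gen (y, w) | x y w.
        x \<in> carrier V \<and> y \<in> carrier V \<and> w \<in> carrier W} \<union>
     {gen (x, v \<oplus>\<^bsub>W\<^esub> w) - gen (x, v) - gen (x, w) | x v w.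
        x \<in> carrier V \<and> v \<in> carrier W \<and> w \<in> carrier W} \<union>
     {gen (c \<odot>\<^bsub>V\<^esub> x, w) - Poly_Mapping.single (x, w) c | c x w.
        x \<in> carrier V \<and> w \<in> carrier W} \<union>
     {gen (x, c \<odot>\<^bsub>W\<^esub> w) - Poly_Mapping.single (x, w) c | c x w.
        x \<in> carrier V \<and> w \<in> carrier W}"

definition tensor_relations :: "(complex, 'v, 'm) module_scheme \<Rightarrow>
    (complex, 'w, 'n) module_scheme \<Rightarrow> ('v \<times> 'w \<Rightarrow>\<^sub>0 complex) set" where
  "tensor_relations V W = vspan (free_space (carrier V \<times> carrier W)) (bilinear_relations V W)"

definition tensor :: "(complex, 'v, 'm) module_scheme \<Rightarrow> (complex, 'w, 'n) module_scheme \<Rightarrow>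
    (complex, ('v \<times> 'w \<Rightarrow>\<^sub>0 complex) set) module" where
  "tensor V W = vquot (free_space (carrier V \<times> carrier W)) (tensor_relations V W)"

definition pure_tensor :: "(complex, 'v, 'm) module_scheme \<Rightarrow> (complex, 'w, 'n) module_scheme \<Rightarrow>
    'v \<Rightarrow> 'w \<Rightarrow> ('v \<times> 'w \<Rightarrow>\<^sub>0 complex) set" where
  "pure_tensor V W x w =
     tensor_relations V W +>\<^bsub>free_space (carrier V \<times> carrier W)\<^esub> gen (x, w)"

text \<open>
  The Hilbert space completion is realised as Cauchy sequences modulo null sequences.
\<close>

definition cauchy_space :: "'h hilb \<Rightarrow> (complex, nat \<Rightarrow> 'h) module" where
  "cauchy_space P =
    \<lparr>carrier = {s. Metric_space.MCauchy (carrier P) (hdist P) s},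
     mult = undefined,
     one = undefined,
     zero = (\<lambda>n. \<zero>\<^bsub>P\<^esub>),
     add = (\<lambda>s t n. s n \<oplus>\<^bsub>P\<^esub> t n),
     smult = (\<lambda>c s n. c \<odot>\<^bsub>P\<^esub> s n)\<rparr>"

definition null_sequences :: "'h hilb \<Rightarrow> (nat \<Rightarrow> 'h) set" where
  "null_sequences P = {s \<in> carrier (cauchy_space P). (\<lambda>n. hnorm P (s n)) \<longlonglongrightarrow> 0}"

definition hilbert_completion :: "'h hilb \<Rightarrow> (nat \<Rightarrow> 'h) set hilb" where
  "hilbert_completion P = module.extend (vquot (cauchy_space P) (null_sequences P))
     (hilb.fields (lift2 (\<lambda>s t. lim (\<lambda>n. \<langle>s n, t n\<rangle>\<^bsub>P\<^esub>))))"

definition completion_embed :: "'h hilb \<Rightarrow> 'h \<Rightarrow> (nat \<Rightarrow> 'h) set" where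
  "completion_embed P x = null_sequences P +>\<^bsub>cauchy_space P\<^esub> (\<lambda>n. x)"

section \<open>OCP maps and anchored representations\<close>

definition ocp_map :: "'k hilb \<Rightarrow> ('a::cstar_algebra \<Rightarrow> 'k \<Rightarrow> 'k) \<Rightarrow> bool" where
  "ocp_map K \<phi> \<longleftrightarrow> hilbert_space K \<and> completely_positive cstar_alg (op_alg K) \<phi>"

type_synonym ('a, 'k, 'h) anrep = "'k hilb \<times> 'h hilb \<times> ('a \<Rightarrow> 'h \<Rightarrow> 'h) \<times> ('k \<Rightarrow> 'h)"

fun anchored_rep :: "('a::cstar_algebra, 'k, 'h) anrep \<Rightarrow> bool" where
  "anchored_rep (K, H, \<pi>, V) \<longleftrightarrow> hilbert_space K \<and> hilbert_space H \<and>
     \<pi> \<in> star_hom cstar_alg (op_alg H) \<and> V \<in> bounded_ops K H"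

fun anrep_morphism :: "('a::cstar_algebra, 'k, 'h) anrep \<Rightarrow> ('a, 'l, 'i) anrep \<Rightarrow>
    ('k \<Rightarrow> 'l) \<times> ('h \<Rightarrow> 'i) \<Rightarrow> bool" where
  "anrep_morphism (K, H, \<pi>, V) (K', H', \<rho>, W) (T, L) \<longleftrightarrow>
     T \<in> bounded_ops K K' \<and> L \<in> bounded_ops H H' \<and>
     (\<forall>a. compose (carrier H) L (\<pi> a) = compose (carrier H) (\<rho> a) L) \<and>
     compose (carrier K) L V = compose (carrier K) W T \<and>
     compose (carrier H) T (adjoint_op K H V) = compose (carrier H) (adjoint_op K' H' W) L"

fun anrep_id :: "('a::cstar_algebra, 'k, 'h) anrep \<Rightarrow> ('k \<Rightarrow> 'k) \<times> ('h \<Rightarrow> 'h)" where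
  "anrep_id (K, H, \<pi>, V) = (id_op K, id_op H)"

text \<open>
  The composite of \<open>(T, L)\<close> followed by \<open>(S, M)\<close>, with the domain of \<open>(T, L)\<close> as first argument.
\<close>

fun anrep_comp :: "('a::cstar_algebra, 'k, 'h) anrep \<Rightarrow> ('l \<Rightarrow> 'm) \<times> ('i \<Rightarrow> 'j) \<Rightarrow>
    ('k \<Rightarrow> 'l) \<times> ('h \<Rightarrow> 'i) \<Rightarrow> ('k \<Rightarrow> 'm) \<times> ('h \<Rightarrow> 'j)" where
  "anrep_comp (K, H, \<pi>, V) (S, M) (T, L) = (compose (carrier K) S T, compose (carrier H) M L)"

text \<open>
  If \<open>(T, L)\<close> is an isomorphism, so is \<open>(c T, c L)\<close> for every non-zero scalar \<open>c\<close>. An isomorphism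
  can thus be unique only once its component \<open>T\<close> between the anchoring spaces is prescribed.
\<close>

definition anrep_iso :: "('a::cstar_algebra, 'k, 'h) anrep \<Rightarrow> ('a, 'l, 'i) anrep \<Rightarrow>
    ('k \<Rightarrow> 'l) \<times> ('h \<Rightarrow> 'i) \<Rightarrow> bool" where
  "anrep_iso X Y F \<longleftrightarrow> anrep_morphism X Y F \<and>
     (\<exists>G. anrep_morphism Y X G \<and> anrep_comp X G F = anrep_id X \<and> anrep_comp Y F G = anrep_id Y)"

fun stinespring_rep :: "'k hilb \<Rightarrow> ('a::cstar_algebra \<Rightarrow> 'k \<Rightarrow> 'k) \<Rightarrow> ('a, 'k, 'h) anrep \<Rightarrow> bool"
  where
  "stinespring_rep K \<phi> (K', H, \<pi>, V) \<longleftrightarrow> K' = K \<and> anchored_rep (K', H, \<pi>, V) \<and>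
     (\<forall>a. \<phi> a = compose (carrier K) (adjoint_op K H V) (compose (carrier K) (\<pi> a) V))"

fun minimal_anrep :: "('a::cstar_algebra, 'k, 'h) anrep \<Rightarrow> bool" where
  "minimal_anrep (K, H, \<pi>, V) \<longleftrightarrow>
     htopology H closure_of vspan H {\<pi> a (V v) | a v. v \<in> carrier K} = carrier H"

definition minimal_stinespring_rep :: "'k hilb \<Rightarrow> ('a::cstar_algebra \<Rightarrow> 'k \<Rightarrow> 'k) \<Rightarrow>
    ('a, 'k, 'h) anrep \<Rightarrow> bool" where
  "minimal_stinespring_rep K \<phi> X \<longleftrightarrow> stinespring_rep K \<phi> X \<and> minimal_anrep X"

section \<open>Stinespring's construction\<close>

abbreviation stine_tensor :: "'k hilb \<Rightarrow>
    (complex, ('a::cstar_algebra \<times> 'k \<Rightarrow>\<^sub>0 complex) set) module" where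
  "stine_tensor K \<equiv> tensor cstar_alg K"

text \<open>
  An element \<open>f\<close> of the free space represents the tensor \<open>\<Sum>p. f p \<cdot> (fst p \<otimes> snd p)\<close>.
\<close>

definition stine_form :: "'k hilb \<Rightarrow> ('a::cstar_algebra \<Rightarrow> 'k \<Rightarrow> 'k) \<Rightarrow>
    ('a \<times> 'k \<Rightarrow>\<^sub>0 complex) set \<Rightarrow> ('a \<times> 'k \<Rightarrow>\<^sub>0 complex) set \<Rightarrow> complex" where
  "stine_form K \<phi> = lift2 (\<lambda>f g.
     \<Sum>(a, v)\<in>Poly_Mapping.keys f. \<Sum>(b, w)\<in>Poly_Mapping.keys g.
       cnj (Poly_Mapping.lookup f (a, v)) * Poly_Mapping.lookup g (b, w) *
         \<langle>v, \<phi> (cstar a * b) w\<rangle>\<^bsub>K\<^esub>)"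

definition stine_null :: "'k hilb \<Rightarrow> ('a::cstar_algebra \<Rightarrow> 'k \<Rightarrow> 'k) \<Rightarrow>
    ('a \<times> 'k \<Rightarrow>\<^sub>0 complex) set set" where
  "stine_null K \<phi> = {\<zeta> \<in> carrier (stine_tensor K). stine_form K \<phi> \<zeta> \<zeta> = 0}"

definition stine_pre :: "'k hilb \<Rightarrow> ('a::cstar_algebra \<Rightarrow> 'k \<Rightarrow> 'k) \<Rightarrow>
    ('a \<times> 'k \<Rightarrow>\<^sub>0 complex) set set hilb" where
  "stine_pre K \<phi> = module.extend (vquot (stine_tensor K) (stine_null K \<phi>))
     (hilb.fields (lift2 (stine_form K \<phi>)))"

type_synonym ('a, 'k) stine_vec = "(nat \<Rightarrow> ('a \<times> 'k \<Rightarrow>\<^sub>0 complex) set set) set"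

definition stine_space :: "'k hilb \<Rightarrow> ('a::cstar_algebra \<Rightarrow> 'k \<Rightarrow> 'k) \<Rightarrow>
    ('a, 'k) stine_vec hilb" where
  "stine_space K \<phi> = hilbert_completion (stine_pre K \<phi>)"

definition stine_class :: "'k hilb \<Rightarrow> ('a::cstar_algebra \<Rightarrow> 'k \<Rightarrow> 'k) \<Rightarrow>
    ('a \<times> 'k \<Rightarrow>\<^sub>0 complex) set \<Rightarrow> ('a, 'k) stine_vec" where
  "stine_class K \<phi> \<zeta> =
     completion_embed (stine_pre K \<phi>) (stine_null K \<phi> +>\<^bsub>stine_tensor K\<^esub> \<zeta>)"

definition stine_rep :: "'k hilb \<Rightarrow> ('a::cstar_algebra \<Rightarrow> 'k \<Rightarrow> 'k) \<Rightarrow>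
    'a \<Rightarrow> ('a, 'k) stine_vec \<Rightarrow> ('a, 'k) stine_vec" where
  "stine_rep K \<phi> a = (THE T. T \<in> bounded_ops (stine_space K \<phi>) (stine_space K \<phi>) \<and>
     (\<forall>(n::nat) b v. v \<in> {..<n} \<rightarrow> carrier K \<longrightarrow>
        T (stine_class K \<phi> (\<Oplus>\<^bsub>stine_tensor K\<^esub>i\<in>{..<n}. pure_tensor cstar_alg K (b i) (v i))) =
        stine_class K \<phi> (\<Oplus>\<^bsub>stine_tensor K\<^esub>i\<in>{..<n}. pure_tensor cstar_alg K (a * b i) (v i))))"

definition stine_anchor :: "'k hilb \<Rightarrow> ('a::cstar_algebra \<Rightarrow> 'k \<Rightarrow> 'k) \<Rightarrow>
    'k \<Rightarrow> ('a, 'k) stine_vec" where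
  "stine_anchor K \<phi> = (\<lambda>w\<in>carrier K. stine_class K \<phi> (pure_tensor cstar_alg K 1 w))"

definition stine :: "'k hilb \<Rightarrow> ('a::cstar_algebra \<Rightarrow> 'k \<Rightarrow> 'k) \<Rightarrow>
    ('a, 'k, ('a, 'k) stine_vec) anrep" where
  "stine K \<phi> = (K, stine_space K \<phi>, stine_rep K \<phi>, stine_anchor K \<phi>)"

end

theory Submission
  imports Defs
begin

text \<open>
  Complete positivity, applied to Gram matrices \<open>(a\<^sub>i\<^sup>* a\<^sub>j)\<close>, makes the form on the tensor product
  positive. Left multiplication by \<open>a\<close> is bounded for it because \<open>1 - a\<^sup>* a / t\<close> has the form
  \<open>y\<^sup>* y\<close> for \<open>t > \<parallel>a\<parallel>\<^sup>2\<close>. For a minimal representation \<open>(K, H, \<pi>, V)\<close> the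
  vectors \<open>\<pi> a (V v)\<close> have the same inner products as the classes of \<open>a \<otimes> v\<close>, so that
  \<open>a \<otimes> v \<mapsto> \<pi> a (V v)\<close> extends to an isometry with dense range, and every
  intertwiner whose first component is the identity agrees with it on a dense subspace.
\<close>

text \<open>Three quotients lead to the Stinespring space: formal combinations modulo tensor
  relations, tensors modulo null vectors, Cauchy sequences modulo null sequences. All are instances
  of one construction, the quotient of a space with a positive semidefinite form by a subspace of
  null vectors (\<open>psd_form_subspace\<close>). Afterwards classes are avoided: the composite
  \<open>qmap\<close> from formal combinations to the Hilbert space has dense range and carries the
  form to the inner product, so identities can be checked on generators. Operators out of the space
  come from \<open>bounded_extension\<close>, which takes linear maps on formal combinations and a
  norm estimate; the estimate already contains independence of representatives. This yields both
  \<open>stine_rep\<close> and the isomorphism. Two choices keep spectral theory out: positive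
  matrices are by definition of the form \<open>N\<^sup>* N\<close>, so positivity of the form is a
  sum of squared norms, and its Hermitian symmetry follows from positivity by polarisation. Adjoints
  are definite descriptions; their existence rests on the Riesz representation theorem.\<close>

lemma complex_field_simps [simp]:
  "carrier complex_field = UNIV" "mult complex_field = (*)" "one complex_field = 1"
  "zero complex_field = 0" "add complex_field = (+)"
  by (simp_all add: complex_field_def)

lemma cring_complex_field: "cring complex_field"
proof (rule cringI)
  show "abelian_group complex_field"
  proof (rule abelian_groupI)
    fix x :: complex
    show "\<exists>y\<in>carrier complex_field. y \<oplus>\<^bsub>complex_field\<^esub> x = \<zero>\<^bsub>complex_field\<^esub>"
      by (rule bexI[of _ "- x"]) simp_all
  qed (simp_all add: algebra_simps)
  show "Group.comm_monoid complex_field"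
    by (rule comm_monoidI) (simp_all add: algebra_simps)
qed (simp_all add: algebra_simps)

lemma complex_moduleI:
  assumes "abelian_group V"
    and "\<And>c x. x \<in> carrier V \<Longrightarrow> c \<odot>\<^bsub>V\<^esub> x \<in> carrier V"
    and "\<And>c d x. x \<in> carrier V \<Longrightarrow> (c + d) \<odot>\<^bsub>V\<^esub> x = c \<odot>\<^bsub>V\<^esub> x \<oplus>\<^bsub>V\<^esub> d \<odot>\<^bsub>V\<^esub> x"
    and "\<And>c x y. \<lbrakk>x \<in> carrier V; y \<in> carrier V\<rbrakk> \<Longrightarrow>
      c \<odot>\<^bsub>V\<^esub> (x \<oplus>\<^bsub>V\<^esub> y) = c \<odot>\<^bsub>V\<^esub> x \<oplus>\<^bsub>V\<^esub> c \<odot>\<^bsub>V\<^esub> y"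
    and "\<And>c d x. x \<in> carrier V \<Longrightarrow> (c * d) \<odot>\<^bsub>V\<^esub> x = c \<odot>\<^bsub>V\<^esub> (d \<odot>\<^bsub>V\<^esub> x)"
    and "\<And>x. x \<in> carrier V \<Longrightarrow> 1 \<odot>\<^bsub>V\<^esub> x = x"
  shows "Module.module complex_field V"
  using assms cring_complex_field by (intro Module.moduleI) simp_all

lemma complex_submoduleI:
  assumes "Module.module complex_field V" "N \<subseteq> carrier V" "\<zero>\<^bsub>V\<^esub> \<in> N"
    and add: "\<And>x y. \<lbrakk>x \<in> N; y \<in> N\<rbrakk> \<Longrightarrow> x \<oplus>\<^bsub>V\<^esub> y \<in> N"
    and smult: "\<And>c x. x \<in> N \<Longrightarrow> c \<odot>\<^bsub>V\<^esub> x \<in> N"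
  shows "submodule N complex_field V"
proof -
  interpret Module.module complex_field V by fact
  show ?thesis
  proof (rule submoduleI)
    fix x assume x: "x \<in> N"
    then have "x \<in> carrier V" using assms(2) by auto
    then have "\<ominus>\<^bsub>V\<^esub> x = (\<ominus>\<^bsub>complex_field\<^esub> 1) \<odot>\<^bsub>V\<^esub> x"
      using smult_l_minus[of 1 x] smult_one[of x] by simp
    then show "\<ominus>\<^bsub>V\<^esub> x \<in> N" using smult[OF x] by simp
  qed (use assms in auto)
qed

lemma submoduleD:
  assumes "submodule N complex_field V"
  shows "N \<subseteq> carrier V" "\<zero>\<^bsub>V\<^esub> \<in> N"
    "\<lbrakk>x \<in> N; y \<in> N\<rbrakk> \<Longrightarrow> x \<oplus>\<^bsub>V\<^esub> y \<in> N"
    "x \<in> N \<Longrightarrow> c \<odot>\<^bsub>V\<^esub> x \<in> N"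
proof -
  interpret submodule N complex_field V by fact
  show "N \<subseteq> carrier V" using subset by simp
  show "\<zero>\<^bsub>V\<^esub> \<in> N" using one_closed by simp
  show "\<lbrakk>x \<in> N; y \<in> N\<rbrakk> \<Longrightarrow> x \<oplus>\<^bsub>V\<^esub> y \<in> N" using m_closed by simp
  show "x \<in> N \<Longrightarrow> c \<odot>\<^bsub>V\<^esub> x \<in> N" using smult_closed by simp
qed

lemma submodule_vspan:
  assumes "Module.module complex_field V" "S \<subseteq> carrier V"
  shows "submodule (vspan V S) complex_field V"
proof -
  have car: "submodule (carrier V) complex_field V"
    using assms(1) by (rule Module.module.carrier_is_submodule)
  have "vspan V S \<subseteq> carrier V" unfolding vspan_def using car assms(2) by blast
  then show ?thesis
  proof (rule complex_submoduleI[OF assms(1)])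
    have *: "z \<in> vspan V S \<longleftrightarrow> (\<forall>N. submodule N complex_field V \<longrightarrow> S \<subseteq> N \<longrightarrow> z \<in> N)" for z
      by (auto simp: vspan_def)
    show "\<zero>\<^bsub>V\<^esub> \<in> vspan V S"
      unfolding * by (simp add: submoduleD(2))
    show "x \<oplus>\<^bsub>V\<^esub> y \<in> vspan V S" if "x \<in> vspan V S" "y \<in> vspan V S" for x y
      using that unfolding * by (simp add: submoduleD(3))
    show "c \<odot>\<^bsub>V\<^esub> x \<in> vspan V S" if "x \<in> vspan V S" for c x
      using that unfolding * by (simp add: submoduleD(4))
  qed
qed

lemma vspan_least:
  assumes "submodule N complex_field V" "S \<subseteq> N" shows "vspan V S \<subseteq> N"
  using assms by (auto simp: vspan_def)

lemma vspan_superset: "S \<subseteq> vspan V S"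
  by (auto simp: vspan_def)

section \<open>Quotients by the null space of a positive form\<close>

text \<open>The group laws mention only carrier, product and unit, so they pass to a record that
  agrees in these fields and differs in others. Quotients and pre-Hilbert spaces are assembled as
  new records around known groups.\<close>

lemma comm_group_cong:
  assumes "comm_group G" "carrier G' = carrier G" "mult G' = mult G" "one G' = one G"
  shows "comm_group G'"
  using assms(1)
  unfolding comm_group_def Group.comm_monoid_def comm_monoid_axioms_def group_def
    group_axioms_def Group.monoid_def Units_def assms(2-4) .

lemma abelian_group_iff_comm_group: "abelian_group G \<longleftrightarrow> comm_group (add_monoid G)"
  by (auto simp: abelian_group_def abelian_group_axioms_def abelian_monoid_def comm_group_def)

lemma vquot_simps [simp]:
  "carrier (vquot V N) = a_rcosets\<^bsub>V\<^esub> N" "zero (vquot V N) = N" "add (vquot V N) = set_add V"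
  "smult (vquot V N) = (\<lambda>c X. \<Union>x\<in>X. N +>\<^bsub>V\<^esub> (c \<odot>\<^bsub>V\<^esub> x))"
  by (simp_all add: vquot_def)

locale vector_subspace = Module.module complex_field V
  for V :: "(complex, 'v, 'm) module_scheme" (structure) +
  fixes N :: "'v set"
  assumes submodule: "submodule N complex_field V"

sublocale vector_subspace \<subseteq> abelian_subgroup N V
  using submodule.axioms(1)[OF submodule] M.abelian_group_axioms
  by (simp add: abelian_subgroupI3 additive_subgroupI)

context vector_subspace
begin

lemma coset_carrier: "x \<in> carrier V \<Longrightarrow> N +> x \<in> carrier (vquot V N)"
  using a_rcosetsI[of N x] a_subset by simp

lemma coset_cases:
  assumes "X \<in> carrier (vquot V N)" obtains x where "x \<in> carrier V" "X = N +> x"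
  using assms by (auto simp: A_RCOSETS_def' a_r_coset_def')

lemma coset_eq_iff:
  assumes "x \<in> carrier V" "y \<in> carrier V" shows "N +> x = N +> y \<longleftrightarrow> x \<ominus> y \<in> N"
  using a_rcos_module[OF assms(2,1)] a_rcos_self[OF assms(1)] a_repr_independence'[of x y] assms(2)
  by (auto simp: a_minus_def)

lemma coset_add:
  "\<lbrakk>x \<in> carrier V; y \<in> carrier V\<rbrakk> \<Longrightarrow> (N +> x) \<oplus>\<^bsub>vquot V N\<^esub> (N +> y) = N +> (x \<oplus> y)"
  by (simp add: a_rcos_sum)

lemma in_cosetD:
  assumes "y \<in> N +> x" "x \<in> carrier V" shows "y \<in> carrier V" "y \<ominus> x \<in> N"
proof -
  show "y \<in> carrier V" using a_elemrcos_carrier[OF assms(2,1)] .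
  show "y \<ominus> x \<in> N" using a_rcos_module_imp[OF assms(2,1)] by (simp add: a_minus_def)
qed

lemma smult_minus_distrib:
  assumes "x \<in> carrier V" "y \<in> carrier V" shows "c \<odot> (x \<ominus> y) = c \<odot> x \<ominus> c \<odot> y"
  using assms by (simp add: a_minus_def smult_r_distr smult_r_minus)

text \<open>Two representatives differ by an element of \<open>N\<close>, and \<open>N\<close>
  absorbs scalars, so the union that defines scalar multiplication in \<open>vquot\<close> consists
  of copies of one coset.\<close>

lemma coset_smult:
  assumes "x \<in> carrier V" shows "c \<odot>\<^bsub>vquot V N\<^esub> (N +> x) = N +> (c \<odot> x)"
proof -
  have "N +> (c \<odot> y) = N +> (c \<odot> x)" if "y \<in> N +> x" for y
    using in_cosetD[OF that assms] submoduleD(4)[OF submodule, of "y \<ominus> x" c] assms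
    by (subst coset_eq_iff) (auto simp: smult_minus_distrib)
  moreover have "N +> x \<noteq> {}" using a_rcos_self[OF assms] by blast
  ultimately show ?thesis unfolding vquot_simps by (intro SUP_eq_const)
qed

lemma module_vquot: "Module.module complex_field (vquot V N)"
proof (rule complex_moduleI)
  show "abelian_group (vquot V N)"
    unfolding abelian_group_iff_comm_group
    by (rule comm_group_cong[OF a_factorgroup_is_comm_group])
      (simp_all add: A_FactGroup_def FactGroup_def A_RCOSETS_def set_add_def)
next
  fix c d X Y assume "X \<in> carrier (vquot V N)" and "Y \<in> carrier (vquot V N)"
  then obtain x y where x: "x \<in> carrier V" "X = N +> x" and y: "y \<in> carrier V" "Y = N +> y"
    by (metis coset_cases)
  note s = coset_smult coset_add coset_carrier smult_l_distr smult_r_distr smult_assoc1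
  show "c \<odot>\<^bsub>vquot V N\<^esub> X \<in> carrier (vquot V N)"
    using x by (simp only: s) (simp add: s del: vquot_simps)
  show "(c + d) \<odot>\<^bsub>vquot V N\<^esub> X = c \<odot>\<^bsub>vquot V N\<^esub> X \<oplus>\<^bsub>vquot V N\<^esub> d \<odot>\<^bsub>vquot V N\<^esub> X"
    using x smult_l_distr[of c d x] by (simp add: s del: vquot_simps)
  show "c \<odot>\<^bsub>vquot V N\<^esub> (X \<oplus>\<^bsub>vquot V N\<^esub> Y) = c \<odot>\<^bsub>vquot V N\<^esub> X \<oplus>\<^bsub>vquot V N\<^esub> c \<odot>\<^bsub>vquot V N\<^esub> Y"
    using x y by (simp add: s del: vquot_simps)
  show "(c * d) \<odot>\<^bsub>vquot V N\<^esub> X = c \<odot>\<^bsub>vquot V N\<^esub> (d \<odot>\<^bsub>vquot V N\<^esub> X)"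
    using x smult_assoc1[of c d x] by (simp add: s del: vquot_simps)
  show "1 \<odot>\<^bsub>vquot V N\<^esub> X = X" 
    using x smult_one[of x] by (simp add: s del: vquot_simps)
qed

lemma coset_linear: "(\<lambda>x. N +> x) \<in> linear_maps V (vquot V N)"
  by (simp add: linear_maps_def coset_carrier coset_add coset_smult del: vquot_simps)

end

text \<open>Without definiteness, the form on formal combinations, the form on tensors, the limit
  form on Cauchy sequences and every inner product fall under the same theory.\<close>

locale psd_form = Module.module complex_field V
  for V :: "(complex, 'v, 'm) module_scheme" (structure) +
  fixes B :: "'v \<Rightarrow> 'v \<Rightarrow> complex"
  assumes form_add_right: "\<lbrakk>x \<in> carrier V; y \<in> carrier V; z \<in> carrier V\<rbrakk> \<Longrightarrow>
      B x (y \<oplus> z) = B x y + B x z"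
    and form_smult_right: "\<lbrakk>x \<in> carrier V; y \<in> carrier V\<rbrakk> \<Longrightarrow> B x (c \<odot> y) = c * B x y"
    and form_commute: "\<lbrakk>x \<in> carrier V; y \<in> carrier V\<rbrakk> \<Longrightarrow> B y x = cnj (B x y)"
    and form_nonneg: "x \<in> carrier V \<Longrightarrow> 0 \<le> Re (B x x)"
begin

lemma form_add_left: "\<lbrakk>x \<in> carrier V; y \<in> carrier V; z \<in> carrier V\<rbrakk> \<Longrightarrow>
    B (x \<oplus> y) z = B x z + B y z"
  using form_commute[of z "x \<oplus> y"] form_add_right[of z x y] form_commute[of z x] form_commute[of z y]
  by simp

lemma form_smult_left: "\<lbrakk>x \<in> carrier V; y \<in> carrier V\<rbrakk> \<Longrightarrow> B (c \<odot> x) y = cnj c * B x y"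
  using form_commute[of y "c \<odot> x"] form_smult_right[of y x c] form_commute[of y x] by simp

lemma uminus_smult: "x \<in> carrier V \<Longrightarrow> \<ominus> x = (- 1) \<odot> x"
proof -
  assume x: "x \<in> carrier V"
  have "(- 1 + 1) \<odot> x = (- 1) \<odot> x \<oplus> 1 \<odot> x" using smult_l_distr[of "-1" 1 x] x by simp
  then have "\<zero> = (- 1) \<odot> x \<oplus> x" using smult_l_null[OF x] smult_one[OF x] by simp
  then show ?thesis using x minus_equality[of "(- 1) \<odot> x" x] smult_closed[of "- 1" x] by simp
qed

lemma form_zero_right [simp]: "x \<in> carrier V \<Longrightarrow> B x \<zero> = 0"
  using form_smult_right[of x \<zero> 0] by simp

lemma form_zero_left [simp]: "x \<in> carrier V \<Longrightarrow> B \<zero> x = 0"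
  using form_smult_left[of \<zero> x 0] by simp

lemma form_diff_right: "\<lbrakk>x \<in> carrier V; y \<in> carrier V; z \<in> carrier V\<rbrakk> \<Longrightarrow>
    B x (y \<ominus> z) = B x y - B x z"
  by (simp add: a_minus_def uminus_smult form_add_right form_smult_right)

lemma form_diff_left: "\<lbrakk>x \<in> carrier V; y \<in> carrier V; z \<in> carrier V\<rbrakk> \<Longrightarrow>
    B (x \<ominus> y) z = B x z - B y z"
  by (simp add: a_minus_def uminus_smult form_add_left form_smult_left)

lemma form_self: "x \<in> carrier V \<Longrightarrow> B x x = complex_of_real (Re (B x x))"
  using form_commute[of x x] by (simp add: complex_eq_iff)

text \<open>Positivity at \<open>x - t (cnj p) y\<close>, with \<open>p = B x y\<close> and t real,
  is a quadratic inequality in t. As the form may be degenerate, \<open>B y y = 0\<close> is a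
  separate case.\<close>

lemma Cauchy_Schwarz:
  assumes x: "x \<in> carrier V" and y: "y \<in> carrier V"
  shows "(cmod (B x y))\<^sup>2 \<le> Re (B x x) * Re (B y y)"
proof -
  define a b p where "a = Re (B x x)" and "b = Re (B y y)" and "p = B x y"
  have ab: "B x x = complex_of_real a" "B y y = complex_of_real b"
    unfolding a_def b_def using form_self x y by blast+
  define s where "s = (cmod p)\<^sup>2"
  have s: "complex_of_real s = p * cnj p" unfolding s_def by (rule complex_norm_square)
  have *: "0 \<le> a - 2 * t * (cmod p)\<^sup>2 + t\<^sup>2 * (cmod p)\<^sup>2 * b" for t :: real
  proof -
    \<comment> \<open>The factor \<open>cnj p\<close> turns both cross terms into the real number
      \<open>- t |p|\<^sup>2\<close>.\<close>
    define c where "c = - complex_of_real t * cnj p"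
    have "B (x \<oplus> c \<odot> y) (x \<oplus> c \<odot> y) = B x x + c * p + cnj c * cnj p + cnj c * c * B y y"
      using x y form_commute[OF x y]
      by (simp add: form_add_left form_add_right form_smult_left form_smult_right p_def algebra_simps)
    also have "\<dots> = complex_of_real (a - 2 * t * (cmod p)\<^sup>2 + t\<^sup>2 * (cmod p)\<^sup>2 * b)"
      unfolding ab s_def[symmetric] by (simp add: s c_def power2_eq_square algebra_simps)
    finally show ?thesis using form_nonneg[of "x \<oplus> c \<odot> y"] x y by simp
  qed
  show ?thesis
  proof (cases "b = 0")
    case True
    have "cmod p = 0"
    proof (rule ccontr)
      assume "cmod p \<noteq> 0"
      \<comment> \<open>For \<open>b = 0\<close> the quadratic degenerates to a line in t; this t
        brings it down to -1.\<close>
      then have "0 \<le> a - (a + 1)" 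
        using *[of "(a + 1) / (2 * (cmod p)\<^sup>2)"] True by (simp add: field_simps)
      then show False by simp
    qed
    then show ?thesis using True by (simp add: p_def b_def)
  next
    case False
    then have "b > 0" using form_nonneg[OF y] by (simp add: b_def)
    \<comment> \<open>The quadratic has its minimum at \<open>t = 1 / b\<close>.\<close>
    then show ?thesis using *[of "1 / b"] 
      by (simp add: a_def b_def p_def field_simps power2_eq_square)
  qed
qed

lemma form_null_right: "\<lbrakk>x \<in> carrier V; y \<in> carrier V; B y y = 0\<rbrakk> \<Longrightarrow> B x y = 0"
  using Cauchy_Schwarz[of x y] by simp

lemma form_null_left: "\<lbrakk>x \<in> carrier V; y \<in> carrier V; B x x = 0\<rbrakk> \<Longrightarrow> B x y = 0"
  using Cauchy_Schwarz[of x y] by simp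

text \<open>Null vectors are orthogonal to everything by Cauchy-Schwarz, so the cross terms in
  \<open>B (x \<oplus> y) (x \<oplus> y)\<close> vanish.\<close>

lemma submodule_null: "submodule {x \<in> carrier V. B x x = 0} complex_field V"
  by (rule complex_submoduleI[OF module_axioms])
    (auto simp: form_add_left form_add_right form_smult_left form_smult_right
      form_null_left form_null_right)

end

text \<open>\<open>N\<close> may be smaller than the set of all null vectors. This allows for the
  tensor relations, whose quotient may still carry a degenerate form; where \<open>N\<close> is the
  whole null space, the quotient becomes a pre-Hilbert space.\<close>

locale psd_form_subspace = psd_form V B + vector_subspace V N
  for V :: "(complex, 'v, 'm) module_scheme" (structure) and B N +
  assumes null: "x \<in> N \<Longrightarrow> B x x = 0"
begin

text \<open>Changing a representative adds a null vector, and null vectors pair to zero with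
  everything; so \<open>lift2\<close> picks the element of a singleton.\<close>

lemma lift2_coset:
  assumes x: "x \<in> carrier V" and y: "y \<in> carrier V"
  shows "lift2 B (N +> x) (N +> y) = B x y"
proof -
  have *: "B x' y' = B x y" if "x' \<in> N +> x" "y' \<in> N +> y" for x' y'
  proof -
    note X = in_cosetD[OF that(1) x] and Y = in_cosetD[OF that(2) y]
    have "B (x' \<ominus> x) y' = 0" using form_null_left[of "x' \<ominus> x" y'] null[OF X(2)] X(1) Y(1) x by simp
    moreover have "B x (y' \<ominus> y) = 0" using form_null_right[of x "y' \<ominus> y"] null[OF Y(2)] X(1) Y(1) x y by simp
    ultimately show ?thesis using X(1) Y(1) x y by (simp add: form_diff_left form_diff_right)
  qed
  have "(\<lambda>(x, y). B x y) ` ((N +> x) \<times> (N +> y)) \<subseteq> {B x y}"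
    by (rule image_subsetI, clarify) (rule *)
  moreover have "B x y \<in> (\<lambda>(x, y). B x y) ` ((N +> x) \<times> (N +> y))"
    using a_rcos_self[OF x] a_rcos_self[OF y] by (intro image_eqI[of _ _ "(x, y)"]) simp_all
  ultimately have "(\<lambda>(x, y). B x y) ` ((N +> x) \<times> (N +> y)) = {B x y}" by blast
  then show ?thesis by (simp add: lift2_def)
qed

lemma psd_form_vquot: "psd_form (vquot V N) (lift2 B)"
proof -
  interpret Q: Module.module complex_field "vquot V N" by (rule module_vquot)
  show ?thesis
  proof
    fix c X Y Z assume "X \<in> carrier (vquot V N)" and "Y \<in> carrier (vquot V N)"
    then obtain x y where x: "x \<in> carrier V" "X = N +> x" and y: "y \<in> carrier V" "Y = N +> y"
      by (metis coset_cases)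
    show "lift2 B X (c \<odot>\<^bsub>vquot V N\<^esub> Y) = c * lift2 B X Y"
      using x y by (simp add: coset_smult lift2_coset form_smult_right del: vquot_simps)
    show "lift2 B Y X = cnj (lift2 B X Y)"
      using x y form_commute[of x y] by (simp add: lift2_coset)
    show "0 \<le> Re (lift2 B X X)" using x form_nonneg by (simp add: lift2_coset)
    assume "Z \<in> carrier (vquot V N)" 
    then obtain z where z: "z \<in> carrier V" "Z = N +> z"
      by (metis coset_cases)
    show "lift2 B X (Y \<oplus>\<^bsub>vquot V N\<^esub> Z) = lift2 B X Y + lift2 B X Z"
      using x y z by (simp add: coset_add lift2_coset form_add_right del: vquot_simps)
  qed
qed

lemma lift2_definite:
  assumes N: "N = {x \<in> carrier V. B x x = 0}"
    and X: "X \<in> carrier (vquot V N)" "lift2 B X X = 0"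
  shows "X = \<zero>\<^bsub>vquot V N\<^esub>"
proof -
  obtain x where x: "x \<in> carrier V" "X = N +> x" by (rule coset_cases[OF X(1)])
  have "B x x = 0" using X(2) lift2_coset[OF x(1) x(1)] unfolding x(2) by simp
  then have "x \<in> N" unfolding N using x(1) by blast
  then show ?thesis using x a_rcos_const by simp
qed

end

lemma module_extend_hilb_fields_simps [simp]:
  fixes M :: "(complex, 'h) module"
  shows "carrier (module.extend M (hilb.fields b)) = carrier M"
    "zero (module.extend M (hilb.fields b)) = zero M"
    "add (module.extend M (hilb.fields b)) = add M"
    "smult (module.extend M (hilb.fields b)) = smult M"
    "cinner (module.extend M (hilb.fields b)) = b"
  by (simp_all add: module.extend_def hilb.fields_def)

lemma module_extend_hilb_fields:
  fixes M :: "(complex, 'h) module" and b :: "'h \<Rightarrow> 'h \<Rightarrow> complex"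
  assumes "Module.module complex_field M"
  shows "Module.module complex_field (module.extend M (hilb.fields b))"
proof -
  interpret Module.module complex_field M by fact
  show ?thesis
  proof (rule complex_moduleI)
    have "comm_group (add_monoid M)" 
      using M.abelian_group_axioms by (simp add: abelian_group_iff_comm_group)
    then show "abelian_group (module.extend M (hilb.fields b))"
      unfolding abelian_group_iff_comm_group by (rule comm_group_cong) simp_all
  qed (use smult_l_distr smult_r_distr smult_assoc1 smult_one in simp_all)
qed

lemma (in psd_form_subspace) pre_hilbert_space_extend:
  assumes N: "N = {x \<in> carrier V. B x x = 0}"
  shows "pre_hilbert_space (module.extend (vquot V N) (hilb.fields (lift2 B)))"
proof -
  interpret Q: psd_form "vquot V N" "lift2 B" by (rule psd_form_vquot)
  show ?thesis
    by (rule pre_hilbert_space.intro[OF module_extend_hilb_fields[OF module_vquot]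
          pre_hilbert_space_axioms.intro], unfold module_extend_hilb_fields_simps)
      (fact Q.form_add_right Q.form_smult_right Q.form_commute Q.form_nonneg lift2_definite[OF N])+
qed

lemma (in pre_hilbert_space) psd_form_cinner: "psd_form H (cinner H)"
proof (rule psd_form.intro[OF module_axioms psd_form_axioms.intro])
qed (fact cinner_add_right cinner_smult_right cinner_commute cinner_nonneg)+

sublocale pre_hilbert_space \<subseteq> psd_form H "cinner H"
  by (rule psd_form_cinner)

section \<open>Norm and completeness\<close>

context pre_hilbert_space
begin

lemma hnorm_nonneg [simp]: "x \<in> carrier H \<Longrightarrow> 0 \<le> hnorm H x"
  by (simp add: hnorm_def cinner_nonneg)

lemma hnorm_power2: "x \<in> carrier H \<Longrightarrow> (hnorm H x)\<^sup>2 = Re \<langle>x, x\<rangle>"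
  by (simp add: hnorm_def cinner_nonneg)

lemma cinner_self: "x \<in> carrier H \<Longrightarrow> \<langle>x, x\<rangle> = complex_of_real ((hnorm H x)\<^sup>2)"
  using form_self[of x] by (simp add: hnorm_power2)

lemma hnorm_smult: "x \<in> carrier H \<Longrightarrow> hnorm H (c \<odot> x) = cmod c * hnorm H x"
proof -
  assume x: "x \<in> carrier H"
  have "\<langle>c \<odot> x, c \<odot> x\<rangle> = (c * cnj c) * \<langle>x, x\<rangle>"
    using x by (simp add: form_smult_left form_smult_right)
  also have "\<dots> = complex_of_real ((cmod c)\<^sup>2 * (hnorm H x)\<^sup>2)"
    by (simp only: complex_norm_square[symmetric] cinner_self[OF x] of_real_mult)
  finally have "Re \<langle>c \<odot> x, c \<odot> x\<rangle> = (cmod c)\<^sup>2 * (hnorm H x)\<^sup>2"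
    by (simp only: Re_complex_of_real)
  then show ?thesis using x by (simp add: hnorm_def[of H "c \<odot> x"] real_sqrt_mult)
qed

lemma cinner_bound: "\<lbrakk>x \<in> carrier H; y \<in> carrier H\<rbrakk> \<Longrightarrow> cmod \<langle>x, y\<rangle> \<le> hnorm H x * hnorm H y"
  using Cauchy_Schwarz[of x y]
  by (rule_tac power2_le_imp_le) (simp_all add: power_mult_distrib hnorm_power2)

lemma hnorm_zero [simp]: "hnorm H \<zero> = 0"
  by (simp add: hnorm_def)

lemma hnorm_eq_zero [simp]: "x \<in> carrier H \<Longrightarrow> hnorm H x = 0 \<longleftrightarrow> x = \<zero>"
  using cinner_definite[of x] cinner_self[of x] by auto

lemma hnorm_add_power2: "\<lbrakk>x \<in> carrier H; y \<in> carrier H\<rbrakk> \<Longrightarrow>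
    (hnorm H (x \<oplus> y))\<^sup>2 = (hnorm H x)\<^sup>2 + 2 * Re \<langle>x, y\<rangle> + (hnorm H y)\<^sup>2"
  using cinner_commute[of x y]
  by (simp add: hnorm_power2 form_add_left form_add_right)

lemma hnorm_triangle:
  assumes x: "x \<in> carrier H" and y: "y \<in> carrier H"
  shows "hnorm H (x \<oplus> y) \<le> hnorm H x + hnorm H y"
proof (rule power2_le_imp_le)
  have "Re \<langle>x, y\<rangle> \<le> hnorm H x * hnorm H y"
    using complex_Re_le_cmod[of "\<langle>x, y\<rangle>"] cinner_bound[OF x y] by linarith
  then show "(hnorm H (x \<oplus> y))\<^sup>2 \<le> (hnorm H x + hnorm H y)\<^sup>2"
    using x y by (simp add: hnorm_add_power2 power2_sum)
qed (use assms in simp)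

lemma cinner_uminus_right: "\<lbrakk>x \<in> carrier H; y \<in> carrier H\<rbrakk> \<Longrightarrow> \<langle>x, \<ominus> y\<rangle> = - \<langle>x, y\<rangle>"
  by (simp add: uminus_smult form_smult_right)

text \<open>Definiteness at \<open>x \<ominus> y\<close>. Below it mostly serves to check linear
  identities between vectors: pairing with z turns them into identities of complex numbers, which
  simplification settles.\<close>

lemma vector_eqI:
  assumes "x \<in> carrier H" "y \<in> carrier H" "\<And>z. z \<in> carrier H \<Longrightarrow> \<langle>z, x\<rangle> = \<langle>z, y\<rangle>"
  shows "x = y"
proof -
  have "\<langle>x \<ominus> y, x \<ominus> y\<rangle> = 0" using assms by (simp add: form_diff_right)
  then have "x \<ominus> y = \<zero>" using cinner_definite[of "x \<ominus> y"] assms by simp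
  then show ?thesis
    using minus_equality[of x "\<ominus> y"] minus_minus[of y] assms by (simp add: a_minus_def)
qed

lemmas cinner_right_simps = cinner_uminus_right form_diff_right form_add_right form_smult_right

lemma hnorm_uminus: "x \<in> carrier H \<Longrightarrow> hnorm H (\<ominus> x) = hnorm H x"
  by (simp add: uminus_smult hnorm_smult)

lemma hnorm_minus_commute:
  assumes "x \<in> carrier H" "y \<in> carrier H" shows "hnorm H (x \<ominus> y) = hnorm H (y \<ominus> x)"
proof -
  have "x \<ominus> y = \<ominus> (y \<ominus> x)"
    by (rule vector_eqI) (simp_all add: assms cinner_right_simps)
  then show ?thesis using assms by (simp add: hnorm_uminus)
qed

lemma hnorm_triangle_minus:
  assumes "x \<in> carrier H" "y \<in> carrier H" "z \<in> carrier H"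
  shows "hnorm H (x \<ominus> z) \<le> hnorm H (x \<ominus> y) + hnorm H (y \<ominus> z)"
proof -
  have "x \<ominus> z = (x \<ominus> y) \<oplus> (y \<ominus> z)"
    by (rule vector_eqI) (simp_all add: assms cinner_right_simps)
  then show ?thesis using assms hnorm_triangle[of "x \<ominus> y" "y \<ominus> z"] by simp
qed

lemma hnorm_reverse_triangle:
  assumes "x \<in> carrier H" "y \<in> carrier H" shows "\<bar>hnorm H x - hnorm H y\<bar> \<le> hnorm H (x \<ominus> y)"
proof -
  have "x = (x \<ominus> y) \<oplus> y" "y = (y \<ominus> x) \<oplus> x"
    by (rule vector_eqI; simp add: assms cinner_right_simps)+
  then show ?thesis
    using hnorm_triangle[of "x \<ominus> y" y] hnorm_triangle[of "y \<ominus> x" x] hnorm_minus_commute[OF assms] assms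
    by simp
qed

lemma eq_iff_hnorm_minus:
  assumes "x \<in> carrier H" "y \<in> carrier H" shows "x = y \<longleftrightarrow> hnorm H (x \<ominus> y) = 0"
proof
  assume "hnorm H (x \<ominus> y) = 0"
  then have "x \<ominus> y = \<zero>" using assms by simp
  then have "\<langle>z, x\<rangle> - \<langle>z, y\<rangle> = 0" if "z \<in> carrier H" for z
    using form_diff_right[of z x y] that assms by simp
  then show "x = y" using assms by (intro vector_eqI) simp_all
next
  assume "x = y"
  then show "hnorm H (x \<ominus> y) = 0" using assms by (simp add: a_minus_def r_neg)
qed

lemma Metric_space_hdist: "Metric_space (carrier H) (hdist H)"
proof
  fix x y z
  show "0 \<le> hdist H x y" by (simp add: hdist_def)
  show "hdist H x y = hdist H y x" by (simp add: hdist_def hnorm_minus_commute)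
  assume x: "x \<in> carrier H" "y \<in> carrier H"
  then show "hdist H x y = 0 \<longleftrightarrow> x = y"
    using eq_iff_hnorm_minus[OF x] by (simp add: hdist_def)
  assume "z \<in> carrier H"
  with x show "hdist H x z \<le> hdist H x y + hdist H y z"
    by (simp add: hdist_def hnorm_triangle_minus)
qed

sublocale metric: Metric_space "carrier H" "hdist H"
  by (rule Metric_space_hdist)

lemma MCauchy_iff:
  "metric.MCauchy s \<longleftrightarrow> (\<forall>n. s n \<in> carrier H) \<and>
    (\<forall>e>0. \<exists>N. \<forall>m\<ge>N. \<forall>n\<ge>N. hnorm H (s m \<ominus> s n) < e)"
  unfolding metric.MCauchy_def by (auto simp: image_subset_iff hdist_def)

lemma limitin_iff:
  assumes "\<And>n. s n \<in> carrier H" "l \<in> carrier H"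
  shows "limitin metric.mtopology s l sequentially \<longleftrightarrow> (\<lambda>n. hnorm H (s n \<ominus> l)) \<longlonglongrightarrow> 0"
  using assms by (simp add: metric.limit_metric_sequentially LIMSEQ_iff hdist_def)

lemma convergent_imp_MCauchy:
  assumes "\<And>n. s n \<in> carrier H" "l \<in> carrier H" "(\<lambda>n. hnorm H (s n \<ominus> l)) \<longlonglongrightarrow> 0"
  shows "metric.MCauchy s"
  using assms limitin_iff[of s l] metric.convergent_imp_MCauchy[of s l] by (auto simp: image_subset_iff)

text \<open>Brings the closure in \<open>minimal_anrep\<close> into the epsilon form in which the
  density arguments are carried out.\<close>

lemma dense_iff:
  assumes "S \<subseteq> carrier H"
  shows "htopology H closure_of S = carrier H \<longleftrightarrow>
    (\<forall>x\<in>carrier H. \<forall>e>0. \<exists>y\<in>S. hnorm H (x \<ominus> y) < e)"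
proof -
  have "y \<in> metric.mball x e \<longleftrightarrow> hnorm H (x \<ominus> y) < e" if "x \<in> carrier H" "y \<in> S" for x y e
    using that assms by (auto simp: hdist_def)
  then have "(\<exists>y\<in>S. y \<in> metric.mball x e) \<longleftrightarrow> (\<exists>y\<in>S. hnorm H (x \<ominus> y) < e)"
    if "x \<in> carrier H" for x e
    using that by (intro bex_cong) simp_all
  then have "(\<forall>x\<in>carrier H. \<forall>e>0. \<exists>y\<in>S. y \<in> metric.mball x e) \<longleftrightarrow>
      (\<forall>x\<in>carrier H. \<forall>e>0. \<exists>y\<in>S. hnorm H (x \<ominus> y) < e)"
    by (intro ball_cong refl) (simp del: metric.in_mball)
  moreover have "{x \<in> carrier H. Q x} = carrier H \<longleftrightarrow> (\<forall>x\<in>carrier H. Q x)" for Q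
    by blast
  ultimately show ?thesis
    unfolding htopology_def metric.metric_closure_of by simp
qed

lemma hilbert_spaceI:
  assumes "\<And>s. \<lbrakk>\<And>n. s n \<in> carrier H; metric.MCauchy s\<rbrakk> \<Longrightarrow>
    \<exists>l\<in>carrier H. (\<lambda>n. hnorm H (s n \<ominus> l)) \<longlonglongrightarrow> 0"
  shows "hilbert_space H"
proof
  show "metric.mcomplete"
    unfolding metric.mcomplete_def using assms limitin_iff MCauchy_iff by meson
qed

lemma cinner_diff_bound:
  assumes "x \<in> carrier H" "y \<in> carrier H" "x' \<in> carrier H" "y' \<in> carrier H"
  shows "cmod (\<langle>x, y\<rangle> - \<langle>x', y'\<rangle>) \<le> hnorm H x * hnorm H (y \<ominus> y') + hnorm H (x \<ominus> x') * hnorm H y'"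
proof -
  have "\<langle>x, y\<rangle> - \<langle>x', y'\<rangle> = \<langle>x, y \<ominus> y'\<rangle> + \<langle>x \<ominus> x', y'\<rangle>"
    using assms by (simp add: form_diff_left form_diff_right)
  then show ?thesis
    using cinner_bound[of x "y \<ominus> y'"] cinner_bound[of "x \<ominus> x'" y'] assms
    by (metis (no_types, lifting) add_mono minus_closed norm_triangle_le)
qed

end

context hilbert_space
begin

lemma Cauchy_limit:
  assumes "metric.MCauchy s"
  obtains l where "l \<in> carrier H" "(\<lambda>n. hnorm H (s n \<ominus> l)) \<longlonglongrightarrow> 0"
proof -
  obtain l where l: "limitin metric.mtopology s l sequentially"
    using complete assms unfolding metric.mcomplete_def by blast
  then have "l \<in> carrier H" using metric.limitin_mspace by blast
  then show ?thesis using that l assms limitin_iff MCauchy_iff by blast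
qed

end

section \<open>Bounded operators and adjoints\<close>

lemma linear_mapsD:
  assumes "f \<in> linear_maps V W"
  shows "x \<in> carrier V \<Longrightarrow> f x \<in> carrier W"
    "\<lbrakk>x \<in> carrier V; y \<in> carrier V\<rbrakk> \<Longrightarrow> f (x \<oplus>\<^bsub>V\<^esub> y) = f x \<oplus>\<^bsub>W\<^esub> f y"
    "x \<in> carrier V \<Longrightarrow> f (c \<odot>\<^bsub>V\<^esub> x) = c \<odot>\<^bsub>W\<^esub> f x"
  using assms by (auto simp: linear_maps_def)

lemma linear_mapsI:
  assumes "\<And>x. x \<in> carrier V \<Longrightarrow> f x \<in> carrier W"
    and "\<And>x y. \<lbrakk>x \<in> carrier V; y \<in> carrier V\<rbrakk> \<Longrightarrow> f (x \<oplus>\<^bsub>V\<^esub> y) = f x \<oplus>\<^bsub>W\<^esub> f y"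
    and "\<And>c x. x \<in> carrier V \<Longrightarrow> f (c \<odot>\<^bsub>V\<^esub> x) = c \<odot>\<^bsub>W\<^esub> f x"
  shows "f \<in> linear_maps V W"
  using assms by (simp add: linear_maps_def)

lemma linear_maps_zero:
  assumes "Module.module complex_field V" "Module.module complex_field W" "f \<in> linear_maps V W"
  shows "f \<zero>\<^bsub>V\<^esub> = \<zero>\<^bsub>W\<^esub>"
proof -
  interpret V: Module.module complex_field V by fact
  interpret W: Module.module complex_field W by fact
  show ?thesis
    using linear_mapsD(3)[OF assms(3), of "\<zero>\<^bsub>V\<^esub>" 0] linear_mapsD(1)[OF assms(3), of "\<zero>\<^bsub>V\<^esub>"]
      V.smult_r_null[of 0] W.smult_l_null[of "f \<zero>\<^bsub>V\<^esub>"] by simp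
qed

lemma module_uminus_smult:
  assumes "Module.module complex_field V" "x \<in> carrier V"
  shows "\<ominus>\<^bsub>V\<^esub> x = (- 1) \<odot>\<^bsub>V\<^esub> x"
proof -
  \<comment> \<open>With the zero form any complex vector space is an instance of
    \<open>psd_form\<close>, which makes \<open>uminus_smult\<close> available.\<close>
  interpret psd_form V "\<lambda>_ _. 0"
    by (intro psd_form.intro psd_form_axioms.intro assms) simp_all
  show ?thesis using assms(2) by (rule uminus_smult)
qed

lemma linear_maps_diff:
  assumes "Module.module complex_field V" "Module.module complex_field W" "f \<in> linear_maps V W"
    "x \<in> carrier V" "y \<in> carrier V"
  shows "f (x \<ominus>\<^bsub>V\<^esub> y) = f x \<ominus>\<^bsub>W\<^esub> f y"
proof -
  interpret V: Module.module complex_field V by fact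
  interpret W: Module.module complex_field W by fact
  have "x \<ominus>\<^bsub>V\<^esub> y = x \<oplus>\<^bsub>V\<^esub> (- 1) \<odot>\<^bsub>V\<^esub> y"
    using module_uminus_smult[OF assms(1,5)] by (simp add: a_minus_def)
  moreover have "(- 1) \<odot>\<^bsub>V\<^esub> y \<in> carrier V" using assms(5) by simp
  moreover have "f x \<ominus>\<^bsub>W\<^esub> f y = f x \<oplus>\<^bsub>W\<^esub> (- 1) \<odot>\<^bsub>W\<^esub> f y"
    using module_uminus_smult[OF assms(2) linear_mapsD(1)[OF assms(3,5)]] by (simp add: a_minus_def)
  ultimately show ?thesis
    using linear_mapsD(2)[OF assms(3,4)] linear_mapsD(3)[OF assms(3,5)] by simp
qed

lemma submodule_image:
  assumes U: "Module.module complex_field U" and W: "Module.module complex_field W"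
    and f: "f \<in> linear_maps U W"
  shows "submodule (f ` carrier U) complex_field W"
proof (rule complex_submoduleI[OF W])
  interpret U: Module.module complex_field U by fact
  note f' = linear_mapsD[OF f]
  show "f ` carrier U \<subseteq> carrier W" using f'(1) by blast
  show "\<zero>\<^bsub>W\<^esub> \<in> f ` carrier U" using linear_maps_zero[OF U W f] U.zero_closed by (metis imageI)
  show "x \<oplus>\<^bsub>W\<^esub> y \<in> f ` carrier U" if "x \<in> f ` carrier U" "y \<in> f ` carrier U" for x y
  proof -
    obtain u v where "u \<in> carrier U" "v \<in> carrier U" "x = f u" "y = f v" using \<open>x \<in> _\<close> \<open>y \<in> _\<close> by blast
    then show ?thesis using f'(2)[of u v] by (intro image_eqI[of _ _ "u \<oplus>\<^bsub>U\<^esub> v"]) simp_all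
  qed
  show "c \<odot>\<^bsub>W\<^esub> x \<in> f ` carrier U" if "x \<in> f ` carrier U" for c x
  proof -
    obtain u where "u \<in> carrier U" "x = f u" using \<open>x \<in> _\<close> by blast
    then show ?thesis using f'(3)[of u c] by (intro image_eqI[of _ _ "c \<odot>\<^bsub>U\<^esub> u"]) simp_all
  qed
qed

lemma linear_maps_comp:
  "\<lbrakk>f \<in> linear_maps U V; g \<in> linear_maps V W\<rbrakk> \<Longrightarrow> (\<lambda>x. g (f x)) \<in> linear_maps U W"
  by (intro linear_mapsI) (simp_all add: linear_mapsD[of f U V] linear_mapsD[of g V W])

lemma bounded_opsD:
  assumes "T \<in> bounded_ops H I"
  shows "T \<in> linear_maps H I" "T \<in> extensional (carrier H)"
    "x \<in> carrier H \<Longrightarrow> T x \<in> carrier I"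
    "\<lbrakk>x \<in> carrier H; y \<in> carrier H\<rbrakk> \<Longrightarrow> T (x \<oplus>\<^bsub>H\<^esub> y) = T x \<oplus>\<^bsub>I\<^esub> T y"
    "x \<in> carrier H \<Longrightarrow> T (c \<odot>\<^bsub>H\<^esub> x) = c \<odot>\<^bsub>I\<^esub> T x"
  using assms linear_mapsD[of T H I] by (simp_all add: bounded_ops_def)

lemma bounded_ops_bound:
  assumes "pre_hilbert_space H" "T \<in> bounded_ops H I"
  obtains C where "0 < C" "\<And>x. x \<in> carrier H \<Longrightarrow> hnorm I (T x) \<le> C * hnorm H x"
proof -
  interpret pre_hilbert_space H by fact
  obtain C where C: "\<And>x. x \<in> carrier H \<Longrightarrow> hnorm I (T x) \<le> C * hnorm H x"
    using assms(2) by (auto simp: bounded_ops_def)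
  have "hnorm I (T x) \<le> (\<bar>C\<bar> + 1) * hnorm H x" if "x \<in> carrier H" for x
    using order.trans[OF C[OF that] mult_right_mono[of C "\<bar>C\<bar> + 1" "hnorm H x"]] that by simp
  then show ?thesis using that[of "\<bar>C\<bar> + 1"] by simp
qed

lemma bounded_opsI:
  assumes "T \<in> linear_maps H I" "T \<in> extensional (carrier H)"
    and "\<And>x. x \<in> carrier H \<Longrightarrow> hnorm I (T x) \<le> C * hnorm H x"
  shows "T \<in> bounded_ops H I"
  using assms by (auto simp: bounded_ops_def)

lemma bounded_ops_eqI:
  assumes "S \<in> bounded_ops H I" "T \<in> bounded_ops H I" "\<And>x. x \<in> carrier H \<Longrightarrow> S x = T x"
  shows "S = T"
  using bounded_opsD(2)[OF assms(1)] bounded_opsD(2)[OF assms(2)] assms(3) by (rule extensionalityI)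

lemma id_op_bounded: "id_op H \<in> bounded_ops H H" if "pre_hilbert_space H"
proof -
  interpret pre_hilbert_space H by fact
  show ?thesis
    by (rule bounded_opsI[where C = 1]) (auto simp: linear_maps_def id_op_def)
qed

lemma compose_bounded:
  assumes "pre_hilbert_space H" "pre_hilbert_space I" "S \<in> bounded_ops I J" "T \<in> bounded_ops H I"
  shows "compose (carrier H) S T \<in> bounded_ops H J"
proof -
  interpret H: pre_hilbert_space H by fact
  obtain C where C: "0 < C" "\<And>x. x \<in> carrier I \<Longrightarrow> hnorm J (S x) \<le> C * hnorm I x"
    using bounded_ops_bound[OF assms(2,3)] by blast
  obtain D where D: "0 < D" "\<And>x. x \<in> carrier H \<Longrightarrow> hnorm I (T x) \<le> D * hnorm H x"
    using bounded_ops_bound[OF assms(1,4)] by blast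
  note S = bounded_opsD[OF assms(3)] and T = bounded_opsD[OF assms(4)]
  show ?thesis
  proof (rule bounded_opsI[where C = "C * D"])
    show "compose (carrier H) S T \<in> linear_maps H J"
      by (rule linear_mapsI) (simp_all add: compose_eq S(3-5) T(3-5))
    show "hnorm J (compose (carrier H) S T x) \<le> C * D * hnorm H x" if x: "x \<in> carrier H" for x
      using order.trans[OF C(2)[OF T(3)[OF x]] mult_left_mono[OF D(2)[OF x]]] C(1) x
      by (simp add: compose_eq mult.assoc)
  qed (simp add: compose_def)
qed

context hilbert_space
begin

text \<open>Minimising \<open>\<parallel>x\<parallel>\<^sup>2 - 2 Re (f x)\<close> avoids the orthogonal complement of the kernel of \<open>f\<close>.\<close>

lemma Riesz_representation:
  assumes add: "\<And>x y. \<lbrakk>x \<in> carrier H; y \<in> carrier H\<rbrakk> \<Longrightarrow> f (x \<oplus> y) = f x + f y"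
    and smult: "\<And>c x. x \<in> carrier H \<Longrightarrow> f (c \<odot> x) = c * f x"
    and bound: "\<And>x. x \<in> carrier H \<Longrightarrow> cmod (f x) \<le> C * hnorm H x"
  obtains y where "y \<in> carrier H" "\<And>x. x \<in> carrier H \<Longrightarrow> f x = \<langle>y, x\<rangle>"
proof -
  define J where "J x = (hnorm H x)\<^sup>2 - 2 * Re (f x)" for x
  define m where "m = Inf (J ` carrier H)"
  \<comment> \<open>Completing the square: with \<open>n = hnorm H x\<close>, \<open>J x\<close> is
    at least \<open>n\<^sup>2 - 2 C n\<close>.\<close>
  have "- C\<^sup>2 \<le> J x" if x: "x \<in> carrier H" for x
  proof -
    have "Re (f x) \<le> C * hnorm H x"
      using complex_Re_le_cmod[of "f x"] bound[OF x] by linarith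
    moreover have "0 \<le> (hnorm H x - C)\<^sup>2" by simp
    ultimately show ?thesis by (simp add: J_def power2_diff mult.commute)
  qed
  then have bdd: "bdd_below (J ` carrier H)" by (auto intro!: bdd_belowI2[of _ "- C\<^sup>2"])
  have m_le: "m \<le> J x" if "x \<in> carrier H" for x
    unfolding m_def by (rule cInf_lower[OF imageI[OF that] bdd])
  have "\<exists>x\<in>carrier H. J x < m + 1 / real (Suc n)" for n
  proof -
    have *: "Inf (J ` carrier H) < m + 1 / real (Suc n)" by (simp add: m_def)
    have "J ` carrier H \<noteq> {}" using zero_closed by blast
    from cInf_lessD[OF this *] show ?thesis by blast
  qed
  then obtain s where s: "\<And>n. s n \<in> carrier H" "\<And>n. J (s n) < m + 1 / real (Suc n)"
    by metis
  \<comment> \<open>Parallelogram law with the midpoint, where the contributions of \<open>f\<close>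
    cancel. It makes a minimising sequence Cauchy.\<close>
  have par: "(hnorm H (x \<ominus> y))\<^sup>2 \<le> 2 * (J x - m) + 2 * (J y - m)"
    if x: "x \<in> carrier H" and y: "y \<in> carrier H" for x y
  proof -
    let ?z = "(1/2) \<odot> (x \<oplus> y)"
    have "(hnorm H (x \<ominus> y))\<^sup>2 = 2 * J x + 2 * J y - 4 * J ?z"
      using x y cinner_commute[OF x y]
      by (simp add: J_def hnorm_power2 form_diff_left form_diff_right form_add_left form_add_right
        form_smult_left form_smult_right add smult algebra_simps)
    moreover have "m \<le> J ?z" using x y by (intro m_le) simp
    ultimately show ?thesis by simp
  qed
  have "metric.MCauchy s"
    unfolding MCauchy_iff
  proof (intro conjI allI impI s(1))
    fix e :: real assume "0 < e"
    then obtain N where N: "1 / real (Suc N) < e\<^sup>2 / 4"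
      using nat_approx_posE[of "e\<^sup>2 / 4"] by auto
    have "hnorm H (s i \<ominus> s j) < e" if "N \<le> i" "N \<le> j" for i j
    proof (rule power2_less_imp_less)
      have "1 / real (Suc i) \<le> 1 / real (Suc N)" "1 / real (Suc j) \<le> 1 / real (Suc N)"
        using that by (simp_all add: frac_le)
      then show "(hnorm H (s i \<ominus> s j))\<^sup>2 < e\<^sup>2"
        using par[OF s(1) s(1), of i j] s(2)[of i] s(2)[of j] N by simp
    qed (use \<open>0 < e\<close> in simp)
    then show "\<exists>N. \<forall>i\<ge>N. \<forall>j\<ge>N. hnorm H (s i \<ominus> s j) < e" by blast
  qed
  then obtain y where y: "y \<in> carrier H" "(\<lambda>n. hnorm H (s n \<ominus> y)) \<longlonglongrightarrow> 0"
    by (rule Cauchy_limit)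
  have Re0: "Re (\<langle>y, x\<rangle> - f x) = 0" if x: "x \<in> carrier H" for x
  proof -
    define A where "A = Re (\<langle>y, x\<rangle> - f x)"
    define b where "b = (hnorm H x)\<^sup>2"
    have lim: "(\<lambda>n. \<langle>s n, x\<rangle>) \<longlonglongrightarrow> \<langle>y, x\<rangle>"
    proof (rule LIM_zero_cancel, rule Lim_null_comparison)
      show "\<forall>\<^sub>F n in sequentially. norm (\<langle>s n, x\<rangle> - \<langle>y, x\<rangle>) \<le> hnorm H (s n \<ominus> y) * hnorm H x"
        using cinner_bound[of "s _ \<ominus> y" x] s(1) y(1) x by (simp add: form_diff_left)
      show "(\<lambda>n. hnorm H (s n \<ominus> y) * hnorm H x) \<longlonglongrightarrow> 0"
        using tendsto_mult_right[OF y(2)] by simp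
    qed
    \<comment> \<open>First variation: moving \<open>s n\<close> by a multiple t of \<open>x\<close>
      cannot bring \<open>J\<close> below m, while \<open>J (s n)\<close> exceeds m by less than
      \<open>1 / (n + 1)\<close>.\<close>
    have "0 \<le> 2 * t * A + t\<^sup>2 * b" for t :: real
    proof (rule LIMSEQ_le)
      show "(\<lambda>n. - (1 / real (Suc n))) \<longlonglongrightarrow> 0"
        using tendsto_minus[OF LIMSEQ_inverse_real_of_nat] by (simp add: inverse_eq_divide)
      show "(\<lambda>n. 2 * t * Re (\<langle>s n, x\<rangle> - f x) + t\<^sup>2 * b) \<longlonglongrightarrow> 2 * t * A + t\<^sup>2 * b"
        unfolding A_def by (intro tendsto_intros lim)
      have "- (1 / real (Suc n)) \<le> 2 * t * Re (\<langle>s n, x\<rangle> - f x) + t\<^sup>2 * b" for n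
      proof -
        have "J (s n \<oplus> complex_of_real t \<odot> x) = J (s n) + 2 * t * Re (\<langle>s n, x\<rangle> - f x) + t\<^sup>2 * b"
          using x s(1)[of n]
          by (simp add: J_def b_def hnorm_add_power2 hnorm_smult form_smult_right add smult
            power_mult_distrib algebra_simps)
        moreover have "m \<le> J (s n \<oplus> complex_of_real t \<odot> x)" using x s(1) by (intro m_le) simp
        ultimately show ?thesis using s(2)[of n] by linarith
      qed
      then show "\<exists>N. \<forall>n\<ge>N. - (1 / real (Suc n)) \<le> 2 * t * Re (\<langle>s n, x\<rangle> - f x) + t\<^sup>2 * b"
        by blast
    qed
    \<comment> \<open>Close to the minimiser \<open>- A / b\<close>, with \<open>b + 1\<close> as
      divisor to cover \<open>b = 0\<close>. The value there is negative unless
      \<open>A = 0\<close>.\<close>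
    note * = this[of "- A / (b + 1)"]
    have b: "0 \<le> b" by (simp add: b_def)
    then have "2 * (- A / (b + 1)) * A + (- A / (b + 1))\<^sup>2 * b = - (A\<^sup>2 * (b + 2)) / (b + 1)\<^sup>2"
      by (simp add: divide_simps power2_eq_square) (simp add: algebra_simps)
    with * have "0 \<le> - (A\<^sup>2 * (b + 2)) / (b + 1)\<^sup>2" by (rule ord_le_eq_trans)
    with b have "A\<^sup>2 * (b + 2) \<le> 0"
      by (simp add: zero_le_divide_iff divide_le_0_iff)
    then have "A\<^sup>2 \<le> 0" using b by (simp add: mult_le_0_iff)
    then show ?thesis by (simp add: A_def)
  qed
  \<comment> \<open>Equality of the real parts at \<open>\<i> \<odot> x\<close> is equality of the
    imaginary parts at \<open>x\<close>.\<close>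
  have "f x = \<langle>y, x\<rangle>" if x: "x \<in> carrier H" for x
    using Re0[OF x] Re0[of "\<i> \<odot> x"] x y(1) by (simp add: smult form_smult_right complex_eq_iff)
  then show ?thesis using y(1) that by blast
qed

end

context
  fixes H :: "'h hilb" and I :: "'i hilb" and T
  assumes H: "hilbert_space H" and I: "pre_hilbert_space I" and T: "T \<in> bounded_ops H I"
begin

interpretation H: hilbert_space H by (rule H)
interpretation I: pre_hilbert_space I by (rule I)

lemma adjoint_op_eqI:
  assumes "S \<in> bounded_ops I H"
    and "\<And>x y. \<lbrakk>x \<in> carrier H; y \<in> carrier I\<rbrakk> \<Longrightarrow> \<langle>y, T x\<rangle>\<^bsub>I\<^esub> = \<langle>S y, x\<rangle>\<^bsub>H\<^esub>"
  shows "adjoint_op H I T = S"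
  unfolding adjoint_op_def
proof (rule the_equality)
  fix S' assume S': "S' \<in> bounded_ops I H \<and>
     (\<forall>x\<in>carrier H. \<forall>y\<in>carrier I. \<langle>y, T x\<rangle>\<^bsub>I\<^esub> = \<langle>S' y, x\<rangle>\<^bsub>H\<^esub>)"
  show "S' = S"
  proof (rule bounded_ops_eqI[OF conjunct1[OF S'] assms(1)])
    fix y assume y: "y \<in> carrier I"
    have car: "S' y \<in> carrier H" "S y \<in> carrier H" using bounded_opsD(3)[OF conjunct1[OF S'] y] bounded_opsD(3)[OF assms(1) y] .
    show "S' y = S y"
    proof (rule H.vector_eqI[OF car])
      fix z assume z: "z \<in> carrier H"
      have "\<langle>S' y, z\<rangle>\<^bsub>H\<^esub> = \<langle>S y, z\<rangle>\<^bsub>H\<^esub>" using conjunct2[OF S', rule_format, OF z y] assms(2)[OF z y] by simp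
      then show "\<langle>z, S' y\<rangle>\<^bsub>H\<^esub> = \<langle>z, S y\<rangle>\<^bsub>H\<^esub>"
        using H.cinner_commute[OF car(1) z] H.cinner_commute[OF car(2) z] by simp
    qed
  qed
qed (simp add: assms)

text \<open>The Riesz vector of the functional \<open>x \<mapsto> \<langle>y, T x\<rangle>\<close>
  is the value at y. Linearity follows by pairing with arbitrary vectors, and the bound by pairing
  the value with itself.\<close>

lemma adjoint_exists:
  "\<exists>S. S \<in> bounded_ops I H \<and> (\<forall>x\<in>carrier H. \<forall>y\<in>carrier I. \<langle>y, T x\<rangle>\<^bsub>I\<^esub> = \<langle>S y, x\<rangle>\<^bsub>H\<^esub>)"
proof -
  note T' = bounded_opsD[OF T]
  obtain C where C: "0 < C" "\<And>x. x \<in> carrier H \<Longrightarrow> hnorm I (T x) \<le> C * hnorm H x"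
    using bounded_ops_bound[OF H.pre_hilbert_space_axioms T] by blast
  have "\<exists>z\<in>carrier H. \<forall>x\<in>carrier H. \<langle>y, T x\<rangle>\<^bsub>I\<^esub> = \<langle>z, x\<rangle>\<^bsub>H\<^esub>" if y: "y \<in> carrier I" for y
  proof (rule H.Riesz_representation[of "\<lambda>x. \<langle>y, T x\<rangle>\<^bsub>I\<^esub>" "hnorm I y * C"])
    fix x assume x: "x \<in> carrier H"
    have "cmod \<langle>y, T x\<rangle>\<^bsub>I\<^esub> \<le> hnorm I y * hnorm I (T x)"
      using y T'(3)[OF x] by (rule I.cinner_bound)
    also have "\<dots> \<le> hnorm I y * (C * hnorm H x)"
      using y by (intro mult_left_mono C(2)[OF x]) simp
    finally show "cmod \<langle>y, T x\<rangle>\<^bsub>I\<^esub> \<le> hnorm I y * C * hnorm H x" by (simp add: mult.assoc)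
  qed (use y in \<open>auto simp: T'(3-5) I.form_add_right I.form_smult_right\<close>)
  then obtain S0 where S0: "\<And>y. y \<in> carrier I \<Longrightarrow> S0 y \<in> carrier H"
    "\<And>y x. \<lbrakk>y \<in> carrier I; x \<in> carrier H\<rbrakk> \<Longrightarrow> \<langle>y, T x\<rangle>\<^bsub>I\<^esub> = \<langle>S0 y, x\<rangle>\<^bsub>H\<^esub>"
    by metis
  have S0': "\<langle>x, S0 y\<rangle>\<^bsub>H\<^esub> = \<langle>T x, y\<rangle>\<^bsub>I\<^esub>" if "y \<in> carrier I" "x \<in> carrier H" for x y
    using S0(2)[OF that] H.cinner_commute[OF S0(1)[OF that(1)] that(2)]
      I.cinner_commute[OF that(1) T'(3)[OF that(2)]] by simp
  define S where "S = restrict S0 (carrier I)"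
  have "S \<in> bounded_ops I H"
  proof (rule bounded_opsI[where C = C])
    show "S \<in> linear_maps I H"
      unfolding S_def
      by (rule linear_mapsI; (simp add: S0(1))?; rule H.vector_eqI)
        (simp_all add: S0(1) S0' T'(3) I.form_add_right I.form_smult_right H.form_add_right
          H.form_smult_right)
    show "hnorm H (S y) \<le> C * hnorm I y" if y: "y \<in> carrier I" for y
    proof -
      define n where "n = hnorm H (S0 y)"
      have n: "0 \<le> n" using S0(1)[OF y] by (simp add: n_def)
      have "n\<^sup>2 = cmod \<langle>S0 y, S0 y\<rangle>\<^bsub>H\<^esub>"
        using H.cinner_self[OF S0(1)[OF y]] by (simp add: n_def norm_power)
      also have "\<dots> = cmod \<langle>y, T (S0 y)\<rangle>\<^bsub>I\<^esub>" using S0(2)[OF y S0(1)[OF y]] by simp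
      also have "\<dots> \<le> hnorm I y * hnorm I (T (S0 y))"
        using y by (intro I.cinner_bound T'(3) S0(1))
      also have "\<dots> \<le> hnorm I y * (C * n)"
        unfolding n_def using y by (intro mult_left_mono C(2) S0(1)) simp_all
      finally have "n * n \<le> C * hnorm I y * n" by (simp add: power2_eq_square mult_ac)
      then have "n \<le> C * hnorm I y"
        using n C(1) y by (cases "n = 0") simp_all
      then show ?thesis using y by (simp add: S_def n_def)
    qed
  qed (simp add: S_def)
  moreover have "\<forall>x\<in>carrier H. \<forall>y\<in>carrier I. \<langle>y, T x\<rangle>\<^bsub>I\<^esub> = \<langle>S y, x\<rangle>\<^bsub>H\<^esub>"
    by (simp add: S_def S0(2))
  ultimately show ?thesis by blast
qed

lemma adjoint_op_bounded: "adjoint_op H I T \<in> bounded_ops I H"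
  by (rule exE[OF adjoint_exists], subst adjoint_op_eqI) auto

lemma adjoint_op_cinner:
  "\<lbrakk>x \<in> carrier H; y \<in> carrier I\<rbrakk> \<Longrightarrow> \<langle>y, T x\<rangle>\<^bsub>I\<^esub> = \<langle>adjoint_op H I T y, x\<rangle>\<^bsub>H\<^esub>"
  by (rule exE[OF adjoint_exists], subst adjoint_op_eqI) auto

end

lemma adjoint_op_cinner_right:
  assumes "hilbert_space H" "pre_hilbert_space I" "T \<in> bounded_ops H I" "x \<in> carrier H" "y \<in> carrier I"
  shows "\<langle>x, adjoint_op H I T y\<rangle>\<^bsub>H\<^esub> = \<langle>T x, y\<rangle>\<^bsub>I\<^esub>"
proof -
  interpret H: hilbert_space H by fact
  interpret I: pre_hilbert_space I by fact
  show ?thesis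
    using H.cinner_commute[OF bounded_opsD(3)[OF adjoint_op_bounded[OF assms(1-3)] assms(5)] assms(4)]
      I.cinner_commute[OF assms(5) bounded_opsD(3)[OF assms(3,4)]]
      adjoint_op_cinner[OF assms] by simp
qed

section \<open>Sums and multiples of bounded operators\<close>

lemma op_alg_simps [simp]:
  "carrier (op_alg H) = bounded_ops H H" "monoid.mult (op_alg H) = compose (carrier H)"
  "one (op_alg H) = id_op H" "zero (op_alg H) = (\<lambda>x\<in>carrier H. \<zero>\<^bsub>H\<^esub>)"
  "add (op_alg H) = (\<lambda>S T. \<lambda>x\<in>carrier H. S x \<oplus>\<^bsub>H\<^esub> T x)"
  "smult (op_alg H) = (\<lambda>c T. \<lambda>x\<in>carrier H. c \<odot>\<^bsub>H\<^esub> T x)"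
  "star (op_alg H) = adjoint_op H H"
  by (simp_all add: op_alg_def)

context pre_hilbert_space
begin

lemma op_add_bounded:
  assumes "S \<in> bounded_ops H H" "T \<in> bounded_ops H H"
  shows "(\<lambda>x\<in>carrier H. S x \<oplus> T x) \<in> bounded_ops H H"
proof -
  obtain C where C: "0 < C" "\<And>x. x \<in> carrier H \<Longrightarrow> hnorm H (S x) \<le> C * hnorm H x"
    using bounded_ops_bound[OF pre_hilbert_space_axioms assms(1)] by blast
  obtain D where D: "0 < D" "\<And>x. x \<in> carrier H \<Longrightarrow> hnorm H (T x) \<le> D * hnorm H x"
    using bounded_ops_bound[OF pre_hilbert_space_axioms assms(2)] by blast
  note S = bounded_opsD[OF assms(1)] and T = bounded_opsD[OF assms(2)]
  show ?thesis
  proof (rule bounded_opsI[where C = "C + D"])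
    show "(\<lambda>x\<in>carrier H. S x \<oplus> T x) \<in> linear_maps H H"
      by (rule linear_mapsI; (simp add: S(3) T(3))?; rule vector_eqI)
        (simp_all add: S(3-5) T(3-5) form_add_right form_smult_right algebra_simps)
    fix x assume x: "x \<in> carrier H"
    show "hnorm H ((\<lambda>x\<in>carrier H. S x \<oplus> T x) x) \<le> (C + D) * hnorm H x"
      using hnorm_triangle[OF S(3)[OF x] T(3)[OF x]] C(2)[OF x] D(2)[OF x] x
      by (simp add: algebra_simps)
  qed simp
qed

lemma op_smult_bounded:
  assumes "T \<in> bounded_ops H H" shows "(\<lambda>x\<in>carrier H. c \<odot> T x) \<in> bounded_ops H H"
proof -
  obtain C where C: "0 < C" "\<And>x. x \<in> carrier H \<Longrightarrow> hnorm H (T x) \<le> C * hnorm H x"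
    using bounded_ops_bound[OF pre_hilbert_space_axioms assms] by blast
  note T = bounded_opsD[OF assms]
  show ?thesis
  proof (rule bounded_opsI[where C = "cmod c * C"])
    show "(\<lambda>x\<in>carrier H. c \<odot> T x) \<in> linear_maps H H"
      by (rule linear_mapsI; (simp add: T(3))?; rule vector_eqI)
        (simp_all add: T(3-5) form_add_right form_smult_right algebra_simps)
    fix x assume x: "x \<in> carrier H"
    show "hnorm H ((\<lambda>x\<in>carrier H. c \<odot> T x) x) \<le> cmod c * C * hnorm H x"
      using mult_left_mono[OF C(2)[OF x], of "cmod c"] x by (simp add: T(3) hnorm_smult mult.assoc)
  qed simp
qed

lemma op_zero_bounded: "(\<lambda>x\<in>carrier H. \<zero>) \<in> bounded_ops H H"
  by (rule bounded_opsI[where C = 0]) (simp_all add: linear_maps_def)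

lemma abelian_monoid_op_alg: "abelian_monoid (op_alg H)"
proof (rule abelian_monoidI)
  fix R S T assume "R \<in> carrier (op_alg H)" "S \<in> carrier (op_alg H)" "T \<in> carrier (op_alg H)"
  then have R: "R \<in> bounded_ops H H" and S: "S \<in> bounded_ops H H" and T: "T \<in> bounded_ops H H"
    by simp_all
  note c = bounded_opsD(3)[OF R] bounded_opsD(3)[OF S] bounded_opsD(3)[OF T]
  show "R \<oplus>\<^bsub>op_alg H\<^esub> S \<in> carrier (op_alg H)" using op_add_bounded R S by simp
  show "R \<oplus>\<^bsub>op_alg H\<^esub> S \<oplus>\<^bsub>op_alg H\<^esub> T = R \<oplus>\<^bsub>op_alg H\<^esub> (S \<oplus>\<^bsub>op_alg H\<^esub> T)"
    by (auto simp: c a_assoc intro!: restrict_ext)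
  show "\<zero>\<^bsub>op_alg H\<^esub> \<oplus>\<^bsub>op_alg H\<^esub> R = R"
    using c bounded_opsD(2)[OF R] by (auto simp: fun_eq_iff extensional_def)
  show "R \<oplus>\<^bsub>op_alg H\<^esub> S = S \<oplus>\<^bsub>op_alg H\<^esub> R"
    using a_comm c by (auto intro!: restrict_ext)
qed (simp add: op_zero_bounded)

text \<open>The entries of a product of operator matrices are finite sums in
  \<open>op_alg H\<close>; pairing with vectors turns them into sums of complex numbers.\<close>

lemma cinner_finsum_op:
  fixes n :: nat
  assumes "\<And>k. k < n \<Longrightarrow> T k \<in> bounded_ops H H" and v: "v \<in> carrier H" and w: "w \<in> carrier H"
  shows "\<langle>v, (\<Oplus>\<^bsub>op_alg H\<^esub>k\<in>{..<n}. T k) w\<rangle> = (\<Sum>k<n. \<langle>v, T k w\<rangle>)"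
  using assms(1)
proof (induction n)
  case 0
  interpret A: abelian_monoid "op_alg H" by (rule abelian_monoid_op_alg)
  show ?case using v w by simp
next
  case (Suc n)
  interpret A: abelian_monoid "op_alg H" by (rule abelian_monoid_op_alg)
  have T: "T \<in> {..<n} \<rightarrow> carrier (op_alg H)" "T n \<in> carrier (op_alg H)" using Suc.prems by auto
  have "(\<Oplus>\<^bsub>op_alg H\<^esub>k\<in>{..<Suc n}. T k) = T n \<oplus>\<^bsub>op_alg H\<^esub> (\<Oplus>\<^bsub>op_alg H\<^esub>k\<in>{..<n}. T k)"
    unfolding lessThan_Suc by (rule A.finsum_insert) (use T in auto)
  moreover have "(\<Oplus>\<^bsub>op_alg H\<^esub>k\<in>{..<n}. T k) w \<in> carrier H"
    using A.finsum_closed[OF T(1)] bounded_opsD(3) w by (metis op_alg_simps(1))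
  moreover have "T n w \<in> carrier H" using T(2) bounded_opsD(3) w by (metis op_alg_simps(1))
  ultimately show ?case using Suc v w by (simp add: form_add_right)
qed

end

section \<open>Extension from dense subspaces\<close>

definition dense_in :: "'h hilb \<Rightarrow> 'h set \<Rightarrow> bool" where
  "dense_in H S \<longleftrightarrow> (\<forall>y\<in>carrier H. \<forall>e>0. \<exists>x\<in>S. hnorm H (y \<ominus>\<^bsub>H\<^esub> x) < e)"

lemma dense_inD:
  assumes "dense_in H S" "y \<in> carrier H" "0 < e"
  obtains x where "x \<in> S" "hnorm H (y \<ominus>\<^bsub>H\<^esub> x) < e"
  using assms unfolding dense_in_def by blast

lemma dense_in_mono:
  assumes "dense_in H S" "S \<subseteq> T" shows "dense_in H T"
  unfolding dense_in_def
proof (intro ballI allI impI)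
  fix y and e :: real assume "y \<in> carrier H" "0 < e"
  then obtain x where "x \<in> S" "hnorm H (y \<ominus>\<^bsub>H\<^esub> x) < e" by (rule dense_inD[OF assms(1)])
  then show "\<exists>x\<in>T. hnorm H (y \<ominus>\<^bsub>H\<^esub> x) < e" using assms(2) by blast
qed

lemma (in pre_hilbert_space) eq_if_arbitrarily_close:
  assumes "x \<in> carrier H" "y \<in> carrier H" "\<And>e. 0 < e \<Longrightarrow> hnorm H (x \<ominus> y) \<le> K * e" "0 \<le> K"
  shows "x = y"
proof -
  have "hnorm H (x \<ominus> y) \<le> 0"
  proof (rule field_le_epsilon)
    fix e :: real assume "0 < e"
    \<comment> \<open>Dividing by \<open>K + 1\<close> rather than \<open>K\<close> covers
      \<open>K = 0\<close>.\<close>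
    have "K * (e / (K + 1)) \<le> e" using assms(4) \<open>0 < e\<close> by (simp add: field_simps)
    then show "hnorm H (x \<ominus> y) \<le> 0 + e"
      using assms(3)[of "e / (K + 1)"] assms(4) \<open>0 < e\<close> by simp
  qed
  then have "hnorm H (x \<ominus> y) = 0" using hnorm_nonneg[of "x \<ominus> y"] assms(1,2) by (intro order.antisym) simp_all
  then show ?thesis using eq_iff_hnorm_minus[OF assms(1,2)] by simp
qed

text \<open>With \<open>d = x \<ominus> y\<close> and z in \<open>D\<close> close to d,
  orthogonality of d and z gives
  \<open>\<langle>d, d\<rangle> = \<langle>d, d \<ominus> z\<rangle>\<close>, so the norm of d is at
  most the distance from d to z.\<close>

lemma (in pre_hilbert_space) eq_if_cinner_dense:
  assumes D: "dense_in H D" "D \<subseteq> carrier H" and x: "x \<in> carrier H" and y: "y \<in> carrier H"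
    and eq: "\<And>z. z \<in> D \<Longrightarrow> \<langle>x, z\<rangle> = \<langle>y, z\<rangle>"
  shows "x = y"
proof (rule eq_if_arbitrarily_close[OF x y, where K = 1])
  fix e :: real assume e: "0 < e"
  let ?d = "x \<ominus> y"
  have d: "?d \<in> carrier H" using x y by simp
  obtain z where z: "z \<in> D" "hnorm H (?d \<ominus> z) < e" by (rule dense_inD[OF D(1) d e])
  have zH: "z \<in> carrier H" using z(1) D(2) by blast
  have "\<langle>?d, z\<rangle> = 0" using eq[OF z(1)] x y zH by (simp add: form_diff_left)
  then have "\<langle>?d, ?d\<rangle> = \<langle>?d, ?d \<ominus> z\<rangle>" using form_diff_right[OF d d zH] by simp
  then have "(hnorm H ?d)\<^sup>2 \<le> hnorm H ?d * hnorm H (?d \<ominus> z)"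
    using hnorm_power2[OF d] complex_Re_le_cmod[of "\<langle>?d, ?d \<ominus> z\<rangle>"] cinner_bound[of ?d "?d \<ominus> z"] d zH
    by simp
  also have "\<dots> \<le> hnorm H ?d * e" using z(2) hnorm_nonneg[OF d] by (intro mult_left_mono) simp_all
  finally have "hnorm H ?d * hnorm H ?d \<le> hnorm H ?d * e" by (simp add: power2_eq_square)
  then show "hnorm H ?d \<le> 1 * e"
    using e hnorm_nonneg[OF d] by (cases "hnorm H ?d = 0") (simp_all del: hnorm_eq_zero)
qed simp

lemma bounded_ops_eq_dense:
  assumes "pre_hilbert_space H" "pre_hilbert_space I" "dense_in H D" "D \<subseteq> carrier H"
    and ST: "S \<in> bounded_ops H I" "T \<in> bounded_ops H I"
    and eq: "\<And>x. x \<in> D \<Longrightarrow> S x = T x"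
  shows "S = T"
proof (rule bounded_ops_eqI[OF ST])
  interpret H: pre_hilbert_space H by fact
  interpret I: pre_hilbert_space I by fact
  obtain A where A: "0 < A" "\<And>x. x \<in> carrier H \<Longrightarrow> hnorm I (S x) \<le> A * hnorm H x"
    using bounded_ops_bound[OF assms(1) ST(1)] by blast
  obtain B where B: "0 < B" "\<And>x. x \<in> carrier H \<Longrightarrow> hnorm I (T x) \<le> B * hnorm H x"
    using bounded_ops_bound[OF assms(1) ST(2)] by blast
  fix y assume y: "y \<in> carrier H"
  note car = bounded_opsD(3)[OF ST(1)] bounded_opsD(3)[OF ST(2)]
  show "S y = T y"
  proof (rule I.eq_if_arbitrarily_close[OF car(1)[OF y] car(2)[OF y]])
    fix e :: real assume "0 < e"
    obtain x where x: "x \<in> D" "hnorm H (y \<ominus>\<^bsub>H\<^esub> x) < e"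
      by (rule dense_inD[OF assms(3) y \<open>0 < e\<close>])
    have xH: "x \<in> carrier H" using x(1) assms(4) by blast
    have yx: "y \<ominus>\<^bsub>H\<^esub> x \<in> carrier H" using y xH by simp
    have "S y \<ominus>\<^bsub>I\<^esub> S x = S (y \<ominus>\<^bsub>H\<^esub> x)" "T y \<ominus>\<^bsub>I\<^esub> T x = T (y \<ominus>\<^bsub>H\<^esub> x)"
      using linear_maps_diff[OF H.module_axioms I.module_axioms bounded_opsD(1) y xH] ST by simp_all
    then have "hnorm I (S y \<ominus>\<^bsub>I\<^esub> S x) \<le> A * hnorm H (y \<ominus>\<^bsub>H\<^esub> x)"
      "hnorm I (T x \<ominus>\<^bsub>I\<^esub> T y) \<le> B * hnorm H (y \<ominus>\<^bsub>H\<^esub> x)"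
      using A(2)[OF yx] B(2)[OF yx] I.hnorm_minus_commute[OF car(2)[OF xH] car(2)[OF y]] by simp_all
    moreover have "A * hnorm H (y \<ominus>\<^bsub>H\<^esub> x) \<le> A * e" "B * hnorm H (y \<ominus>\<^bsub>H\<^esub> x) \<le> B * e"
      using x(2) A(1) B(1) by simp_all
    ultimately show "hnorm I (S y \<ominus>\<^bsub>I\<^esub> T y) \<le> (A + B) * e"
      using I.hnorm_triangle_minus[OF car(1)[OF y] car(1)[OF xH] car(2)[OF y]] eq[OF x(1)]
      by (simp add: algebra_simps)
  qed (use A(1) B(1) in simp)
qed

text \<open>The operator is prescribed through a parameter space \<open>X\<close>: \<open>q\<close>
  names the points and \<open>r\<close> the values. Where \<open>q\<close> identifies parameters,
  the bound forces \<open>r\<close> to identify them too, so nothing has to be checked on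
  classes.\<close>

lemma bounded_extension:
  assumes X: "Module.module complex_field X" and "pre_hilbert_space H" "hilbert_space I"
    and q: "q \<in> linear_maps X H" and r: "r \<in> linear_maps X I"
    and bound: "\<And>x. x \<in> carrier X \<Longrightarrow> hnorm I (r x) \<le> C * hnorm H (q x)"
    and dense: "dense_in H (q ` carrier X)"
  shows "\<exists>T\<in>bounded_ops H I. \<forall>x\<in>carrier X. T (q x) = r x"
proof -
  interpret X: Module.module complex_field X by fact
  interpret H: pre_hilbert_space H by fact
  interpret I: hilbert_space I by fact
  note q' = linear_mapsD[OF q] and r' = linear_mapsD[OF r]
  have qd: "q (x \<ominus>\<^bsub>X\<^esub> y) = q x \<ominus>\<^bsub>H\<^esub> q y" if "x \<in> carrier X" "y \<in> carrier X" for x y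
    using linear_maps_diff[OF X H.module_axioms q that] .
  have rd: "r (x \<ominus>\<^bsub>X\<^esub> y) = r x \<ominus>\<^bsub>I\<^esub> r y" if "x \<in> carrier X" "y \<in> carrier X" for x y
    using linear_maps_diff[OF X I.module_axioms r that] .
  \<comment> \<open>Strictly positive, as it appears in denominators below.\<close>
  define K where "K = \<bar>C\<bar> + 1"
  have K: "0 < K" by (simp add: K_def)
  have boundK: "hnorm I (r x \<ominus>\<^bsub>I\<^esub> r y) \<le> K * hnorm H (q x \<ominus>\<^bsub>H\<^esub> q y)"
    if "x \<in> carrier X" "y \<in> carrier X" for x y
  proof -
    have "x \<ominus>\<^bsub>X\<^esub> y \<in> carrier X" using that by simp
    moreover have "C * hnorm H (q (x \<ominus>\<^bsub>X\<^esub> y)) \<le> K * hnorm H (q (x \<ominus>\<^bsub>X\<^esub> y))"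
      using q'(1)[OF calculation] by (intro mult_right_mono) (simp_all add: K_def)
    ultimately show ?thesis using bound[of "x \<ominus>\<^bsub>X\<^esub> y"] that by (simp add: qd rd)
  qed
  define Q where "Q y z \<longleftrightarrow> z \<in> carrier I \<and>
    (\<forall>x\<in>carrier X. hnorm I (r x \<ominus>\<^bsub>I\<^esub> z) \<le> K * hnorm H (q x \<ominus>\<^bsub>H\<^esub> y))" for y z
  have approx: "\<exists>x\<in>carrier X. hnorm H (q x \<ominus>\<^bsub>H\<^esub> y) < e" if y: "y \<in> carrier H" and e: "0 < e" for y e
  proof -
    obtain u where u: "u \<in> q ` carrier X" "hnorm H (y \<ominus>\<^bsub>H\<^esub> u) < e"
      by (rule dense_inD[OF dense y e])
    then obtain x where x: "x \<in> carrier X" "u = q x" by blast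
    then show ?thesis using u(2) H.hnorm_minus_commute[OF y q'(1)[OF x(1)]] by auto
  qed
  have Q_ex: "\<exists>z. Q y z" if y: "y \<in> carrier H" for y
  proof -
    have "\<forall>n. \<exists>x\<in>carrier X. hnorm H (q x \<ominus>\<^bsub>H\<^esub> y) < 1 / real (Suc n)"
      using approx[OF y] by simp
    then obtain s where s: "\<And>n. s n \<in> carrier X" "\<And>n. hnorm H (q (s n) \<ominus>\<^bsub>H\<^esub> y) < 1 / real (Suc n)"
      by metis
    have "I.metric.MCauchy (\<lambda>n. r (s n))"
      unfolding I.MCauchy_iff
    proof (intro conjI allI impI)
      show "r (s n) \<in> carrier I" for n using r'(1) s(1) by blast
      fix e :: real assume "0 < e"
      then obtain N where N: "1 / real (Suc N) < e / (2 * K)"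
        using nat_approx_posE[of "e / (2 * K)"] K by auto
      have "hnorm I (r (s i) \<ominus>\<^bsub>I\<^esub> r (s j)) < e" if "N \<le> i" "N \<le> j" for i j
      proof -
        have "1 / real (Suc i) \<le> 1 / real (Suc N)" "1 / real (Suc j) \<le> 1 / real (Suc N)"
          using that by (simp_all add: frac_le)
        then have "hnorm H (q (s i) \<ominus>\<^bsub>H\<^esub> q (s j)) < 2 * (e / (2 * K))"
          using H.hnorm_triangle_minus[OF q'(1)[OF s(1)] y q'(1)[OF s(1)], of i j] s(2)[of i] s(2)[of j]
            H.hnorm_minus_commute[OF y q'(1)[OF s(1)], of j] N by simp
        then have "K * hnorm H (q (s i) \<ominus>\<^bsub>H\<^esub> q (s j)) < e" using K by (simp add: field_simps)
        then show ?thesis using boundK[OF s(1) s(1), of i j] by linarith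
      qed
      then show "\<exists>N. \<forall>i\<ge>N. \<forall>j\<ge>N. hnorm I (r (s i) \<ominus>\<^bsub>I\<^esub> r (s j)) < e" by blast
    qed
    then obtain z where z: "z \<in> carrier I" "(\<lambda>n. hnorm I (r (s n) \<ominus>\<^bsub>I\<^esub> z)) \<longlonglongrightarrow> 0"
      by (rule I.Cauchy_limit)
    \<comment> \<open>Insert \<open>r (s n)\<close> between \<open>r x\<close> and z, and let n tend
      to infinity.\<close>
    have "hnorm I (r x \<ominus>\<^bsub>I\<^esub> z) \<le> K * hnorm H (q x \<ominus>\<^bsub>H\<^esub> y)" if x: "x \<in> carrier X" for x
    proof (rule LIMSEQ_le_const)
      show "(\<lambda>n. K * (hnorm H (q x \<ominus>\<^bsub>H\<^esub> y) + 1 / real (Suc n)) + hnorm I (r (s n) \<ominus>\<^bsub>I\<^esub> z)) \<longlonglongrightarrow>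
        K * hnorm H (q x \<ominus>\<^bsub>H\<^esub> y)"
        using tendsto_add[OF tendsto_mult_left[OF tendsto_add[OF tendsto_const
          LIMSEQ_inverse_real_of_nat]] z(2), of K "hnorm H (q x \<ominus>\<^bsub>H\<^esub> y)"]
        by (simp add: inverse_eq_divide)
      have "hnorm I (r x \<ominus>\<^bsub>I\<^esub> z) \<le> K * (hnorm H (q x \<ominus>\<^bsub>H\<^esub> y) + 1 / real (Suc n)) + hnorm I (r (s n) \<ominus>\<^bsub>I\<^esub> z)"
        for n
      proof -
        have "hnorm H (q x \<ominus>\<^bsub>H\<^esub> q (s n)) \<le> hnorm H (q x \<ominus>\<^bsub>H\<^esub> y) + 1 / real (Suc n)"
          using H.hnorm_triangle_minus[OF q'(1)[OF x] y q'(1)[OF s(1)], of n] s(2)[of n]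
            H.hnorm_minus_commute[OF y q'(1)[OF s(1)], of n] by linarith
        then have "K * hnorm H (q x \<ominus>\<^bsub>H\<^esub> q (s n)) \<le> K * (hnorm H (q x \<ominus>\<^bsub>H\<^esub> y) + 1 / real (Suc n))"
          using K by simp
        then show ?thesis
          using I.hnorm_triangle_minus[OF r'(1)[OF x] r'(1)[OF s(1)] z(1), of n] boundK[OF x s(1), of n]
          by linarith
      qed
      then show "\<exists>N. \<forall>n\<ge>N. hnorm I (r x \<ominus>\<^bsub>I\<^esub> z) \<le>
          K * (hnorm H (q x \<ominus>\<^bsub>H\<^esub> y) + 1 / real (Suc n)) + hnorm I (r (s n) \<ominus>\<^bsub>I\<^esub> z)"
        by blast
    qed
    then show ?thesis using z(1) unfolding Q_def by blast
  qed
  then obtain T0 where T0: "\<And>y. y \<in> carrier H \<Longrightarrow> Q y (T0 y)" by metis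
  have T0c: "T0 y \<in> carrier I" if "y \<in> carrier H" for y using T0[OF that] by (simp add: Q_def)
  have T0b: "hnorm I (r x \<ominus>\<^bsub>I\<^esub> T0 y) \<le> K * hnorm H (q x \<ominus>\<^bsub>H\<^esub> y)"
    if "x \<in> carrier X" "y \<in> carrier H" for x y
    using T0[OF that(2)] that(1) by (simp add: Q_def)
  have T0b': "hnorm I (T0 y \<ominus>\<^bsub>I\<^esub> r x) \<le> K * hnorm H (q x \<ominus>\<^bsub>H\<^esub> y)"
    if "x \<in> carrier X" "y \<in> carrier H" for x y
    using T0b[OF that] I.hnorm_minus_commute[OF T0c[OF that(2)] r'(1)[OF that(1)]] by simp
  have T0_add: "T0 (y \<oplus>\<^bsub>H\<^esub> y') = T0 y \<oplus>\<^bsub>I\<^esub> T0 y'" if y: "y \<in> carrier H" "y' \<in> carrier H" for y y'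
  \<comment> \<open>Both sides are compared with \<open>r (x \<oplus> x')\<close>; each lies within
    \<open>2 * K * e\<close> of it.\<close>
  proof (rule I.eq_if_arbitrarily_close[where K = "4 * K"])
    fix e :: real assume e: "0 < e"
    obtain x where x: "x \<in> carrier X" "hnorm H (q x \<ominus>\<^bsub>H\<^esub> y) < e" using approx[OF y(1) e] by blast
    obtain x' where x': "x' \<in> carrier X" "hnorm H (q x' \<ominus>\<^bsub>H\<^esub> y') < e" using approx[OF y(2) e] by blast
    let ?w = "x \<oplus>\<^bsub>X\<^esub> x'"
    have w: "?w \<in> carrier X" using x(1) x'(1) by simp
    have yy: "y \<oplus>\<^bsub>H\<^esub> y' \<in> carrier H" using y by simp
    have "q ?w \<ominus>\<^bsub>H\<^esub> (y \<oplus>\<^bsub>H\<^esub> y') = (q x \<ominus>\<^bsub>H\<^esub> y) \<oplus>\<^bsub>H\<^esub> (q x' \<ominus>\<^bsub>H\<^esub> y')"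
      by (rule H.vector_eqI) (simp_all add: q'(1,2) x(1) x'(1) y H.cinner_right_simps)
    then have "hnorm H (q ?w \<ominus>\<^bsub>H\<^esub> (y \<oplus>\<^bsub>H\<^esub> y')) \<le> 2 * e"
      using H.hnorm_triangle[of "q x \<ominus>\<^bsub>H\<^esub> y" "q x' \<ominus>\<^bsub>H\<^esub> y'"] x x' y q'(1) by simp
    then have 1: "hnorm I (T0 (y \<oplus>\<^bsub>H\<^esub> y') \<ominus>\<^bsub>I\<^esub> r ?w) \<le> K * (2 * e)"
      using order.trans[OF T0b'[OF w yy] mult_left_mono] K by simp
    have "r ?w \<ominus>\<^bsub>I\<^esub> (T0 y \<oplus>\<^bsub>I\<^esub> T0 y') = (r x \<ominus>\<^bsub>I\<^esub> T0 y) \<oplus>\<^bsub>I\<^esub> (r x' \<ominus>\<^bsub>I\<^esub> T0 y')"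
      by (rule I.vector_eqI) (simp_all add: r'(1,2) x(1) x'(1) y T0c I.cinner_right_simps)
    moreover have "hnorm I (r x \<ominus>\<^bsub>I\<^esub> T0 y) \<le> K * e"
      using order.trans[OF T0b[OF x(1) y(1)] mult_left_mono] x(2) K by simp
    moreover have "hnorm I (r x' \<ominus>\<^bsub>I\<^esub> T0 y') \<le> K * e"
      using order.trans[OF T0b[OF x'(1) y(2)] mult_left_mono] x'(2) K by simp
    ultimately have 2: "hnorm I (r ?w \<ominus>\<^bsub>I\<^esub> (T0 y \<oplus>\<^bsub>I\<^esub> T0 y')) \<le> K * e + K * e"
      using I.hnorm_triangle[of "r x \<ominus>\<^bsub>I\<^esub> T0 y" "r x' \<ominus>\<^bsub>I\<^esub> T0 y'"] x(1) x'(1) y T0c r'(1) by simp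
    show "hnorm I (T0 (y \<oplus>\<^bsub>H\<^esub> y') \<ominus>\<^bsub>I\<^esub> (T0 y \<oplus>\<^bsub>I\<^esub> T0 y')) \<le> 4 * K * e"
      using I.hnorm_triangle_minus[of "T0 (y \<oplus>\<^bsub>H\<^esub> y')" "r ?w" "T0 y \<oplus>\<^bsub>I\<^esub> T0 y'"] 1 2 T0c yy y r'(1)[OF w]
      by simp
  qed (use y T0c K in simp_all)
  have T0_smult: "T0 (c \<odot>\<^bsub>H\<^esub> y) = c \<odot>\<^bsub>I\<^esub> T0 y" if y: "y \<in> carrier H" for c y
  proof (rule I.eq_if_arbitrarily_close[where K = "2 * cmod c * K"])
    fix e :: real assume e: "0 < e"
    obtain x where x: "x \<in> carrier X" "hnorm H (q x \<ominus>\<^bsub>H\<^esub> y) < e" using approx[OF y(1) e] by blast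
    let ?w = "c \<odot>\<^bsub>X\<^esub> x"
    have w: "?w \<in> carrier X" using x(1) by simp
    have yy: "c \<odot>\<^bsub>H\<^esub> y \<in> carrier H" using y by simp
    have "q ?w \<ominus>\<^bsub>H\<^esub> (c \<odot>\<^bsub>H\<^esub> y) = c \<odot>\<^bsub>H\<^esub> (q x \<ominus>\<^bsub>H\<^esub> y)"
      by (rule H.vector_eqI) (simp_all add: q'(1,3) x(1) y H.cinner_right_simps algebra_simps)
    then have "hnorm H (q ?w \<ominus>\<^bsub>H\<^esub> (c \<odot>\<^bsub>H\<^esub> y)) \<le> cmod c * e"
      using x y q'(1) mult_left_mono[of "hnorm H (q x \<ominus>\<^bsub>H\<^esub> y)" e "cmod c"] by (simp add: H.hnorm_smult)
    then have 1: "hnorm I (T0 (c \<odot>\<^bsub>H\<^esub> y) \<ominus>\<^bsub>I\<^esub> r ?w) \<le> K * (cmod c * e)"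
      using order.trans[OF T0b'[OF w yy] mult_left_mono] K by simp
    have "r ?w \<ominus>\<^bsub>I\<^esub> (c \<odot>\<^bsub>I\<^esub> T0 y) = c \<odot>\<^bsub>I\<^esub> (r x \<ominus>\<^bsub>I\<^esub> T0 y)"
      by (rule I.vector_eqI) (simp_all add: r'(1,3) x(1) y T0c I.cinner_right_simps algebra_simps)
    moreover have "hnorm I (r x \<ominus>\<^bsub>I\<^esub> T0 y) \<le> K * e"
      using order.trans[OF T0b[OF x(1) y(1)] mult_left_mono] x(2) K by simp
    ultimately have 2: "hnorm I (r ?w \<ominus>\<^bsub>I\<^esub> (c \<odot>\<^bsub>I\<^esub> T0 y)) \<le> cmod c * (K * e)"
      using x(1) y T0c r'(1) mult_left_mono[of "hnorm I (r x \<ominus>\<^bsub>I\<^esub> T0 y)" "K * e" "cmod c"]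
      by (simp add: I.hnorm_smult)
    show "hnorm I (T0 (c \<odot>\<^bsub>H\<^esub> y) \<ominus>\<^bsub>I\<^esub> (c \<odot>\<^bsub>I\<^esub> T0 y)) \<le> 2 * cmod c * K * e"
      using I.hnorm_triangle_minus[of "T0 (c \<odot>\<^bsub>H\<^esub> y)" "r ?w" "c \<odot>\<^bsub>I\<^esub> T0 y"] 1 2 T0c yy y r'(1)[OF w]
      by (simp add: algebra_simps)
  qed (use y T0c K in simp_all)
  \<comment> \<open>The estimate in \<open>Q\<close> at the zero parameter.\<close>
  have T0_bound: "hnorm I (T0 y) \<le> K * hnorm H y" if y: "y \<in> carrier H" for y
  proof -
    have "q \<zero>\<^bsub>X\<^esub> = \<zero>\<^bsub>H\<^esub>" "r \<zero>\<^bsub>X\<^esub> = \<zero>\<^bsub>I\<^esub>"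
      using linear_maps_zero[OF X H.module_axioms q] linear_maps_zero[OF X I.module_axioms r] by simp_all
    then show ?thesis
      using T0b[of "\<zero>\<^bsub>X\<^esub>" y] y T0c[OF y] by (simp add: a_minus_def H.hnorm_uminus I.hnorm_uminus)
  qed
  \<comment> \<open>The estimate in \<open>Q\<close> at \<open>y = q x\<close>, where its right-hand
    side is zero.\<close>
  have T0_q: "T0 (q x) = r x" if x: "x \<in> carrier X" for x
  proof -
    have "hnorm I (T0 (q x) \<ominus>\<^bsub>I\<^esub> r x) \<le> 0"
      using T0b'[OF x q'(1)[OF x]] H.eq_iff_hnorm_minus[of "q x" "q x"] q'(1)[OF x] by simp
    then have "hnorm I (T0 (q x) \<ominus>\<^bsub>I\<^esub> r x) = 0"
      using I.hnorm_nonneg[of "T0 (q x) \<ominus>\<^bsub>I\<^esub> r x"] T0c[OF q'(1)[OF x]] r'(1)[OF x]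
      by (intro order.antisym) simp_all
    then show ?thesis using I.eq_iff_hnorm_minus[OF T0c[OF q'(1)[OF x]] r'(1)[OF x]] by simp
  qed
  show ?thesis
  proof (intro bexI ballI)
    show "restrict T0 (carrier H) \<in> bounded_ops H I"
      by (rule bounded_opsI[where C = K])
        (simp_all add: linear_maps_def T0c T0_add T0_smult T0_bound)
    show "restrict T0 (carrier H) (q x) = r x" if "x \<in> carrier X" for x
      using that by (simp add: q'(1) T0_q)
  qed
qed

section \<open>The Hilbert space completion\<close>

lemma cauchy_space_simps [simp]:
  "carrier (cauchy_space P) = {s. Metric_space.MCauchy (carrier P) (hdist P) s}"
  "zero (cauchy_space P) = (\<lambda>n. \<zero>\<^bsub>P\<^esub>)"
  "add (cauchy_space P) = (\<lambda>s t n. s n \<oplus>\<^bsub>P\<^esub> t n)"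
  "smult (cauchy_space P) = (\<lambda>c s n. c \<odot>\<^bsub>P\<^esub> s n)"
  by (simp_all add: cauchy_space_def)

definition cauchy_form :: "'h hilb \<Rightarrow> (nat \<Rightarrow> 'h) \<Rightarrow> (nat \<Rightarrow> 'h) \<Rightarrow> complex" where
  "cauchy_form P s t = lim (\<lambda>n. \<langle>s n, t n\<rangle>\<^bsub>P\<^esub>)"

context pre_hilbert_space
begin

lemma MCauchy_carrier: "metric.MCauchy s \<Longrightarrow> s n \<in> carrier H"
  by (simp add: MCauchy_iff)

lemma MCauchy_dominated:
  assumes s: "metric.MCauchy s" and t: "metric.MCauchy t" and u: "\<And>n. u n \<in> carrier H"
    and le: "\<And>m n. hnorm H (u m \<ominus> u n) \<le> K * (hnorm H (s m \<ominus> s n) + hnorm H (t m \<ominus> t n))"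
    and K: "0 < K"
  shows "metric.MCauchy u"
  unfolding MCauchy_iff
proof (intro conjI allI impI u)
  fix e :: real assume "0 < e"
  then have e: "0 < e / (2 * K)" using K by simp
  from s e obtain N where N: "\<And>m n. \<lbrakk>N \<le> m; N \<le> n\<rbrakk> \<Longrightarrow> hnorm H (s m \<ominus> s n) < e / (2 * K)"
    unfolding MCauchy_iff by blast
  from t e obtain M where M: "\<And>m n. \<lbrakk>M \<le> m; M \<le> n\<rbrakk> \<Longrightarrow> hnorm H (t m \<ominus> t n) < e / (2 * K)"
    unfolding MCauchy_iff by blast
  have "hnorm H (u m \<ominus> u n) < e" if "max M N \<le> m" "max M N \<le> n" for m n
  proof -
    have "hnorm H (s m \<ominus> s n) + hnorm H (t m \<ominus> t n) < e / K"
      using N[of m n] M[of m n] that K by (simp add: field_simps)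
    then have "K * (hnorm H (s m \<ominus> s n) + hnorm H (t m \<ominus> t n)) < e"
      using K by (simp add: field_simps)
    then show ?thesis using le[of m n] by linarith
  qed
  then show "\<exists>N. \<forall>m\<ge>N. \<forall>n\<ge>N. hnorm H (u m \<ominus> u n) < e" by blast
qed

lemma MCauchy_add:
  assumes s: "metric.MCauchy s" and t: "metric.MCauchy t"
  shows "metric.MCauchy (\<lambda>n. s n \<oplus> t n)"
proof (rule MCauchy_dominated[OF s t, where K = 1])
  note c = MCauchy_carrier[OF s] MCauchy_carrier[OF t]
  fix m n
  have "(s m \<oplus> t m) \<ominus> (s n \<oplus> t n) = (s m \<ominus> s n) \<oplus> (t m \<ominus> t n)"
    by (rule vector_eqI) (simp_all add: c cinner_right_simps)
  then show "hnorm H ((s m \<oplus> t m) \<ominus> (s n \<oplus> t n)) \<le> 1 * (hnorm H (s m \<ominus> s n) + hnorm H (t m \<ominus> t n))"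
    using hnorm_triangle[of "s m \<ominus> s n" "t m \<ominus> t n"] c by simp
qed (simp_all add: MCauchy_carrier s t)

lemma MCauchy_smult:
  assumes s: "metric.MCauchy s" shows "metric.MCauchy (\<lambda>n. c \<odot> s n)"
\<comment> \<open>One sequence plays both roles; adding 1 keeps the factor positive for
  \<open>c = 0\<close>.\<close>
proof (rule MCauchy_dominated[OF s s, where K = "cmod c + 1"])
  note car = MCauchy_carrier[OF s]
  fix m n
  have "(c \<odot> s m) \<ominus> (c \<odot> s n) = c \<odot> (s m \<ominus> s n)"
    by (rule vector_eqI) (simp_all add: car cinner_right_simps algebra_simps)
  then have "hnorm H ((c \<odot> s m) \<ominus> (c \<odot> s n)) = cmod c * hnorm H (s m \<ominus> s n)"
    using car by (simp add: hnorm_smult)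
  also have "\<dots> \<le> (cmod c + 1) * (hnorm H (s m \<ominus> s n) + hnorm H (s m \<ominus> s n))"
    using car by (intro mult_mono) simp_all
  finally show "hnorm H ((c \<odot> s m) \<ominus> (c \<odot> s n)) \<le>
      (cmod c + 1) * (hnorm H (s m \<ominus> s n) + hnorm H (s m \<ominus> s n))" .
qed (simp_all add: MCauchy_carrier s add_nonneg_pos)

lemma module_cauchy_space: "Module.module complex_field (cauchy_space H)"
proof (rule complex_moduleI)
  note car = MCauchy_carrier
  show "abelian_group (cauchy_space H)"
  proof (rule abelian_groupI)
    fix s t u
    assume s: "s \<in> carrier (cauchy_space H)"
    show "\<zero>\<^bsub>cauchy_space H\<^esub> \<oplus>\<^bsub>cauchy_space H\<^esub> s = s"
      using s by (simp add: car)
    have "(- 1) \<odot> x \<oplus> x = \<zero>" if "x \<in> carrier H" for x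
      using uminus_smult[OF that] l_neg[OF that] by simp
    then show "\<exists>t\<in>carrier (cauchy_space H). t \<oplus>\<^bsub>cauchy_space H\<^esub> s = \<zero>\<^bsub>cauchy_space H\<^esub>"
      using s by (intro bexI[of _ "\<lambda>n. (- 1) \<odot> s n"]) (simp_all add: car MCauchy_smult)
    assume t: "t \<in> carrier (cauchy_space H)"
    show "s \<oplus>\<^bsub>cauchy_space H\<^esub> t \<in> carrier (cauchy_space H)"
      using s t by (simp add: MCauchy_add)
    show "s \<oplus>\<^bsub>cauchy_space H\<^esub> t = t \<oplus>\<^bsub>cauchy_space H\<^esub> s"
      using s t by (simp add: car a_comm)
    assume u: "u \<in> carrier (cauchy_space H)"
    show "s \<oplus>\<^bsub>cauchy_space H\<^esub> t \<oplus>\<^bsub>cauchy_space H\<^esub> u = s \<oplus>\<^bsub>cauchy_space H\<^esub> (t \<oplus>\<^bsub>cauchy_space H\<^esub> u)"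
      using s t u by (simp add: car a_assoc)
  qed (simp add: metric.MCauchy_const)
  fix c d s t
  assume s: "s \<in> carrier (cauchy_space H)"
  show "c \<odot>\<^bsub>cauchy_space H\<^esub> s \<in> carrier (cauchy_space H)" using s by (simp add: MCauchy_smult)
  show "(c + d) \<odot>\<^bsub>cauchy_space H\<^esub> s = c \<odot>\<^bsub>cauchy_space H\<^esub> s \<oplus>\<^bsub>cauchy_space H\<^esub> d \<odot>\<^bsub>cauchy_space H\<^esub> s"
    using s smult_l_distr[of c d "s _"] by (simp add: car)
  show "(c * d) \<odot>\<^bsub>cauchy_space H\<^esub> s = c \<odot>\<^bsub>cauchy_space H\<^esub> (d \<odot>\<^bsub>cauchy_space H\<^esub> s)"
    using s smult_assoc1[of c d "s _"] by (simp add: car)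
  show "1 \<odot>\<^bsub>cauchy_space H\<^esub> s = s" using s smult_one[of "s _"] by (simp add: car)
  assume t: "t \<in> carrier (cauchy_space H)"
  show "c \<odot>\<^bsub>cauchy_space H\<^esub> (s \<oplus>\<^bsub>cauchy_space H\<^esub> t) =
      c \<odot>\<^bsub>cauchy_space H\<^esub> s \<oplus>\<^bsub>cauchy_space H\<^esub> c \<odot>\<^bsub>cauchy_space H\<^esub> t"
    using s t smult_r_distr[of c "s _" "t _"] by (simp add: car)
qed

lemma cauchy_space_minus:
  assumes "metric.MCauchy s" "metric.MCauchy t"
  shows "s \<ominus>\<^bsub>cauchy_space H\<^esub> t = (\<lambda>n. s n \<ominus> t n)"
  using assms module_uminus_smult[OF module_cauchy_space, of t]
  by (simp add: a_minus_def uminus_smult MCauchy_carrier)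

lemma MCauchy_bounded:
  assumes s: "metric.MCauchy s"
  obtains M where "0 < M" "\<And>n. hnorm H (s n) \<le> M"
proof -
  have "Cauchy (\<lambda>n. hnorm H (s n))"
  proof (rule metric_CauchyI)
    fix e :: real assume "0 < e"
    then obtain N where N: "\<And>m n. \<lbrakk>N \<le> m; N \<le> n\<rbrakk> \<Longrightarrow> hnorm H (s m \<ominus> s n) < e"
      using s unfolding MCauchy_iff by blast
    have "dist (hnorm H (s m)) (hnorm H (s n)) < e" if "N \<le> m" "N \<le> n" for m n
      using hnorm_reverse_triangle[OF MCauchy_carrier[OF s] MCauchy_carrier[OF s], of m n] N[OF that]
      by (simp add: dist_real_def)
    then show "\<exists>N. \<forall>m\<ge>N. \<forall>n\<ge>N. dist (hnorm H (s m)) (hnorm H (s n)) < e" by blast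
  qed
  then obtain M where "0 < M" "\<And>n. norm (hnorm H (s n)) \<le> M"
    using Cauchy_Bseq BseqE by blast
  then show ?thesis using that[of M] by (simp add: abs_le_iff)
qed

text \<open>Cauchy sequences are bounded, so the inner products of their terms form a Cauchy
  sequence of complex numbers. Hence \<open>lim\<close> in \<open>cauchy_form\<close> is a genuine
  limit.\<close>

lemma cauchy_form_tendsto:
  assumes s: "metric.MCauchy s" and t: "metric.MCauchy t"
  shows "(\<lambda>n. \<langle>s n, t n\<rangle>) \<longlonglongrightarrow> cauchy_form H s t"
proof -
  note c = MCauchy_carrier[OF s] MCauchy_carrier[OF t]
  obtain M where M: "0 < M" "\<And>n. hnorm H (s n) \<le> M" using MCauchy_bounded[OF s] by blast
  obtain M' where M': "0 < M'" "\<And>n. hnorm H (t n) \<le> M'" using MCauchy_bounded[OF t] by blast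
  have "Cauchy (\<lambda>n. \<langle>s n, t n\<rangle>)"
  proof (rule metric_CauchyI)
    fix e :: real assume "0 < e"
    \<comment> \<open>With this tolerance d for both sequences, the two error terms add up to less
      than \<open>M * d + d * M' = e\<close>.\<close>
    then have e: "0 < e / (M + M')" using M M' by simp
    from s e obtain N where N: "\<And>m n. \<lbrakk>N \<le> m; N \<le> n\<rbrakk> \<Longrightarrow> hnorm H (s m \<ominus> s n) < e / (M + M')"
      unfolding MCauchy_iff by blast
    from t e obtain N' where N': "\<And>m n. \<lbrakk>N' \<le> m; N' \<le> n\<rbrakk> \<Longrightarrow> hnorm H (t m \<ominus> t n) < e / (M + M')"
      unfolding MCauchy_iff by blast
    have "dist \<langle>s m, t m\<rangle> \<langle>s n, t n\<rangle> < e" if "max N N' \<le> m" "max N N' \<le> n" for m n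
    proof -
      have "hnorm H (s m) * hnorm H (t m \<ominus> t n) \<le> M * hnorm H (t m \<ominus> t n)"
        using M c by (intro mult_right_mono) simp_all
      also have "\<dots> < M * (e / (M + M'))"
        using N'[of m n] that by (intro mult_strict_left_mono M(1)) simp
      finally have 1: "hnorm H (s m) * hnorm H (t m \<ominus> t n) < M * (e / (M + M'))" .
      have "hnorm H (s m \<ominus> s n) * hnorm H (t n) \<le> hnorm H (s m \<ominus> s n) * M'"
        using M' c by (intro mult_left_mono) simp_all
      also have "\<dots> < (e / (M + M')) * M'"
        using N[of m n] that by (intro mult_strict_right_mono M'(1)) simp
      finally have 2: "hnorm H (s m \<ominus> s n) * hnorm H (t n) < (e / (M + M')) * M'" .
      have "M * d + d * M' = (M + M') * d" for d by (simp add: algebra_simps)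
      then have "M * (e / (M + M')) + (e / (M + M')) * M' = (M + M') * (e / (M + M'))" .
      also have "\<dots> = e" using M(1) M'(1) by simp
      finally have "M * (e / (M + M')) + (e / (M + M')) * M' = e" .
      then show ?thesis
        using 1 2 cinner_diff_bound[OF c(1) c(2) c(1) c(2), of m m n n] by (simp add: dist_norm)
    qed
    then show "\<exists>N. \<forall>m\<ge>N. \<forall>n\<ge>N. dist \<langle>s m, t m\<rangle> \<langle>s n, t n\<rangle> < e" by blast
  qed
  then show ?thesis
    using Cauchy_convergent convergent_LIMSEQ_iff unfolding cauchy_form_def by blast
qed

lemma cauchy_form_eqI:
  assumes "metric.MCauchy s" "metric.MCauchy t" "(\<lambda>n. \<langle>s n, t n\<rangle>) \<longlonglongrightarrow> l"
  shows "cauchy_form H s t = l"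
  using LIMSEQ_unique[OF cauchy_form_tendsto[OF assms(1,2)] assms(3)] .

lemma psd_form_cauchy_form: "psd_form (cauchy_space H) (cauchy_form H)"
proof (intro psd_form.intro module_cauchy_space psd_form_axioms.intro)
  note car = MCauchy_carrier
  fix s t u c
  assume "s \<in> carrier (cauchy_space H)"
  then have s: "metric.MCauchy s" by simp
  have "(\<lambda>n. Re \<langle>s n, s n\<rangle>) \<longlonglongrightarrow> Re (cauchy_form H s s)"
    using cauchy_form_tendsto[OF s s] by (rule tendsto_Re)
  then show "0 \<le> Re (cauchy_form H s s)"
    by (rule LIMSEQ_le_const) (simp add: cinner_nonneg car s)
  assume "t \<in> carrier (cauchy_space H)"
  then have t: "metric.MCauchy t" by simp
  show "cauchy_form H t s = cnj (cauchy_form H s t)"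
  proof (rule cauchy_form_eqI[OF t s])
    have "(\<lambda>n. \<langle>t n, s n\<rangle>) = (\<lambda>n. cnj \<langle>s n, t n\<rangle>)"
      using cinner_commute[OF car[OF s] car[OF t]] by (rule ext)
    then show "(\<lambda>n. \<langle>t n, s n\<rangle>) \<longlonglongrightarrow> cnj (cauchy_form H s t)"
      using tendsto_cnj[OF cauchy_form_tendsto[OF s t]] by simp
  qed
  show "cauchy_form H s (c \<odot>\<^bsub>cauchy_space H\<^esub> t) = c * cauchy_form H s t"
    unfolding cauchy_space_simps
  proof (rule cauchy_form_eqI[OF s MCauchy_smult[OF t]])
    show "(\<lambda>n. \<langle>s n, c \<odot> t n\<rangle>) \<longlonglongrightarrow> c * cauchy_form H s t"
      using tendsto_mult_left[OF cauchy_form_tendsto[OF s t], of c]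
      by (simp add: form_smult_right car s t)
  qed
  assume "u \<in> carrier (cauchy_space H)"
  then have u: "metric.MCauchy u" by simp
  show "cauchy_form H s (t \<oplus>\<^bsub>cauchy_space H\<^esub> u) = cauchy_form H s t + cauchy_form H s u"
    unfolding cauchy_space_simps
  proof (rule cauchy_form_eqI[OF s MCauchy_add[OF t u]])
    show "(\<lambda>n. \<langle>s n, t n \<oplus> u n\<rangle>) \<longlonglongrightarrow> cauchy_form H s t + cauchy_form H s u"
      using tendsto_add[OF cauchy_form_tendsto[OF s t] cauchy_form_tendsto[OF s u]]
      by (simp add: form_add_right car s t u)
  qed
qed

lemma cauchy_form_self:
  assumes s: "metric.MCauchy s"
  shows "(\<lambda>n. (hnorm H (s n))\<^sup>2) \<longlonglongrightarrow> Re (cauchy_form H s s)"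
  using tendsto_Re[OF cauchy_form_tendsto[OF s s]] by (simp add: hnorm_power2 MCauchy_carrier s)

text \<open>The limit form at \<open>(s, s)\<close> is the limit of the squared norms of the terms.
  So null sequences are exactly the null vectors, and the completion becomes an instance of the
  quotient construction.\<close>

lemma null_sequences_eq:
  "null_sequences H = {s \<in> carrier (cauchy_space H). cauchy_form H s s = 0}"
proof -
  interpret C: psd_form "cauchy_space H" "cauchy_form H" by (rule psd_form_cauchy_form)
  have "(\<lambda>n. hnorm H (s n)) \<longlonglongrightarrow> 0 \<longleftrightarrow> cauchy_form H s s = 0" if "s \<in> carrier (cauchy_space H)" for s
  proof
    have s: "metric.MCauchy s" using that by simp
    note lim = cauchy_form_self[OF s]
    show "cauchy_form H s s = 0" if "(\<lambda>n. hnorm H (s n)) \<longlonglongrightarrow> 0"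
    proof -
      have "(\<lambda>n. (hnorm H (s n))\<^sup>2) \<longlonglongrightarrow> 0" using tendsto_power[OF that, of 2] by simp
      then have "Re (cauchy_form H s s) = 0" using lim LIMSEQ_unique by blast
      then show ?thesis using C.form_self[of s] s by simp
    qed
    show "(\<lambda>n. hnorm H (s n)) \<longlonglongrightarrow> 0" if "cauchy_form H s s = 0"
      using tendsto_real_sqrt[OF lim] that by (simp add: MCauchy_carrier s)
  qed
  then show ?thesis unfolding null_sequences_def by blast
qed

lemma psd_form_subspace_cauchy:
  "psd_form_subspace (cauchy_space H) (cauchy_form H) (null_sequences H)"
proof -
  interpret C: psd_form "cauchy_space H" "cauchy_form H" by (rule psd_form_cauchy_form)
  show ?thesis
    by (intro psd_form_subspace.intro psd_form_cauchy_form vector_subspace.intro C.module_axioms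
      vector_subspace_axioms.intro psd_form_subspace_axioms.intro)
     (use C.submodule_null in \<open>simp_all add: null_sequences_eq\<close>)
qed

lemma hilbert_completion_eq:
  "hilbert_completion H = module.extend (vquot (cauchy_space H) (null_sequences H))
     (hilb.fields (lift2 (cauchy_form H)))"
  by (simp add: hilbert_completion_def cauchy_form_def[abs_def])

lemma pre_hilbert_space_completion: "pre_hilbert_space (hilbert_completion H)"
proof -
  interpret C: psd_form_subspace "cauchy_space H" "cauchy_form H" "null_sequences H"
    by (rule psd_form_subspace_cauchy)
  show ?thesis unfolding hilbert_completion_eq
    by (rule C.pre_hilbert_space_extend) (rule null_sequences_eq)
qed

definition cauchy_class where
  "cauchy_class s = null_sequences H +>\<^bsub>cauchy_space H\<^esub> s"

lemma cauchy_class_linear: "cauchy_class \<in> linear_maps (cauchy_space H) (hilbert_completion H)"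
proof -
  interpret C: psd_form_subspace "cauchy_space H" "cauchy_form H" "null_sequences H"
    by (rule psd_form_subspace_cauchy)
  show ?thesis
    using C.coset_linear unfolding hilbert_completion_eq linear_maps_def cauchy_class_def
      module_extend_hilb_fields_simps .
qed

lemma cauchy_class_surj:
  assumes "X \<in> carrier (hilbert_completion H)"
  obtains s where "metric.MCauchy s" "X = cauchy_class s"
proof -
  interpret C: psd_form_subspace "cauchy_space H" "cauchy_form H" "null_sequences H"
    by (rule psd_form_subspace_cauchy)
  have "X \<in> carrier (vquot (cauchy_space H) (null_sequences H))"
    using assms unfolding hilbert_completion_eq module_extend_hilb_fields_simps .
  then obtain s where "s \<in> carrier (cauchy_space H)" "X = null_sequences H +>\<^bsub>cauchy_space H\<^esub> s"
    using C.coset_cases by blast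
  then show ?thesis using that by (simp add: cauchy_class_def)
qed

lemma cinner_cauchy_class:
  assumes "metric.MCauchy s" "metric.MCauchy t"
  shows "\<langle>cauchy_class s, cauchy_class t\<rangle>\<^bsub>hilbert_completion H\<^esub> = cauchy_form H s t"
proof -
  interpret C: psd_form_subspace "cauchy_space H" "cauchy_form H" "null_sequences H"
    by (rule psd_form_subspace_cauchy)
  show ?thesis
    unfolding hilbert_completion_eq module_extend_hilb_fields_simps cauchy_class_def
    by (rule C.lift2_coset) (use assms in simp_all)
qed

lemma completion_embed_eq: "completion_embed H x = cauchy_class (\<lambda>n. x)"
  by (simp add: completion_embed_def cauchy_class_def)

lemma completion_embed_linear: "completion_embed H \<in> linear_maps H (hilbert_completion H)"
  using linear_mapsD[OF cauchy_class_linear]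
  by (intro linear_mapsI) (simp_all add: completion_embed_eq metric.MCauchy_const)

lemma cinner_completion_embed:
  assumes "x \<in> carrier H" "y \<in> carrier H"
  shows "\<langle>completion_embed H x, completion_embed H y\<rangle>\<^bsub>hilbert_completion H\<^esub> = \<langle>x, y\<rangle>"
  using assms
  by (simp add: completion_embed_eq cinner_cauchy_class metric.MCauchy_const cauchy_form_def)

text \<open>For fixed k, the distance from the class of \<open>s\<close> to the k-th embedded term
  is the limit over n of the norm of \<open>s n \<ominus> s k\<close>, which the Cauchy condition
  controls.\<close>

lemma completion_embed_tendsto:
  assumes s: "metric.MCauchy s"
  shows "(\<lambda>k. hnorm (hilbert_completion H) (cauchy_class s \<ominus>\<^bsub>hilbert_completion H\<^esub> completion_embed H (s k)))
    \<longlonglongrightarrow> 0"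
proof (rule LIMSEQ_I)
  fix e :: real assume "0 < e"
  then have "0 < e / 2" by simp
  with s obtain N where N: "\<And>m n. \<lbrakk>N \<le> m; N \<le> n\<rbrakk> \<Longrightarrow> hnorm H (s m \<ominus> s n) < e / 2"
    unfolding MCauchy_iff by blast
  interpret C: pre_hilbert_space "hilbert_completion H" by (rule pre_hilbert_space_completion)
  have "norm (hnorm (hilbert_completion H)
      (cauchy_class s \<ominus>\<^bsub>hilbert_completion H\<^esub> completion_embed H (s k)) - 0) < e" if k: "N \<le> k" for k
  proof -
    let ?c = "\<lambda>n::nat. s k"
    have c: "metric.MCauchy ?c" using MCauchy_carrier[OF s] by (simp add: metric.MCauchy_const)
    define d where "d = (\<lambda>n. s n \<ominus> s k)"
    have d: "metric.MCauchy d"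
      using MCauchy_add[OF s MCauchy_smult[OF c, of "- 1"]] uminus_smult[of "s k"] MCauchy_carrier[OF s]
      by (simp add: d_def a_minus_def)
    have dc: "d n \<in> carrier H" for n using MCauchy_carrier[OF d] .
    \<comment> \<open>Strict inequalities become weak in the limit, hence the margin
      \<open>e / 2\<close>.\<close>
    have "sqrt (Re (cauchy_form H d d)) \<le> e / 2"
    proof (rule real_le_lsqrt, use \<open>0 < e\<close> in simp, rule LIMSEQ_le_const2[OF cauchy_form_self[OF d]])
      have "(hnorm H (d n))\<^sup>2 \<le> (e / 2)\<^sup>2" if "N \<le> n" for n
        using N[OF that k] dc[of n] by (intro power_mono) (simp_all add: d_def)
      then show "\<exists>N. \<forall>n\<ge>N. (hnorm H (d n))\<^sup>2 \<le> (e / 2)\<^sup>2" by blast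
    qed
    moreover have "cauchy_class s \<ominus>\<^bsub>hilbert_completion H\<^esub> completion_embed H (s k) = cauchy_class d"
      using linear_maps_diff[OF module_cauchy_space C.module_axioms cauchy_class_linear, of s ?c] s c
      by (simp add: completion_embed_eq cauchy_space_minus d_def)
    ultimately have "hnorm (hilbert_completion H)
        (cauchy_class s \<ominus>\<^bsub>hilbert_completion H\<^esub> completion_embed H (s k)) \<le> e / 2"
      by (simp add: hnorm_def cinner_cauchy_class d)
    moreover have "cauchy_class s \<ominus>\<^bsub>hilbert_completion H\<^esub> completion_embed H (s k) \<in> carrier (hilbert_completion H)"
      using linear_mapsD(1)[OF cauchy_class_linear] linear_mapsD(1)[OF completion_embed_linear] s
        MCauchy_carrier[OF s] by simp
    ultimately show ?thesis using \<open>0 < e\<close> by simp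
  qed
  then show "\<exists>N. \<forall>k\<ge>N. norm (hnorm (hilbert_completion H)
      (cauchy_class s \<ominus>\<^bsub>hilbert_completion H\<^esub> completion_embed H (s k)) - 0) < e" by blast
qed

lemma completion_embed_dense: "dense_in (hilbert_completion H) (completion_embed H ` carrier H)"
  unfolding dense_in_def
proof (intro ballI allI impI)
  fix X and e :: real assume X: "X \<in> carrier (hilbert_completion H)" and e: "0 < e"
  obtain s where s: "metric.MCauchy s" "X = cauchy_class s" by (rule cauchy_class_surj[OF X])
  obtain k where "norm (hnorm (hilbert_completion H) (X \<ominus>\<^bsub>hilbert_completion H\<^esub> completion_embed H (s k)) - 0) < e"
    using LIMSEQ_D[OF completion_embed_tendsto[OF s(1)] e] s(2) by blast
  then show "\<exists>x\<in>completion_embed H ` carrier H.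
      hnorm (hilbert_completion H) (X \<ominus>\<^bsub>hilbert_completion H\<^esub> x) < e"
    using MCauchy_carrier[OF s(1)] by (intro bexI[of _ "completion_embed H (s k)"]) simp_all
qed

text \<open>Replace the n-th class by an embedded vector \<open>p n\<close> at distance below
  \<open>1 / (n + 1)\<close>. As the embedding is isometric, \<open>p\<close> is a Cauchy sequence
  in the original space, and its own class is the limit.\<close>

lemma hilbert_space_completion: "hilbert_space (hilbert_completion H)"
proof -
  interpret C: pre_hilbert_space "hilbert_completion H" by (rule pre_hilbert_space_completion)
  let ?j = "completion_embed H" and ?C = "hilbert_completion H"
  note j = linear_mapsD(1)[OF completion_embed_linear]
  show ?thesis
  proof (rule C.hilbert_spaceI)
    fix X assume X: "\<And>n. X n \<in> carrier ?C" and Cauchy: "C.metric.MCauchy X"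
    have "\<forall>n. \<exists>p\<in>carrier H. hnorm ?C (X n \<ominus>\<^bsub>?C\<^esub> ?j p) < 1 / real (Suc n)"
      using completion_embed_dense X unfolding dense_in_def by simp
    then obtain p where p: "\<And>n. p n \<in> carrier H" "\<And>n. hnorm ?C (X n \<ominus>\<^bsub>?C\<^esub> ?j (p n)) < 1 / real (Suc n)"
      by metis
    have "metric.MCauchy p"
      unfolding MCauchy_iff
    proof (intro conjI allI impI p(1))
      fix e :: real assume "0 < e"
      then have "0 < e / 3" by simp
      with Cauchy obtain N where N: "\<And>m n. \<lbrakk>N \<le> m; N \<le> n\<rbrakk> \<Longrightarrow> hnorm ?C (X m \<ominus>\<^bsub>?C\<^esub> X n) < e / 3"
        unfolding C.MCauchy_iff by blast
      obtain M where M: "1 / real (Suc M) < e / 3"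
        using nat_approx_posE[OF \<open>0 < e / 3\<close>] by blast
      have "hnorm H (p m \<ominus> p n) < e" if "max M N \<le> m" "max M N \<le> n" for m n
      proof -
        have "1 / real (Suc m) \<le> 1 / real (Suc M)" "1 / real (Suc n) \<le> 1 / real (Suc M)"
          using that by (simp_all add: frac_le)
        moreover have "hnorm H (p m \<ominus> p n) = hnorm ?C (?j (p m) \<ominus>\<^bsub>?C\<^esub> ?j (p n))"
          using linear_maps_diff[OF module_axioms C.module_axioms completion_embed_linear p(1) p(1), of m n]
            cinner_completion_embed[of "p m \<ominus> p n" "p m \<ominus> p n"] p(1) by (simp add: hnorm_def)
        ultimately show ?thesis
          using C.hnorm_triangle_minus[OF j[OF p(1)] X j[OF p(1)], of m n m]
            C.hnorm_triangle_minus[OF X X j[OF p(1)], of m n n] p(2)[of m] p(2)[of n] M N[of m n] that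
            C.hnorm_minus_commute[OF X j[OF p(1)], of m m] by simp
      qed
      then show "\<exists>N. \<forall>m\<ge>N. \<forall>n\<ge>N. hnorm H (p m \<ominus> p n) < e" by blast
    qed
    note lim = completion_embed_tendsto[OF this] and L = linear_mapsD(1)[OF cauchy_class_linear, of p]
    have L: "cauchy_class p \<in> carrier ?C" using L \<open>metric.MCauchy p\<close> by simp
    have "(\<lambda>n. hnorm ?C (X n \<ominus>\<^bsub>?C\<^esub> cauchy_class p)) \<longlonglongrightarrow> 0"
    proof (rule Lim_null_comparison)
      show "(\<lambda>n. 1 / real (Suc n) + hnorm ?C (cauchy_class p \<ominus>\<^bsub>?C\<^esub> ?j (p n))) \<longlonglongrightarrow> 0"
        using tendsto_add[OF LIMSEQ_inverse_real_of_nat lim] by (simp add: inverse_eq_divide)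
      have "norm (hnorm ?C (X n \<ominus>\<^bsub>?C\<^esub> cauchy_class p)) \<le>
          1 / real (Suc n) + hnorm ?C (cauchy_class p \<ominus>\<^bsub>?C\<^esub> ?j (p n))" for n
        using C.hnorm_triangle_minus[OF X j[OF p(1)] L, of n n] p(2)[of n] X L
          C.hnorm_minus_commute[OF L j[OF p(1)], of n] by simp
      then show "\<forall>\<^sub>F n in sequentially. norm (hnorm ?C (X n \<ominus>\<^bsub>?C\<^esub> cauchy_class p)) \<le>
          1 / real (Suc n) + hnorm ?C (cauchy_class p \<ominus>\<^bsub>?C\<^esub> ?j (p n))"
        by simp
    qed
    then show "\<exists>l\<in>carrier ?C. (\<lambda>n. hnorm ?C (X n \<ominus>\<^bsub>?C\<^esub> l)) \<longlonglongrightarrow> 0" using L by blast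
  qed
qed

end

section \<open>Linear and sesquilinear extension on free spaces\<close>

lemma free_space_simps [simp]:
  "carrier (free_space X) = {f. Poly_Mapping.keys f \<subseteq> X}" "zero (free_space X) = 0"
  "add (free_space X) = (+)" "smult (free_space X) = (\<lambda>c. Poly_Mapping.map ((*) c))"
  by (simp_all add: free_space_def)

lemma lookup_scale: "Poly_Mapping.lookup (Poly_Mapping.map ((*) c) f) k = c * Poly_Mapping.lookup f k"
  for f :: "'x \<Rightarrow>\<^sub>0 complex"
  by (simp add: Poly_Mapping.map.rep_eq when_def)

lemma keys_scale: "Poly_Mapping.keys (Poly_Mapping.map ((*) c) f) \<subseteq> Poly_Mapping.keys f"
  for f :: "'x \<Rightarrow>\<^sub>0 complex"
  by (auto simp: in_keys_iff lookup_scale)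

lemma scale_single: "Poly_Mapping.map ((*) c) (Poly_Mapping.single x d) = Poly_Mapping.single x (c * d)"
  for c d :: complex
  by (rule poly_mapping_eqI) (simp add: lookup_scale lookup_single when_def)

lemma module_free_space: "Module.module complex_field (free_space X)"
proof (rule complex_moduleI)
  show "abelian_group (free_space X)"
  proof (rule abelian_groupI)
    fix f assume f: "f \<in> carrier (free_space X)"
    have "Poly_Mapping.keys (- f) \<subseteq> X" using f by (auto simp: in_keys_iff)
    then show "\<exists>g\<in>carrier (free_space X). g \<oplus>\<^bsub>free_space X\<^esub> f = \<zero>\<^bsub>free_space X\<^esub>"
      by (intro bexI[of _ "- f"]) simp_all
    fix g assume g: "g \<in> carrier (free_space X)"
    show "f \<oplus>\<^bsub>free_space X\<^esub> g \<in> carrier (free_space X)"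
      using f g keys_add[of f g] by auto
  qed (simp_all add: algebra_simps)
qed (auto intro!: poly_mapping_eqI dest!: subsetD[OF keys_scale] simp: lookup_scale lookup_add algebra_simps)

lemma free_space_minus:
  assumes "f \<in> carrier (free_space X)" "g \<in> carrier (free_space X)"
  shows "f \<ominus>\<^bsub>free_space X\<^esub> g = f - g"
proof -
  have "\<ominus>\<^bsub>free_space X\<^esub> g = - g"
    unfolding module_uminus_smult[OF module_free_space assms(2)]
    by (rule poly_mapping_eqI) (simp add: lookup_scale)
  then show ?thesis by (simp add: a_minus_def)
qed

lemma poly_mapping_sum_single:
  "(\<Sum>x\<in>Poly_Mapping.keys f. Poly_Mapping.single x (Poly_Mapping.lookup f x)) = f"
proof (rule poly_mapping_eqI)
  fix k
  show "Poly_Mapping.lookup (\<Sum>x\<in>Poly_Mapping.keys f. Poly_Mapping.single x (Poly_Mapping.lookup f x)) k =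
      Poly_Mapping.lookup f k"
    by (simp add: lookup_sum lookup_single when_def in_keys_iff)
qed

lemma free_space_induct [consumes 1, case_names zero single add]:
  fixes f :: "'x \<Rightarrow>\<^sub>0 complex"
  assumes f: "f \<in> carrier (free_space X)" and zero: "P 0"
    and single: "\<And>x c. x \<in> X \<Longrightarrow> P (Poly_Mapping.single x c)"
    and add: "\<And>f g. \<lbrakk>f \<in> carrier (free_space X); g \<in> carrier (free_space X); P f; P g\<rbrakk> \<Longrightarrow> P (f + g)"
  shows "P f"
proof -
  let ?s = "\<lambda>x. Poly_Mapping.single x (Poly_Mapping.lookup f x)"
  have "sum ?s A \<in> carrier (free_space X) \<and> P (sum ?s A)" if "finite A" "A \<subseteq> X" for A
    using that
  proof (induction A rule: finite_induct)
    case (insert x A)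
    have 1: "?s x \<in> carrier (free_space X)" using insert.prems by simp
    have 2: "?s x + sum ?s A \<in> carrier (free_space X)"
      using 1 insert keys_add[of "?s x" "sum ?s A"] by auto
    show ?case using insert 1 2 add[OF 1, of "sum ?s A"] single[of x] by simp
  qed (simp add: zero)
  from this[of "Poly_Mapping.keys f"] show ?thesis
    using f by (simp add: poly_mapping_sum_single)
qed

definition free_lift :: "(complex, 'v, 'm) module_scheme \<Rightarrow> ('x \<Rightarrow> 'v) \<Rightarrow> ('x \<Rightarrow>\<^sub>0 complex) \<Rightarrow> 'v" where
  "free_lift M h f = (\<Oplus>\<^bsub>M\<^esub>x\<in>Poly_Mapping.keys f. Poly_Mapping.lookup f x \<odot>\<^bsub>M\<^esub> h x)"

context
  fixes M :: "(complex, 'v, 'm) module_scheme" and h :: "'x \<Rightarrow> 'v" and X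
  assumes M: "Module.module complex_field M" and h: "\<And>x. x \<in> X \<Longrightarrow> h x \<in> carrier M"
begin

interpretation M: Module.module complex_field M by (rule M)

text \<open>Supports of \<open>f\<close>, \<open>g\<close> and \<open>f + g\<close> differ, and
  cancellation may shrink the last one. Over a common finite superset the sums can be compared term
  by term.\<close>

lemma free_lift_superset:
  assumes "finite A" "Poly_Mapping.keys f \<subseteq> A" "A \<subseteq> X"
  shows "free_lift M h f = (\<Oplus>\<^bsub>M\<^esub>x\<in>A. Poly_Mapping.lookup f x \<odot>\<^bsub>M\<^esub> h x)"
  unfolding free_lift_def
proof (rule M.add.finprod_mono_neutral_cong_left[OF assms(1,2)])
  fix x assume "x \<in> A - Poly_Mapping.keys f"
  then show "Poly_Mapping.lookup f x \<odot>\<^bsub>M\<^esub> h x = \<zero>\<^bsub>M\<^esub>"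
    using M.smult_l_null[OF h[of x]] assms(3) by (auto simp: in_keys_iff)
qed (use h assms(3) in auto)

lemma free_lift_linear: "free_lift M h \<in> linear_maps (free_space X) M"
proof (rule linear_mapsI)
  fix f :: "'x \<Rightarrow>\<^sub>0 complex" assume "f \<in> carrier (free_space X)"
  then have f: "Poly_Mapping.keys f \<subseteq> X" by simp
  then show "free_lift M h f \<in> carrier M"
    unfolding free_lift_def using h by (intro M.finsum_closed) auto
  show "free_lift M h (c \<odot>\<^bsub>free_space X\<^esub> f) = c \<odot>\<^bsub>M\<^esub> free_lift M h f" for c
  proof -
    let ?A = "Poly_Mapping.keys f"
    have "free_lift M h (c \<odot>\<^bsub>free_space X\<^esub> f) = (\<Oplus>\<^bsub>M\<^esub>x\<in>?A. c \<odot>\<^bsub>M\<^esub> (Poly_Mapping.lookup f x \<odot>\<^bsub>M\<^esub> h x))"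
      using f h keys_scale[of c f] M.smult_assoc1[of c]
      by (subst free_lift_superset[of ?A]) (auto intro!: M.add.finprod_cong' simp: lookup_scale)
    also have "\<dots> = c \<odot>\<^bsub>M\<^esub> free_lift M h f"
      unfolding free_lift_def using f h by (subst M.finsum_smult_ldistr) auto
    finally show ?thesis .
  qed
  fix g :: "'x \<Rightarrow>\<^sub>0 complex" assume "g \<in> carrier (free_space X)"
  then have g: "Poly_Mapping.keys g \<subseteq> X" by simp
  let ?A = "Poly_Mapping.keys f \<union> Poly_Mapping.keys g"
  have "free_lift M h (f \<oplus>\<^bsub>free_space X\<^esub> g) =
      (\<Oplus>\<^bsub>M\<^esub>x\<in>?A. Poly_Mapping.lookup f x \<odot>\<^bsub>M\<^esub> h x \<oplus>\<^bsub>M\<^esub> Poly_Mapping.lookup g x \<odot>\<^bsub>M\<^esub> h x)"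
  proof (subst free_lift_superset[of ?A])
    show "Poly_Mapping.keys (f \<oplus>\<^bsub>free_space X\<^esub> g) \<subseteq> ?A" using keys_add[of f g] by simp
    show "(\<Oplus>\<^bsub>M\<^esub>x\<in>?A. Poly_Mapping.lookup (f \<oplus>\<^bsub>free_space X\<^esub> g) x \<odot>\<^bsub>M\<^esub> h x) =
      (\<Oplus>\<^bsub>M\<^esub>x\<in>?A. Poly_Mapping.lookup f x \<odot>\<^bsub>M\<^esub> h x \<oplus>\<^bsub>M\<^esub> Poly_Mapping.lookup g x \<odot>\<^bsub>M\<^esub> h x)"
    proof (rule M.add.finprod_cong'[OF refl])
      show "(\<lambda>x. Poly_Mapping.lookup f x \<odot>\<^bsub>M\<^esub> h x \<oplus>\<^bsub>M\<^esub> Poly_Mapping.lookup g x \<odot>\<^bsub>M\<^esub> h x) \<in> ?A \<rightarrow> carrier M"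
        using f g h by auto
      fix x assume "x \<in> ?A"
      then have "h x \<in> carrier M" using f g h by auto
      then show "Poly_Mapping.lookup (f \<oplus>\<^bsub>free_space X\<^esub> g) x \<odot>\<^bsub>M\<^esub> h x =
          Poly_Mapping.lookup f x \<odot>\<^bsub>M\<^esub> h x \<oplus>\<^bsub>M\<^esub> Poly_Mapping.lookup g x \<odot>\<^bsub>M\<^esub> h x"
        using M.smult_l_distr[of "Poly_Mapping.lookup f x" "Poly_Mapping.lookup g x" "h x"]
        by (simp add: lookup_add)
    qed
  qed (use f g in auto)
  also have "\<dots> = (\<Oplus>\<^bsub>M\<^esub>x\<in>?A. Poly_Mapping.lookup f x \<odot>\<^bsub>M\<^esub> h x) \<oplus>\<^bsub>M\<^esub>
      (\<Oplus>\<^bsub>M\<^esub>x\<in>?A. Poly_Mapping.lookup g x \<odot>\<^bsub>M\<^esub> h x)"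
    using f g h by (intro M.add.finprod_multf) auto
  also have "\<dots> = free_lift M h f \<oplus>\<^bsub>M\<^esub> free_lift M h g"
    using f g free_lift_superset[of ?A f] free_lift_superset[of ?A g] by simp
  finally show "free_lift M h (f \<oplus>\<^bsub>free_space X\<^esub> g) = free_lift M h f \<oplus>\<^bsub>M\<^esub> free_lift M h g" .
qed

lemma free_lift_single:
  assumes "x \<in> X" shows "free_lift M h (Poly_Mapping.single x c) = c \<odot>\<^bsub>M\<^esub> h x"
  using free_lift_superset[of "{x}" "Poly_Mapping.single x c"] assms h[OF assms] by simp

end

text \<open>The double sum of \<open>stine_form\<close> with an abstract kernel. Sesquilinearity on
  formal combinations holds for any kernel; properties of \<open>\<phi>\<close> enter only with
  positivity and the tensor relations.\<close>

definition sesqui :: "('x \<Rightarrow> 'x \<Rightarrow> complex) \<Rightarrow> ('x \<Rightarrow>\<^sub>0 complex) \<Rightarrow> ('x \<Rightarrow>\<^sub>0 complex) \<Rightarrow> complex" where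
  "sesqui \<kappa> f g = (\<Sum>p\<in>Poly_Mapping.keys f. \<Sum>q\<in>Poly_Mapping.keys g.
     cnj (Poly_Mapping.lookup f p) * Poly_Mapping.lookup g q * \<kappa> p q)"

lemma sesqui_superset:
  assumes "finite A" "Poly_Mapping.keys f \<subseteq> A" "finite B" "Poly_Mapping.keys g \<subseteq> B"
  shows "sesqui \<kappa> f g = (\<Sum>p\<in>A. \<Sum>q\<in>B.
     cnj (Poly_Mapping.lookup f p) * Poly_Mapping.lookup g q * \<kappa> p q)"
proof -
  have "sesqui \<kappa> f g = (\<Sum>p\<in>Poly_Mapping.keys f. \<Sum>q\<in>B.
     cnj (Poly_Mapping.lookup f p) * Poly_Mapping.lookup g q * \<kappa> p q)"
    unfolding sesqui_def using assms(3,4)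
    by (intro sum.cong refl sum.mono_neutral_left) (simp_all add: in_keys_iff)
  also have "\<dots> = (\<Sum>p\<in>A. \<Sum>q\<in>B.
     cnj (Poly_Mapping.lookup f p) * Poly_Mapping.lookup g q * \<kappa> p q)"
    using assms(1,2) by (intro sum.mono_neutral_left) (simp_all add: in_keys_iff)
  finally show ?thesis .
qed

lemma sesqui_add_right: "sesqui \<kappa> f (g + g') = sesqui \<kappa> f g + sesqui \<kappa> f g'"
proof -
  let ?B = "Poly_Mapping.keys g \<union> Poly_Mapping.keys g'"
  have "Poly_Mapping.keys (g + g') \<subseteq> ?B" by (rule keys_add)
  then show ?thesis
    by (simp add: sesqui_superset[of "Poly_Mapping.keys f" f ?B] lookup_add
        sum.distrib[symmetric] algebra_simps)
qed

lemma sesqui_scale_right: "sesqui \<kappa> f (Poly_Mapping.map ((*) c) g) = c * sesqui \<kappa> f g"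
  using keys_scale[of c g]
  by (simp add: sesqui_superset[of "Poly_Mapping.keys f" f "Poly_Mapping.keys g"] lookup_scale
      sum_distrib_left mult_ac)

lemma sesqui_add_left: "sesqui \<kappa> (f + f') g = sesqui \<kappa> f g + sesqui \<kappa> f' g"
proof -
  let ?A = "Poly_Mapping.keys f \<union> Poly_Mapping.keys f'"
  have "Poly_Mapping.keys (f + f') \<subseteq> ?A" by (rule keys_add)
  then show ?thesis
    by (simp add: sesqui_superset[of ?A _ "Poly_Mapping.keys g" g] lookup_add
        sum.distrib[symmetric] algebra_simps)
qed

lemma sesqui_scale_left: "sesqui \<kappa> (Poly_Mapping.map ((*) c) f) g = cnj c * sesqui \<kappa> f g"
  using keys_scale[of c f]
  by (simp add: sesqui_superset[of "Poly_Mapping.keys f" _ "Poly_Mapping.keys g" g] lookup_scale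
      sum_distrib_left mult_ac)

lemma sesqui_single:
  "sesqui \<kappa> (Poly_Mapping.single p c) (Poly_Mapping.single q d) = cnj c * d * \<kappa> p q"
  by (simp add: sesqui_superset[of "{p}" _ "{q}"])

lemma sesqui_zero [simp]: "sesqui \<kappa> 0 g = 0" "sesqui \<kappa> f 0 = 0"
  by (simp_all add: sesqui_def)

lemma sesqui_diff_right: "sesqui \<kappa> f (g - g') = sesqui \<kappa> f g - sesqui \<kappa> f g'"
  using sesqui_add_right[of \<kappa> f "g - g'" g'] by simp

text \<open>Polarisation: the values on the diagonal at \<open>f + g\<close> and at
  \<open>f + \<i> g\<close> are real, which settles the imaginary and the real part. Symmetry of the
  form thus comes from its positivity, with no prior knowledge of adjoints of
  \<open>\<phi> a\<close>.\<close>

lemma sesqui_commute: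
  assumes real: "\<And>f. f \<in> carrier (free_space X) \<Longrightarrow> Im (sesqui \<kappa> f f) = 0"
    and f: "f \<in> carrier (free_space X)" and g: "g \<in> carrier (free_space X)"
  shows "sesqui \<kappa> g f = cnj (sesqui \<kappa> f g)"
proof -
  interpret Module.module complex_field "free_space X" by (rule module_free_space)
  let ?ig = "Poly_Mapping.map ((*) \<i>) g"
  have ig: "?ig \<in> carrier (free_space X)" using smult_closed[OF _ g, of \<i>] by simp
  have "f + g \<in> carrier (free_space X)" "f + ?ig \<in> carrier (free_space X)"
    using a_closed[OF f g] a_closed[OF f ig] by simp_all
  from this[THEN real] real[OF f] real[OF g] real[OF ig] show ?thesis
    by (simp add: sesqui_add_left sesqui_add_right sesqui_scale_left sesqui_scale_right complex_eq_iff)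
qed

lemma sesqui_self_sum:
  assumes "bij_betw p {..<n} (Poly_Mapping.keys f)"
  shows "sesqui \<kappa> f f = (\<Sum>i<n. \<Sum>j<n.
    cnj (Poly_Mapping.lookup f (p i)) * Poly_Mapping.lookup f (p j) * \<kappa> (p i) (p j))"
  unfolding sesqui_def by (simp add: sum.reindex_bij_betw[OF assms, symmetric])

section \<open>Positivity of the Stinespring form\<close>

lemma cstar_alg_simps [simp]:
  "carrier cstar_alg = UNIV" "monoid.mult cstar_alg = (*)" "one cstar_alg = 1"
  "zero cstar_alg = 0" "add cstar_alg = (+)" "smult cstar_alg = scaleC" "star cstar_alg = cstar"
  by (simp_all add: cstar_alg_def)

lemma cstar_zero [simp]: "cstar 0 = 0"
  using cstar_add[of 0 0] by simp

lemma cstar_one [simp]: "cstar 1 = 1"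
  by (metis cstar_cstar cstar_mult mult.right_neutral mult.left_neutral)

lemma scaleC_one [simp]: "1 *\<^sub>C x = x"
  using scaleR_scaleC[of 1 x] by simp

lemma scaleC_uminus_one: "(- 1) *\<^sub>C x = - x"
  using scaleR_scaleC[of "- 1" x] by simp

lemma abelian_group_cstar_alg: "abelian_group (cstar_alg :: 'a::cstar_algebra star_algebra)"
proof (rule abelian_groupI)
  fix x :: 'a
  show "\<exists>y\<in>carrier cstar_alg. y \<oplus>\<^bsub>cstar_alg\<^esub> x = \<zero>\<^bsub>cstar_alg\<^esub>"
    by (rule bexI[of _ "- x"]) simp_all
qed (simp_all add: algebra_simps)

lemma finsum_cstar_alg:
  fixes x :: "nat \<Rightarrow> 'a::cstar_algebra"
  shows "(\<Oplus>\<^bsub>cstar_alg\<^esub>k\<in>{..<n}. x k) = (\<Sum>k<n. x k)"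
proof -
  interpret abelian_group "cstar_alg :: 'a star_algebra" by (rule abelian_group_cstar_alg)
  show ?thesis
    by (induction n) (simp_all add: lessThan_Suc finsum_insert)
qed

lemma mat_alg_simps:
  "carrier (mat_alg n A) = {..<n} \<times> {..<n} \<rightarrow>\<^sub>E carrier A"
  "monoid.mult (mat_alg n A) = (\<lambda>M N. \<lambda>(i, j)\<in>{..<n} \<times> {..<n}. \<Oplus>\<^bsub>A\<^esub>k\<in>{..<n}. M (i, k) \<otimes>\<^bsub>A\<^esub> N (k, j))"
  "star (mat_alg n A) = (\<lambda>M. \<lambda>(i, j)\<in>{..<n} \<times> {..<n}. star A (M (j, i)))"
  by (simp_all add: mat_alg_def Let_def)

text \<open>The Gram matrix of \<open>a\<close> is \<open>X\<^sup>* X\<close> for the matrix \<open>X\<close> with first row \<open>a\<close> and zeros elsewhere.\<close>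

lemma gram_positive:
  fixes a :: "nat \<Rightarrow> 'a::cstar_algebra"
  shows "(\<lambda>(i, j)\<in>{..<n} \<times> {..<n}. cstar (a i) * a j) \<in> positive_elements (mat_alg n cstar_alg)"
proof -
  define X where "X = (\<lambda>(i, j)\<in>{..<n} \<times> {..<n}. if i = 0 then a j else 0)"
  have "star (mat_alg n cstar_alg) X \<otimes>\<^bsub>mat_alg n cstar_alg\<^esub> X =
      (\<lambda>(i, j)\<in>{..<n} \<times> {..<n}. cstar (a i) * a j)"
    unfolding mat_alg_simps
  proof (rule restrict_ext, clarify)
    fix i j assume ij: "i < n" "j < n"
    have "(\<Sum>k<n. cstar (X (k, i)) * X (k, j)) = (\<Sum>k<n. if k = 0 then cstar (a i) * a j else 0)"
      using ij by (intro sum.cong) (auto simp: X_def)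
    \<comment> \<open>Row 0 is present because \<open>i < n\<close>.\<close>
    also have "\<dots> = cstar (a i) * a j" using ij by simp
    finally show "(\<Oplus>\<^bsub>cstar_alg\<^esub>k\<in>{..<n}. (\<lambda>(i, j)\<in>{..<n} \<times> {..<n}. star cstar_alg (X (j, i))) (i, k) \<otimes>\<^bsub>cstar_alg\<^esub> X (k, j)) =
        cstar (a i) * a j"
      using ij by (simp add: finsum_cstar_alg)
  qed
  moreover have "X \<in> carrier (mat_alg n cstar_alg)"
    by (auto simp: mat_alg_simps X_def)
  ultimately show ?thesis unfolding positive_elements_def by force
qed

context pre_hilbert_space
begin

text \<open>The witness is the sum of the \<open>w j\<close>, stated through its pairings, the only
  property of it that is used.\<close>

lemma cinner_sum_representative:
  fixes n :: nat
  assumes "\<And>j. j < n \<Longrightarrow> w j \<in> carrier H"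
  shows "\<exists>u\<in>carrier H. \<forall>x\<in>carrier H. (\<Sum>j<n. \<langle>x, w j\<rangle>) = \<langle>x, u\<rangle>"
  using assms
proof (induction n)
  case 0
  then show ?case by (intro bexI[of _ \<zero>]) simp_all
next
  case (Suc n)
  then obtain u where u: "u \<in> carrier H" "\<forall>x\<in>carrier H. (\<Sum>j<n. \<langle>x, w j\<rangle>) = \<langle>x, u\<rangle>" by auto
  have w: "w n \<in> carrier H" using Suc.prems by simp
  then show ?case using u by (intro bexI[of _ "u \<oplus> w n"]) (simp_all add: form_add_right)
qed

text \<open>The double sum is the squared norm of the sum of the vectors.\<close>

lemma gram_sum_nonneg:
  fixes n :: nat
  assumes w: "\<And>j. j < n \<Longrightarrow> w j \<in> carrier H"
  shows "\<exists>r\<ge>0. (\<Sum>i<n. \<Sum>j<n. \<langle>w i, w j\<rangle>) = complex_of_real r"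
proof -
  obtain u where u: "u \<in> carrier H" "\<And>x. x \<in> carrier H \<Longrightarrow> (\<Sum>j<n. \<langle>x, w j\<rangle>) = \<langle>x, u\<rangle>"
    using cinner_sum_representative[where n = n and w = w] w by blast
  have "(\<Sum>i<n. \<Sum>j<n. \<langle>w i, w j\<rangle>) = (\<Sum>i<n. \<langle>w i, u\<rangle>)"
    using w u(2) by (intro sum.cong) simp_all
  also have "\<dots> = (\<Sum>i<n. cnj \<langle>u, w i\<rangle>)"
  proof (rule sum.cong[OF refl])
    fix i assume "i \<in> {..<n}"
    then show "\<langle>w i, u\<rangle> = cnj \<langle>u, w i\<rangle>" using w u(1) by (intro cinner_commute) simp_all
  qed
  also have "\<dots> = cnj \<langle>u, u\<rangle>" using u by (simp flip: cnj_sum)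
  also have "\<dots> = complex_of_real ((hnorm H u)\<^sup>2)" by (simp add: cinner_self[OF u(1)])
  finally show ?thesis by (intro exI[of _ "(hnorm H u)\<^sup>2"]) simp
qed

end

section \<open>Complete positivity on Gram matrices\<close>

locale ocp = hilbert_space K for K :: "'k hilb" (structure) +
  fixes \<phi> :: "'a::cstar_algebra \<Rightarrow> 'k \<Rightarrow> 'k"
  assumes cp: "completely_positive cstar_alg (op_alg K) \<phi>"
begin

lemma phi_bounded: "\<phi> a \<in> bounded_ops K K"
  using cp unfolding completely_positive_def linear_maps_def by auto

lemma phi_carrier: "v \<in> carrier K \<Longrightarrow> \<phi> a v \<in> carrier K"
  using bounded_opsD(3)[OF phi_bounded] .

lemma phi_add: "v \<in> carrier K \<Longrightarrow> \<phi> (a + b) v = \<phi> a v \<oplus> \<phi> b v"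
  using cp unfolding completely_positive_def linear_maps_def by simp

lemma phi_scale: "v \<in> carrier K \<Longrightarrow> \<phi> (c *\<^sub>C a) v = c \<odot> \<phi> a v"
  using cp unfolding completely_positive_def linear_maps_def by simp

text \<open>Applied entrywise to the Gram matrix, \<open>\<phi>\<close> gives a matrix
  \<open>N\<^sup>* N\<close> of operators, with entries the sums over k of the adjoint of
  \<open>N (k, i)\<close> times \<open>N (k, j)\<close>. The double sum is therefore the sum over k
  of the squared norms of the vectors obtained by adding all \<open>N (k, j) (v j)\<close>.\<close>

lemma cp_nonneg:
  fixes n :: nat
  assumes v: "\<And>i. i < n \<Longrightarrow> v i \<in> carrier K"
  shows "\<exists>r\<ge>0. (\<Sum>i<n. \<Sum>j<n. \<langle>v i, \<phi> (cstar (a i) * a j) (v j)\<rangle>) = complex_of_real r"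
proof -
  let ?I = "{..<n} \<times> {..<n}"
  define M where "M = (\<lambda>(i, j)\<in>?I. cstar (a i) * a j)"
  have "compose ?I \<phi> M \<in> positive_elements (mat_alg n (op_alg K))"
    using cp gram_positive[where n = n and a = a] unfolding completely_positive_def M_def by blast
  then obtain N where N: "N \<in> ?I \<rightarrow>\<^sub>E bounded_ops K K"
    and eq: "compose ?I \<phi> M = star (mat_alg n (op_alg K)) N \<otimes>\<^bsub>mat_alg n (op_alg K)\<^esub> N"
    unfolding positive_elements_def by (auto simp: mat_alg_simps(1))
  have Nb: "N (i, j) \<in> bounded_ops K K" if "i < n" "j < n" for i j
    using PiE_mem[OF N, of "(i, j)"] that by simp
  have entry: "\<langle>v i, \<phi> (cstar (a i) * a j) (v j)\<rangle> = (\<Sum>k<n. \<langle>N (k, i) (v i), N (k, j) (v j)\<rangle>)"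
    if ij: "i < n" "j < n" for i j
  proof -
    have comp: "compose (carrier K) (adjoint_op K K (N (k, i))) (N (k, j)) \<in> bounded_ops K K" if "k < n" for k
      by (rule compose_bounded[OF pre_hilbert_space_axioms pre_hilbert_space_axioms
        adjoint_op_bounded[OF hilbert_space_axioms pre_hilbert_space_axioms] ]) (use Nb that ij in auto)
    have "\<phi> (cstar (a i) * a j) = compose ?I \<phi> M (i, j)"
      using ij by (simp add: compose_def M_def)
    also have "\<dots> = (\<Oplus>\<^bsub>op_alg K\<^esub>k\<in>{..<n}. (\<lambda>(i, j)\<in>?I. adjoint_op K K (N (j, i))) (i, k) \<otimes>\<^bsub>op_alg K\<^esub> N (k, j))"
      unfolding eq mat_alg_simps using ij by simp
    also have "\<dots> = (\<Oplus>\<^bsub>op_alg K\<^esub>k\<in>{..<n}. compose (carrier K) (adjoint_op K K (N (k, i))) (N (k, j)))"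
    proof -
      interpret O: abelian_monoid "op_alg K" by (rule abelian_monoid_op_alg)
      show ?thesis using comp ij by (intro O.add.finprod_cong') auto
    qed
    finally have "\<langle>v i, \<phi> (cstar (a i) * a j) (v j)\<rangle> =
        (\<Sum>k<n. \<langle>v i, compose (carrier K) (adjoint_op K K (N (k, i))) (N (k, j)) (v j)\<rangle>)"
      using cinner_finsum_op[where n = n and T = "\<lambda>k. compose (carrier K) (adjoint_op K K (N (k, i))) (N (k, j))",
          OF comp v[OF ij(1)] v[OF ij(2)]]
      by simp
    also have "\<dots> = (\<Sum>k<n. \<langle>N (k, i) (v i), N (k, j) (v j)\<rangle>)"
    proof (rule sum.cong[OF refl])
      fix k assume "k \<in> {..<n}"
      then have k: "k < n" by simp
      show "\<langle>v i, compose (carrier K) (adjoint_op K K (N (k, i))) (N (k, j)) (v j)\<rangle> =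
          \<langle>N (k, i) (v i), N (k, j) (v j)\<rangle>"
        unfolding compose_eq[OF v[OF ij(2)]]
        by (rule adjoint_op_cinner_right[OF hilbert_space_axioms pre_hilbert_space_axioms Nb[OF k ij(1)]
            v[OF ij(1)] bounded_opsD(3)[OF Nb[OF k ij(2)] v[OF ij(2)]]])
    qed
    finally show ?thesis .
  qed
  \<comment> \<open>The row index k is moved outermost, so that for each k a Gram sum of vectors
    remains.\<close>
  have "(\<Sum>i<n. \<Sum>j<n. \<langle>v i, \<phi> (cstar (a i) * a j) (v j)\<rangle>) =
      (\<Sum>i<n. \<Sum>j<n. \<Sum>k<n. \<langle>N (k, i) (v i), N (k, j) (v j)\<rangle>)"
    by (intro sum.cong refl entry) simp_all
  also have "\<dots> = (\<Sum>i<n. \<Sum>k<n. \<Sum>j<n. \<langle>N (k, i) (v i), N (k, j) (v j)\<rangle>)"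
    by (intro sum.cong refl sum.swap)
  also have "\<dots> = (\<Sum>k<n. \<Sum>i<n. \<Sum>j<n. \<langle>N (k, i) (v i), N (k, j) (v j)\<rangle>)"
    by (rule sum.swap)
  finally have *: "(\<Sum>i<n. \<Sum>j<n. \<langle>v i, \<phi> (cstar (a i) * a j) (v j)\<rangle>) =
      (\<Sum>k<n. \<Sum>i<n. \<Sum>j<n. \<langle>N (k, i) (v i), N (k, j) (v j)\<rangle>)" .
  have "\<forall>k\<in>{..<n}. \<exists>r\<ge>0. (\<Sum>i<n. \<Sum>j<n. \<langle>N (k, i) (v i), N (k, j) (v j)\<rangle>) = complex_of_real r"
    using bounded_opsD(3)[OF Nb] v by (intro ballI gram_sum_nonneg) simp
  then obtain r where r: "\<And>k. k < n \<Longrightarrow> 0 \<le> r k"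
    "\<And>k. k < n \<Longrightarrow> (\<Sum>i<n. \<Sum>j<n. \<langle>N (k, i) (v i), N (k, j) (v j)\<rangle>) = complex_of_real (r k)"
    unfolding bchoice_iff by auto
  have "(\<Sum>k<n. \<Sum>i<n. \<Sum>j<n. \<langle>N (k, i) (v i), N (k, j) (v j)\<rangle>) = complex_of_real (\<Sum>k<n. r k)"
    using r(2) by simp
  moreover have "0 \<le> (\<Sum>k<n. r k)" using r(1) by (intro sum_nonneg) simp
  ultimately show ?thesis unfolding * by blast
qed

end

section \<open>Stinespring's space\<close>

context ocp
begin

abbreviation gens :: "('a \<times> 'k) set" where "gens \<equiv> UNIV \<times> carrier K"

abbreviation FS where "FS \<equiv> carrier (free_space gens)"

definition kern :: "'a \<times> 'k \<Rightarrow> 'a \<times> 'k \<Rightarrow> complex" where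
  "kern = (\<lambda>(a, v) (b, w). \<langle>v, \<phi> (cstar a * b) w\<rangle>)"

abbreviation form :: "('a \<times> 'k \<Rightarrow>\<^sub>0 complex) \<Rightarrow> ('a \<times> 'k \<Rightarrow>\<^sub>0 complex) \<Rightarrow> complex" where
  "form \<equiv> sesqui kern"

text \<open>Enumerate the support and absorb each coefficient into its vector; what remains is the
  double sum of \<open>cp_nonneg\<close>.\<close>

lemma form_self_nonneg:
  assumes f: "f \<in> FS"
  shows "\<exists>r\<ge>0. form f f = complex_of_real r"
proof -
  obtain p where p: "bij_betw p {..<card (Poly_Mapping.keys f)} (Poly_Mapping.keys f)"
    using ex_bij_betw_nat_finite[of "Poly_Mapping.keys f"] by (auto simp: atLeast0LessThan)
  let ?n = "card (Poly_Mapping.keys f)"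
  have pK: "snd (p i) \<in> carrier K" if "i < ?n" for i
  proof -
    have "p i \<in> gens" using bij_betwE[OF p] that f by auto
    then show ?thesis by (simp only: mem_Times_iff)
  qed
  have "form f f = (\<Sum>i<?n. \<Sum>j<?n. \<langle>Poly_Mapping.lookup f (p i) \<odot> snd (p i),
      \<phi> (cstar (fst (p i)) * fst (p j)) (Poly_Mapping.lookup f (p j) \<odot> snd (p j))\<rangle>)"
    unfolding sesqui_self_sum[OF p]
    by (intro sum.cong refl)
      (simp add: kern_def case_prod_unfold pK form_smult_left form_smult_right
        bounded_opsD(5)[OF phi_bounded] phi_carrier)
  then show ?thesis
    using cp_nonneg[where n = ?n and v = "\<lambda>i. Poly_Mapping.lookup f (p i) \<odot> snd (p i)" and a = "\<lambda>i. fst (p i)"]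
      pK by simp
qed

lemma psd_form_free: "psd_form (free_space gens) form"
proof (rule psd_form.intro[OF module_free_space psd_form_axioms.intro])
  fix f g h and c :: complex assume f: "f \<in> FS"
  show "0 \<le> Re (form f f)" using form_self_nonneg[OF f] by auto
  show "form f (c \<odot>\<^bsub>free_space gens\<^esub> g) = c * form f g" by (simp add: sesqui_scale_right)
  show "form f (g \<oplus>\<^bsub>free_space gens\<^esub> h) = form f g + form f h" by (simp add: sesqui_add_right)
  assume g: "g \<in> FS"
  have "Im (form h h) = 0" if "h \<in> FS" for h
    using form_self_nonneg[OF that] by auto
  then show "form g f = cnj (form f g)" using f g by (rule sesqui_commute)
qed

lemma form_single_right:
  "form f (Poly_Mapping.single q d) =
    d * (\<Sum>p\<in>Poly_Mapping.keys f. cnj (Poly_Mapping.lookup f p) * kern p q)"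
  by (simp add: sesqui_superset[of "Poly_Mapping.keys f" f "{q}"] sum_distrib_left mult_ac)

text \<open>For a fixed first argument, \<open>kern\<close> is linear in each component of its
  second one, so the relations are orthogonal to everything. This lets the form descend to the
  tensor product.\<close>

lemma bilinear_relations_null:
  assumes z: "z \<in> bilinear_relations cstar_alg K"
  shows "z \<in> FS" "f \<in> FS \<Longrightarrow> form f z = 0"
proof -
  have diff: "u - w \<in> FS"
    if "u \<in> FS" "w \<in> FS" for u w
    using that free_space_minus[OF that] Module.module.axioms(2)[OF module_free_space]
      abelian_group.minus_closed by metis
  have sgl: "Poly_Mapping.single (a, v) c \<in> FS" if "v \<in> carrier K" for a v c
    using that by simp
  show "z \<in> FS"
    using z unfolding bilinear_relations_def Un_iff mem_Collect_eq
    by (elim disjE exE conjE; hypsubst; intro diff sgl) simp_all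
  assume f: "f \<in> FS"
  have keys: "snd p \<in> carrier K" if "p \<in> Poly_Mapping.keys f" for p
  proof -
    have "p \<in> gens" using f that by auto
    then show ?thesis by (simp only: mem_Times_iff)
  qed
  \<comment> \<open>The pairing with \<open>f\<close> on a single generator. The four kinds of
    relations become the additivity and homogeneity of \<open>L\<close> in either component.\<close>
  define L where "L q = (\<Sum>p\<in>Poly_Mapping.keys f. cnj (Poly_Mapping.lookup f p) * kern p q)" for q
  have sl: "form f (Poly_Mapping.single q d) = d * L q" for q d
    by (simp add: form_single_right L_def)
  have 1: "L (a + b, w) = L (a, w) + L (b, w)" if "w \<in> carrier K" for a b w
    unfolding L_def sum.distrib[symmetric]
    by (intro sum.cong refl) (simp add: kern_def case_prod_unfold that keys distrib_left phi_add
      phi_carrier form_add_right)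
  have 2: "L (a, v \<oplus> w) = L (a, v) + L (a, w)" if "v \<in> carrier K" "w \<in> carrier K" for a v w
    unfolding L_def sum.distrib[symmetric]
    by (intro sum.cong refl) (simp add: kern_def case_prod_unfold that keys distrib_left
      bounded_opsD(4)[OF phi_bounded] phi_carrier form_add_right)
  have 3: "L (c *\<^sub>C a, w) = c * L (a, w)" if "w \<in> carrier K" for a c w
    unfolding L_def sum_distrib_left
    by (intro sum.cong refl) (simp add: kern_def case_prod_unfold that keys mult_scaleC_right phi_scale
      phi_carrier form_smult_right)
  have 4: "L (a, c \<odot> w) = c * L (a, w)" if "w \<in> carrier K" for a c w
    unfolding L_def sum_distrib_left
    by (intro sum.cong refl) (simp add: kern_def case_prod_unfold that keys
      bounded_opsD(5)[OF phi_bounded] phi_carrier form_smult_right)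
  show "form f z = 0"
    using z unfolding bilinear_relations_def Un_iff mem_Collect_eq
    by (elim disjE exE conjE; hypsubst) (simp_all add: sesqui_diff_right sl 1 2 3 4)
qed

abbreviation rels :: "('a \<times> 'k \<Rightarrow>\<^sub>0 complex) set" where
  "rels \<equiv> tensor_relations cstar_alg K"

lemma tensor_relations_eq: "rels = vspan (free_space gens) (bilinear_relations cstar_alg K)"
  by (simp add: tensor_relations_def)

lemma stine_tensor_eq: "stine_tensor K = vquot (free_space gens) rels"
  by (simp add: tensor_def)

text \<open>The null vectors form a subspace that contains the bilinear relations, hence also their
  span.\<close>

lemma psd_form_subspace_rels: "psd_form_subspace (free_space gens) form rels"
proof -
  interpret F: psd_form "free_space gens" form by (rule psd_form_free)
  show ?thesis
  proof (intro psd_form_subspace.intro psd_form_free vector_subspace.intro module_free_space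
      vector_subspace_axioms.intro psd_form_subspace_axioms.intro)
    have "bilinear_relations cstar_alg K \<subseteq> FS"
      using bilinear_relations_null(1) by blast
    then show "submodule rels complex_field (free_space gens)"
      unfolding tensor_relations_eq by (rule submodule_vspan[OF module_free_space])
    have "rels \<subseteq> {f \<in> FS. form f f = 0}"
      unfolding tensor_relations_eq
      by (rule vspan_least[OF F.submodule_null]) (use bilinear_relations_null in blast)
    then show "form f f = 0" if "f \<in> rels" for f using that by blast
  qed
qed

lemma stine_form_eq: "stine_form K \<phi> = lift2 form"
  by (simp add: stine_form_def sesqui_def[abs_def] kern_def case_prod_unfold)

lemma psd_form_stine: "psd_form (stine_tensor K) (stine_form K \<phi>)"
  unfolding stine_form_eq stine_tensor_eq
  by (rule psd_form_subspace.psd_form_vquot[OF psd_form_subspace_rels])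

lemma psd_form_subspace_stine: "psd_form_subspace (stine_tensor K) (stine_form K \<phi>) (stine_null K \<phi>)"
proof -
  interpret T: psd_form "stine_tensor K" "stine_form K \<phi>" by (rule psd_form_stine)
  show ?thesis
    by (intro psd_form_subspace.intro psd_form_stine vector_subspace.intro T.module_axioms
      vector_subspace_axioms.intro psd_form_subspace_axioms.intro)
     (use T.submodule_null in \<open>simp_all add: stine_null_def\<close>)
qed

lemma pre_hilbert_space_stine_pre: "pre_hilbert_space (stine_pre K \<phi>)"
  unfolding stine_pre_def
  by (rule psd_form_subspace.pre_hilbert_space_extend[OF psd_form_subspace_stine]) (rule stine_null_def)

lemma hilbert_space_stine: "hilbert_space (stine_space K \<phi>)"
  unfolding stine_space_def
  by (rule pre_hilbert_space.hilbert_space_completion[OF pre_hilbert_space_stine_pre])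

definition tensor_class where "tensor_class f = rels +>\<^bsub>free_space gens\<^esub> f"

text \<open>The composite of the three quotient maps, from formal combinations to tensors, then
  modulo null vectors, then into the completion. All computations in the Stinespring space go
  through it.\<close>

definition qmap where "qmap f = stine_class K \<phi> (tensor_class f)"

lemma tensor_class_linear: "tensor_class \<in> linear_maps (free_space gens) (stine_tensor K)"
proof -
  interpret psd_form_subspace "free_space gens" form rels by (rule psd_form_subspace_rels)
  show ?thesis using coset_linear by (simp only: stine_tensor_eq tensor_class_def[abs_def])
qed

lemma stine_pre_class_linear:
  "(\<lambda>\<zeta>. stine_null K \<phi> +>\<^bsub>stine_tensor K\<^esub> \<zeta>) \<in> linear_maps (stine_tensor K) (stine_pre K \<phi>)"
proof -
  interpret psd_form_subspace "stine_tensor K" "stine_form K \<phi>" "stine_null K \<phi>"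
    by (rule psd_form_subspace_stine)
  show ?thesis using coset_linear
    unfolding stine_pre_def linear_maps_def module_extend_hilb_fields_simps .
qed

lemma qmap_linear: "qmap \<in> linear_maps (free_space gens) (stine_space K \<phi>)"
proof -
  interpret P: pre_hilbert_space "stine_pre K \<phi>" by (rule pre_hilbert_space_stine_pre)
  show ?thesis
    unfolding qmap_def[abs_def] stine_class_def stine_space_def
    by (rule linear_maps_comp[OF linear_maps_comp[OF tensor_class_linear stine_pre_class_linear]
      P.completion_embed_linear])
qed

text \<open>Each of the three maps preserves the form: the two quotient maps by
  \<open>lift2_coset\<close>, the embedding by constant sequences.\<close>

lemma cinner_qmap:
  assumes f: "f \<in> FS" and g: "g \<in> FS"
  shows "\<langle>qmap f, qmap g\<rangle>\<^bsub>stine_space K \<phi>\<^esub> = form f g"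
proof -
  interpret P: pre_hilbert_space "stine_pre K \<phi>" by (rule pre_hilbert_space_stine_pre)
  note t = linear_mapsD(1)[OF tensor_class_linear]
  have "\<langle>qmap f, qmap g\<rangle>\<^bsub>stine_space K \<phi>\<^esub> =
    \<langle>stine_null K \<phi> +>\<^bsub>stine_tensor K\<^esub> tensor_class f, stine_null K \<phi> +>\<^bsub>stine_tensor K\<^esub> tensor_class g\<rangle>\<^bsub>stine_pre K \<phi>\<^esub>"
    unfolding qmap_def stine_class_def stine_space_def
    by (rule P.cinner_completion_embed[OF linear_mapsD(1)[OF stine_pre_class_linear t[OF f]]
      linear_mapsD(1)[OF stine_pre_class_linear t[OF g]]])
  also have "\<dots> = stine_form K \<phi> (tensor_class f) (tensor_class g)"
    unfolding stine_pre_def module_extend_hilb_fields_simps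
    by (rule psd_form_subspace.lift2_coset[OF psd_form_subspace_stine t[OF f] t[OF g]])
  also have "\<dots> = form f g"
    unfolding stine_form_eq tensor_class_def
    by (rule psd_form_subspace.lift2_coset[OF psd_form_subspace_rels f g])
  finally show ?thesis .
qed

lemma qmap_carrier: "f \<in> FS \<Longrightarrow> qmap f \<in> carrier (stine_space K \<phi>)"
  using linear_mapsD(1)[OF qmap_linear] .

lemma qmap_range: "qmap ` FS \<subseteq> carrier (stine_space K \<phi>)"
  using qmap_carrier by blast

text \<open>Both quotient maps are onto, so the range of \<open>qmap\<close> contains that of
  \<open>completion_embed\<close>.\<close>

lemma qmap_dense: "dense_in (stine_space K \<phi>) (qmap ` FS)"
proof -
  interpret P: pre_hilbert_space "stine_pre K \<phi>" by (rule pre_hilbert_space_stine_pre)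
  have "completion_embed (stine_pre K \<phi>) ` carrier (stine_pre K \<phi>) \<subseteq> qmap ` FS"
  proof (rule image_subsetI)
    fix X assume "X \<in> carrier (stine_pre K \<phi>)"
    then have "X \<in> carrier (vquot (stine_tensor K) (stine_null K \<phi>))"
      by (simp only: stine_pre_def module_extend_hilb_fields_simps)
    then obtain \<zeta> where \<zeta>: "\<zeta> \<in> carrier (stine_tensor K)" "X = stine_null K \<phi> +>\<^bsub>stine_tensor K\<^esub> \<zeta>"
      by (rule vector_subspace.coset_cases[OF psd_form_subspace.axioms(2)[OF psd_form_subspace_stine]])
    from \<zeta>(1) have "\<zeta> \<in> carrier (vquot (free_space gens) rels)" by (simp only: stine_tensor_eq)
    then obtain f where f: "f \<in> FS" "\<zeta> = rels +>\<^bsub>free_space gens\<^esub> f"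
      by (rule vector_subspace.coset_cases[OF psd_form_subspace.axioms(2)[OF psd_form_subspace_rels]])
    have "completion_embed (stine_pre K \<phi>) X = qmap f"
      by (simp only: \<zeta>(2) f(2) qmap_def stine_class_def tensor_class_def)
    then show "completion_embed (stine_pre K \<phi>) X \<in> qmap ` FS"
      using f(1) by blast
  qed
  then show ?thesis
    unfolding stine_space_def by (rule dense_in_mono[OF P.completion_embed_dense])
qed

text \<open>If \<open>f - g\<close> is orthogonal to all formal combinations, it is so to itself and
  its class vanishes. Identities that fail for formal combinations but hold for tensors can thus be
  read off from the kernel.\<close>

lemma qmap_eqI:
  assumes f: "f \<in> FS" and g: "g \<in> FS"
    and eq: "\<And>h. h \<in> FS \<Longrightarrow> form h f = form h g"
  shows "qmap f = qmap g"
proof -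
  interpret S: hilbert_space "stine_space K \<phi>" by (rule hilbert_space_stine)
  interpret F: Module.module complex_field "free_space gens" by (rule module_free_space)
  let ?d = "f \<ominus>\<^bsub>free_space gens\<^esub> g"
  have d: "?d \<in> FS" using F.minus_closed[OF f g] .
  have "qmap f \<ominus>\<^bsub>stine_space K \<phi>\<^esub> qmap g = qmap ?d"
    using linear_maps_diff[OF module_free_space S.module_axioms qmap_linear f g] by simp
  moreover have "form ?d ?d = 0"
    using eq[OF d] by (simp add: free_space_minus[OF f g] sesqui_diff_right)
  ultimately have "hnorm (stine_space K \<phi>) (qmap f \<ominus>\<^bsub>stine_space K \<phi>\<^esub> qmap g) = 0"
    by (simp only: hnorm_def cinner_qmap[OF d d]) simp
  then show ?thesis using S.eq_iff_hnorm_minus[OF qmap_carrier[OF f] qmap_carrier[OF g]] by simp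
qed

lemma hnorm_qmap:
  "f \<in> FS \<Longrightarrow> hnorm (stine_space K \<phi>) (qmap f) = sqrt (Re (form f f))"
  by (simp only: hnorm_def cinner_qmap)

lemma single_carrier: "v \<in> carrier K \<Longrightarrow> Poly_Mapping.single (a, v) c \<in> FS"
  by simp

text \<open>The condition that determines \<open>stine_rep\<close> speaks of finite sums of pure
  tensors; this connects them with \<open>qmap\<close>.\<close>

lemma stine_class_finsum:
  fixes n :: nat
  assumes "v \<in> {..<n} \<rightarrow> carrier K"
  shows "(\<Sum>i<n. gen (b i, v i)) \<in> FS"
    "stine_class K \<phi> (\<Oplus>\<^bsub>stine_tensor K\<^esub>i\<in>{..<n}. pure_tensor cstar_alg K (b i) (v i)) =
     qmap (\<Sum>i<n. gen (b i, v i))"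
proof -
  interpret T: Module.module complex_field
    "stine_tensor K :: (complex, ('a \<times> 'k \<Rightarrow>\<^sub>0 complex) set) module"
    by (rule psd_form.axioms(1)[OF psd_form_stine])
  interpret F: Module.module complex_field "free_space gens" by (rule module_free_space)
  have pure: "pure_tensor cstar_alg K a x = tensor_class (gen (a, x))" for a x
    by (simp add: pure_tensor_def tensor_class_def)
  have "(\<Sum>i<n. gen (b i, v i)) \<in> FS \<and>
    (\<Oplus>\<^bsub>stine_tensor K\<^esub>i\<in>{..<n}. tensor_class (gen (b i, v i))) = tensor_class (\<Sum>i<n. gen (b i, v i))"
    using assms
  proof (induction n)
    case 0
    then show ?case
      using linear_maps_zero[OF module_free_space T.module_axioms tensor_class_linear]
      by (simp del: free_space_simps(1)) simp
  next
    case (Suc n)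
    have v: "v \<in> {..<n} \<rightarrow> carrier K" using Suc.prems by auto
    note IH = conjunct1[OF Suc.IH[OF v]] conjunct2[OF Suc.IH[OF v]]
    have g: "gen (b i, v i) \<in> FS" if "i < Suc n" for i
      using Suc.prems that by (intro single_carrier) auto
    have "(\<Oplus>\<^bsub>stine_tensor K\<^esub>i\<in>{..<Suc n}. tensor_class (gen (b i, v i))) =
        tensor_class (gen (b n, v n)) \<oplus>\<^bsub>stine_tensor K\<^esub> tensor_class (\<Sum>i<n. gen (b i, v i))"
      unfolding lessThan_Suc IH(2)[symmetric]
      by (rule T.finsum_insert) (use g linear_mapsD(1)[OF tensor_class_linear] in \<open>auto simp del: free_space_simps\<close>)
    also have "\<dots> = tensor_class (gen (b n, v n) \<oplus>\<^bsub>free_space gens\<^esub> (\<Sum>i<n. gen (b i, v i)))"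
      using linear_mapsD(2)[OF tensor_class_linear g[OF lessI] IH(1)] by simp
    finally show ?case
      using F.a_closed[OF g[OF lessI] IH(1)] by (simp add: add.commute)
  qed
  then show "(\<Sum>i<n. gen (b i, v i)) \<in> FS"
    "stine_class K \<phi> (\<Oplus>\<^bsub>stine_tensor K\<^esub>i\<in>{..<n}. pure_tensor cstar_alg K (b i) (v i)) =
     qmap (\<Sum>i<n. gen (b i, v i))"
    unfolding pure qmap_def by simp_all
qed

text \<open>Left multiplication before any quotient. It is multiplicative in \<open>a\<close> on the
  nose, whereas additivity and homogeneity in \<open>a\<close> hold only modulo the tensor
  relations; they are therefore proved inside the form, in \<open>form_lmul_add\<close> and
  \<open>form_lmul_scale\<close>.\<close>

definition lmul :: "'a \<Rightarrow> ('a \<times> 'k \<Rightarrow>\<^sub>0 complex) \<Rightarrow> 'a \<times> 'k \<Rightarrow>\<^sub>0 complex" where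
  "lmul a = free_lift (free_space gens) (\<lambda>(b, v). gen (a * b, v))"

lemma lmul_linear: "lmul a \<in> linear_maps (free_space gens) (free_space gens)"
  unfolding lmul_def by (rule free_lift_linear[OF module_free_space]) auto

lemma lmul_single:
  assumes "v \<in> carrier K"
  shows "lmul a (Poly_Mapping.single (b, v) c) = Poly_Mapping.single (a * b, v) c"
  unfolding lmul_def
  by (subst free_lift_single[OF module_free_space, where X = gens])
    (use assms in \<open>auto simp: scale_single\<close>)

lemma lmul_carrier: "f \<in> FS \<Longrightarrow> lmul a f \<in> FS"
  using linear_mapsD(1)[OF lmul_linear] .

lemma lmul_add:
  "\<lbrakk>f \<in> FS; g \<in> FS\<rbrakk> \<Longrightarrow> lmul a (f + g) = lmul a f + lmul a g"
  using linear_mapsD(2)[OF lmul_linear] by simp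

lemma lmul_zero [simp]: "lmul a 0 = 0"
  using linear_maps_zero[OF module_free_space module_free_space lmul_linear] by simp

lemma lmul_mult: "f \<in> FS \<Longrightarrow> lmul (a * b) f = lmul a (lmul b f)"
proof (induction rule: free_space_induct)
  case (single p c)
  then show ?case by (cases p) (simp add: lmul_single mult.assoc)
qed (simp_all only: lmul_add lmul_carrier lmul_zero)

lemma lmul_one: "f \<in> FS \<Longrightarrow> lmul 1 f = f"
proof (induction rule: free_space_induct)
  case (single p c)
  then show ?case by (cases p) (simp add: lmul_single)
qed (simp_all only: lmul_add lmul_zero)

lemma lmul_sum_gen:
  fixes n :: nat
  assumes "v \<in> {..<n} \<rightarrow> carrier K"
  shows "lmul a (\<Sum>i<n. gen (b i, v i)) = (\<Sum>i<n. gen (a * b i, v i))"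
  using assms
proof (induction n)
  case (Suc n)
  then have v: "v \<in> {..<n} \<rightarrow> carrier K" "v n \<in> carrier K" by auto
  show ?case
    using Suc.IH[OF v(1)] lmul_add[OF stine_class_finsum(1)[OF v(1)] single_carrier[OF v(2)]]
      lmul_single[OF v(2)] by simp
qed simp

text \<open>Induction over both arguments reduces an identity to pairs of generators with
  coefficients. Additivity enters as preservation of the equality under sums, so that one rule
  serves expressions of different shapes.\<close>

lemma biadditive_eqI:
  assumes f: "f \<in> FS" and g: "g \<in> FS"
    and single: "\<And>a v c b w d. \<lbrakk>v \<in> carrier K; w \<in> carrier K\<rbrakk> \<Longrightarrow>
      \<Phi> (Poly_Mapping.single (a, v) c) (Poly_Mapping.single (b, w) d) =
      \<Psi> (Poly_Mapping.single (a, v) c) (Poly_Mapping.single (b, w) d)"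
    and zero: "\<And>g. \<Phi> 0 g = \<Psi> 0 g" "\<And>f. \<Phi> f 0 = \<Psi> f 0"
    and addL: "\<And>f f' g. \<lbrakk>f \<in> FS; f' \<in> FS;
        \<Phi> f g = \<Psi> f g; \<Phi> f' g = \<Psi> f' g\<rbrakk> \<Longrightarrow> \<Phi> (f + f') g = \<Psi> (f + f') g"
    and addR: "\<And>f g g'. \<lbrakk>g \<in> FS; g' \<in> FS;
        \<Phi> f g = \<Psi> f g; \<Phi> f g' = \<Psi> f g'\<rbrakk> \<Longrightarrow> \<Phi> f (g + g') = \<Psi> f (g + g')"
  shows "\<Phi> f g = \<Psi> f g"
  using f
proof (induction rule: free_space_induct)
  case zero
  show ?case by (rule assms(4))
next
  case (add f f')
  then show ?case by (rule addL)
next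
  case (single p c)
  from g show ?case
  proof (induction rule: free_space_induct)
    case zero
    show ?case by (rule assms(5))
  next
    case (add g g')
    then show ?case by (rule addR)
  next
    case (single q d)
    with \<open>p \<in> gens\<close> show ?case by (cases p; cases q) (simp add: assms(3))
  qed
qed

text \<open>On generators both sides contain \<open>\<phi>\<close> at
  \<open>cstar b * cstar a * c\<close>, since the star reverses products.\<close>

lemma form_lmul_left:
  "\<lbrakk>f \<in> FS; g \<in> FS\<rbrakk> \<Longrightarrow>
    form (lmul a f) g = form f (lmul (cstar a) g)"
  by (rule biadditive_eqI[where \<Phi> = "\<lambda>f g. form (lmul a f) g" and \<Psi> = "\<lambda>f g. form f (lmul (cstar a) g)"])
    (simp_all add: lmul_add lmul_single sesqui_add_left sesqui_add_right sesqui_single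
      kern_def cstar_mult mult.assoc del: free_space_simps)

lemma form_lmul_add:
  "\<lbrakk>f \<in> FS; g \<in> FS\<rbrakk> \<Longrightarrow>
    form f (lmul (a + b) g) = form f (lmul a g + lmul b g)"
  by (rule biadditive_eqI[where \<Phi> = "\<lambda>f g. form f (lmul (a + b) g)" and \<Psi> = "\<lambda>f g. form f (lmul a g + lmul b g)"])
    (simp_all add: lmul_add lmul_single sesqui_add_left sesqui_add_right sesqui_single algebra_simps
      kern_def phi_add phi_carrier form_add_right del: free_space_simps)

lemma form_lmul_scale:
  "\<lbrakk>f \<in> FS; g \<in> FS\<rbrakk> \<Longrightarrow>
    form f (lmul (c *\<^sub>C a) g) = form f (Poly_Mapping.map ((*) c) (lmul a g))"
  unfolding sesqui_scale_right
  by (rule biadditive_eqI[where \<Phi> = "\<lambda>f g. form f (lmul (c *\<^sub>C a) g)" and \<Psi> = "\<lambda>f g. c * form f (lmul a g)"])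
    (simp_all add: lmul_add lmul_single sesqui_add_left sesqui_add_right sesqui_single algebra_simps
      kern_def mult_scaleC_right mult_scaleC_left phi_scale phi_carrier form_smult_right del: free_space_simps)

end

text \<open>The square root of \<open>1 - x\<close> is \<open>1 - z\<close>, where \<open>z\<close> is the fixed point of the contraction
  \<open>z \<mapsto> (x + z\<^sup>2) / 2\<close> of the self-adjoint part of the ball of radius \<open>\<parallel>x\<parallel>\<close>.\<close>

lemma norm_cstar: "norm (cstar x) = norm x" for x :: "'a::cstar_algebra"
proof -
  have le: "norm x \<le> norm (cstar x)" for x :: 'a
  proof (cases "norm x = 0")
    case False
    have "norm x * norm x \<le> norm (cstar x) * norm x"
      using cstar_norm[of x] norm_mult_ineq[of "cstar x" x] by (simp add: power2_eq_square)
    then show ?thesis using False by simp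
  qed simp
  show ?thesis using le[of x] le[of "cstar x"] by (simp add: cstar_cstar)
qed

lemma cstar_uminus: "cstar (- x) = - cstar x" for x :: "'a::cstar_algebra"
  using cstar_add[of x "- x"] by (simp add: add_eq_0_iff)

lemma cstar_diff: "cstar (x - y) = cstar x - cstar y" for x :: "'a::cstar_algebra"
  using cstar_add[of x "- y"] by (simp add: cstar_uminus)

lemma cstar_scaleR: "cstar (r *\<^sub>R x) = r *\<^sub>R cstar x" for x :: "'a::cstar_algebra"
  by (simp add: scaleR_scaleC cstar_scaleC)

lemma one_minus_positive:
  fixes x :: "'a::cstar_algebra"
  assumes sa: "cstar x = x" and norm: "norm x < 1"
  obtains y where "cstar y * y = 1 - x"
proof -
  define r where "r = norm x"
  define S :: "'a set" where "S = {z. norm z \<le> r} \<inter> {z. cstar z = z}"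
  define T where "T z = (1/2) *\<^sub>R (x + z * z)" for z
  have r: "0 \<le> r" "r < 1" using norm by (simp_all add: r_def)
  \<comment> \<open>The star is isometric. Its continuity makes the self-adjoint elements a closed
    set, so that \<open>S\<close> is complete.\<close>
  have "continuous_on UNIV (cstar :: 'a \<Rightarrow> 'a)"
  proof (rule continuous_onI)
    fix z :: 'a and e :: real assume "0 < e"
    then show "\<exists>d>0. \<forall>z'\<in>UNIV. dist z' z < d \<longrightarrow> dist (cstar z') (cstar z) \<le> e"
      by (intro exI[of _ e]) (simp add: dist_norm norm_cstar flip: cstar_diff)
  qed
  then have "closed {z::'a. cstar z = z}"
    by (intro closed_Collect_eq continuous_on_id) simp_all
  moreover have "closed {z::'a. norm z \<le> r}"
    by (intro closed_Collect_le continuous_intros)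
  ultimately have "complete S"
    by (simp add: S_def complete_eq_closed closed_Int)
  moreover have "0 \<in> S" using r by (simp add: S_def)
  then have "S \<noteq> {}" by blast
  moreover have "T ` S \<subseteq> S"
  proof (rule image_subsetI)
    fix z assume z: "z \<in> S"
    \<comment> \<open>As \<open>r < 1\<close>, squares of elements of the ball stay in the ball, and
      so does the average with \<open>x\<close>, whose norm is r.\<close>
    have "norm (z * z) \<le> r * r"
      using z norm_mult_ineq[of z z] mult_mono[of "norm z" r "norm z" r] r by (simp add: S_def)
    also have "\<dots> \<le> r" using mult_left_mono[of r 1 r] r by simp
    finally have "norm (x + z * z) \<le> r + r"
      using norm_triangle_ineq[of x "z * z"] by (simp add: r_def)
    then show "T z \<in> S"
      using z sa by (simp add: S_def T_def cstar_scaleR cstar_add cstar_mult)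
  qed
  moreover have "dist (T z) (T w) \<le> r * dist z w" if "z \<in> S \<and> w \<in> S" for z w
  proof -
    \<comment> \<open>A factorisation of the difference of squares that does not assume that z and w
      commute. Each of the two terms has norm at most \<open>r * norm (z - w)\<close>, and the
      factor 1/2 leaves the constant r.\<close>
    have "T z - T w = (1/2) *\<^sub>R (z * (z - w) + (z - w) * w)"
      by (simp add: T_def algebra_simps flip: scaleR_right_diff_distrib)
    moreover have "norm (z * (z - w)) \<le> r * norm (z - w)"
      using norm_mult_ineq[of z "z - w"] mult_right_mono[of "norm z" r "norm (z - w)"] that
      by (simp add: S_def)
    moreover have "norm ((z - w) * w) \<le> r * norm (z - w)"
      using norm_mult_ineq[of "z - w" w] mult_left_mono[of "norm w" r "norm (z - w)"] that
      by (simp add: S_def mult.commute)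
    ultimately show ?thesis
      using norm_triangle_ineq[of "z * (z - w)" "(z - w) * w"] by (simp add: dist_norm)
  qed
  ultimately have "\<exists>!z. z \<in> S \<and> T z = z"
    using r by (intro Banach_fix[of S r T]) auto
  then obtain z where z: "z \<in> S" "T z = z" by blast
  have "2 *\<^sub>R z = x + z * z" using z(2) by (simp add: T_def) (metis scaleR_half_double scaleR_2 scaleR_right_distrib)
  then have "z + z = x + z * z" by (simp add: scaleR_2)
  moreover have "(1 - z) * (1 - z) = 1 - (z + z) + z * z" by (simp add: algebra_simps)
  ultimately have "(1 - z) * (1 - z) = 1 - x" by simp
  then show ?thesis using that[of "1 - z"] z(1) by (simp add: S_def cstar_diff)
qed

context ocp
begin

lemma form_lmul_bounded:
  assumes f: "f \<in> FS"
  shows "Re (form (lmul a f) (lmul a f)) \<le> ((norm a)\<^sup>2 + 1) * Re (form f f)"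
proof -
  \<comment> \<open>Adding 1 makes t positive and the norm of \<open>x\<close> strictly less than 1,
    also for \<open>a = 0\<close>.\<close>
  define t where "t = (norm a)\<^sup>2 + 1"
  define x where "x = (1 / t) *\<^sub>R (cstar a * a)"
  have t: "0 < t" by (simp add: t_def add_nonneg_pos)
  have "norm x < 1" using t by (simp add: x_def cstar_norm) (simp add: t_def)
  moreover have "cstar x = x" by (simp add: x_def cstar_scaleR cstar_mult cstar_cstar)
  ultimately obtain y where y: "cstar y * y = 1 - x" using one_minus_positive by blast
  have lm: "form (lmul b f) (lmul b f) = form f (lmul (cstar b * b) f)" for b
    using form_lmul_left[OF f lmul_carrier[OF f]] lmul_mult[OF f] by simp
  \<comment> \<open>\<open>1 - x\<close> is expanded under the form, where \<open>lmul\<close> is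
    linear in the algebra element.\<close>
  have "form (lmul y f) (lmul y f) = form f (lmul (1 + (- complex_of_real (1 / t)) *\<^sub>C (cstar a * a)) f)"
    unfolding lm y
    using scaleC_scaleC[of "- 1" "complex_of_real (1 / t)" "cstar a * a"]
    by (simp only: x_def scaleR_scaleC scaleC_uminus_one mult_minus1 diff_conv_add_uminus)
  also have "\<dots> = form f f - complex_of_real (1 / t) * form (lmul a f) (lmul a f)"
    unfolding form_lmul_add[OF f f] sesqui_add_right form_lmul_scale[OF f f] sesqui_scale_right
      lmul_one[OF f] lm by simp
  finally have "Re (form (lmul y f) (lmul y f)) = Re (form f f) - (1 / t) * Re (form (lmul a f) (lmul a f))"
    by simp
  then have "Re (form (lmul a f) (lmul a f)) + t * Re (form (lmul y f) (lmul y f)) = t * Re (form f f)"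
    using t by (simp add: field_simps)
  moreover have "0 \<le> Re (form (lmul y f) (lmul y f))"
    using form_self_nonneg[OF lmul_carrier[OF f]] by (metis Re_complex_of_real)
  then have "0 \<le> t * Re (form (lmul y f) (lmul y f))" using t by simp
  ultimately have "Re (form (lmul a f) (lmul a f)) \<le> t * Re (form f f)" by linarith
  then show ?thesis by (simp add: t_def)
qed

end

section \<open>Stinespring's representation\<close>

context ocp
begin

abbreviation space where "space \<equiv> stine_space K \<phi>"

sublocale S: hilbert_space "stine_space K \<phi>" by (rule hilbert_space_stine)

lemma qmap_add: "\<lbrakk>f \<in> FS; g \<in> FS\<rbrakk> \<Longrightarrow>
    qmap (f + g) = qmap f \<oplus>\<^bsub>space\<^esub> qmap g"
  using linear_mapsD(2)[OF qmap_linear, of f g] by simp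

lemma qmap_zero: "qmap 0 = \<zero>\<^bsub>space\<^esub>"
  using linear_maps_zero[OF module_free_space S.module_axioms qmap_linear] by simp

lemma qmap_single: "v \<in> carrier K \<Longrightarrow> qmap (Poly_Mapping.single (a, v) c) = c \<odot>\<^bsub>space\<^esub> qmap (gen (a, v))"
  using linear_mapsD(3)[OF qmap_linear, of "gen (a, v)" c] by (simp add: scale_single)

lemma bounded_linear_qmap_eqI:
  assumes "Module.module complex_field M" "T \<in> linear_maps space M" "R \<in> linear_maps (free_space gens) M"
    and "\<And>a v. v \<in> carrier K \<Longrightarrow> T (qmap (gen (a, v))) = R (gen (a, v))"
    and "f \<in> FS"
  shows "T (qmap f) = R f"
  using assms(5)
proof (induction rule: free_space_induct)
  case zero
  show ?case
    using linear_maps_zero[OF S.module_axioms assms(1,2)] linear_maps_zero[OF module_free_space assms(1,3)]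
    by (simp add: qmap_zero)
next
  case (single p c)
  obtain a v where p: "p = (a, v)" by (cases p)
  have v: "v \<in> carrier K" using single p by simp
  show ?case
    using linear_mapsD(3)[OF assms(2) qmap_carrier[OF single_carrier[OF v]], of c a 1]
      linear_mapsD(3)[OF assms(3) single_carrier[OF v], of c a 1] assms(4)[OF v, of a]
    by (simp add: p qmap_single[OF v, of a c] scale_single)
next
  case (add f g)
  then show ?case
    using linear_mapsD(2)[OF assms(2) qmap_carrier[OF add(1)] qmap_carrier[OF add(2)]]
      linear_mapsD(2)[OF assms(3) add(1,2)] by (simp add: qmap_add)
qed

lemma qmap_lmul_linear: "(\<lambda>f. qmap (lmul a f)) \<in> linear_maps (free_space gens) space"
  by (rule linear_maps_comp[OF lmul_linear qmap_linear])

lemma stine_rep_exists: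
  "\<exists>T\<in>bounded_ops space space. \<forall>f\<in>FS. T (qmap f) = qmap (lmul a f)"
proof (rule bounded_extension[OF module_free_space S.pre_hilbert_space_axioms S.hilbert_space_axioms
      qmap_linear qmap_lmul_linear _ qmap_dense])
  fix f assume f: "f \<in> FS"
  have "sqrt (Re (form (lmul a f) (lmul a f))) \<le> sqrt (((norm a)\<^sup>2 + 1) * Re (form f f))"
    by (rule real_sqrt_le_mono[OF form_lmul_bounded[OF f]])
  then show "hnorm space (qmap (lmul a f)) \<le> sqrt ((norm a)\<^sup>2 + 1) * hnorm space (qmap f)"
    by (simp only: hnorm_qmap[OF f] hnorm_qmap[OF lmul_carrier[OF f]] real_sqrt_mult)
qed

text \<open>Resolves the definite description. The operator built by extension meets its condition,
  and an operator that meets it is determined on classes of pure tensors, hence on a dense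
  subspace.\<close>

lemma stine_rep:
  "stine_rep K \<phi> a \<in> bounded_ops space space \<and>
   (\<forall>f\<in>FS. stine_rep K \<phi> a (qmap f) = qmap (lmul a f))"
proof -
  obtain T where T: "T \<in> bounded_ops space space"
    "\<And>f. f \<in> FS \<Longrightarrow> T (qmap f) = qmap (lmul a f)"
    using stine_rep_exists[of a] by metis
  have "stine_rep K \<phi> a = T"
    unfolding stine_rep_def
  proof (rule the_equality)
    have "T (stine_class K \<phi> (\<Oplus>\<^bsub>stine_tensor K\<^esub>i\<in>{..<n}. pure_tensor cstar_alg K (b i) (v i))) =
        stine_class K \<phi> (\<Oplus>\<^bsub>stine_tensor K\<^esub>i\<in>{..<n}. pure_tensor cstar_alg K (a * b i) (v i))"
      if v: "v \<in> {..<n} \<rightarrow> carrier K" for n :: nat and b v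
      unfolding stine_class_finsum(2)[OF v] T(2)[OF stine_class_finsum(1)[OF v]] lmul_sum_gen[OF v] ..
    with T(1) show "T \<in> bounded_ops space space \<and>
     (\<forall>(n::nat) b v. v \<in> {..<n} \<rightarrow> carrier K \<longrightarrow>
        T (stine_class K \<phi> (\<Oplus>\<^bsub>stine_tensor K\<^esub>i\<in>{..<n}. pure_tensor cstar_alg K (b i) (v i))) =
        stine_class K \<phi> (\<Oplus>\<^bsub>stine_tensor K\<^esub>i\<in>{..<n}. pure_tensor cstar_alg K (a * b i) (v i)))"
      by blast
  next
    fix T' assume T': "T' \<in> bounded_ops space space \<and>
     (\<forall>(n::nat) b v. v \<in> {..<n} \<rightarrow> carrier K \<longrightarrow>
        T' (stine_class K \<phi> (\<Oplus>\<^bsub>stine_tensor K\<^esub>i\<in>{..<n}. pure_tensor cstar_alg K (b i) (v i))) =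
        stine_class K \<phi> (\<Oplus>\<^bsub>stine_tensor K\<^esub>i\<in>{..<n}. pure_tensor cstar_alg K (a * b i) (v i)))"
    have gens: "T' (qmap (gen (b, v))) = qmap (lmul a (gen (b, v)))" if v: "v \<in> carrier K" for b v
    proof -
      \<comment> \<open>Sums of a single term already fix the values on classes of
        generators.\<close>
      have v': "(\<lambda>_. v) \<in> {..<Suc 0} \<rightarrow> carrier K" using v by simp
      show ?thesis
        using conjunct2[OF T', rule_format, OF v', of "\<lambda>_. b"]
        unfolding stine_class_finsum(2)[OF v'] by (simp add: lmul_single[OF v])
    qed
    show "T' = T"
    proof (rule bounded_ops_eq_dense[OF S.pre_hilbert_space_axioms S.pre_hilbert_space_axioms
          qmap_dense qmap_range conjunct1[OF T'] T(1)])
      fix x assume "x \<in> qmap ` FS"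
      then obtain f where f: "f \<in> FS" "x = qmap f" by blast
      show "T' x = T x"
        unfolding f(2) T(2)[OF f(1)]
        by (rule bounded_linear_qmap_eqI[OF S.module_axioms bounded_opsD(1)[OF conjunct1[OF T']]
          qmap_lmul_linear gens f(1)])
    qed
  qed
  then show ?thesis using T by simp
qed

lemmas stine_rep_bounded = stine_rep[THEN conjunct1]
lemmas stine_rep_qmap = stine_rep[THEN conjunct2, rule_format]

lemma space_op_eqI:
  assumes "pre_hilbert_space M" "T \<in> bounded_ops space M" "T' \<in> bounded_ops space M"
    and "\<And>f. f \<in> FS \<Longrightarrow> T (qmap f) = T' (qmap f)"
  shows "T = T'"
  by (rule bounded_ops_eq_dense[OF S.pre_hilbert_space_axioms assms(1) qmap_dense qmap_range assms(2,3)])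
    (use assms(4) in blast)

text \<open>Equality of bounded operators is tested on the dense range of \<open>qmap\<close>.
  Product and unit are then identities of \<open>lmul\<close>, while sum and scalar multiple need
  \<open>qmap_eqI\<close>.\<close>

lemma stine_rep_hom: "stine_rep K \<phi> \<in> star_hom cstar_alg (op_alg space)"
proof -
  note b = stine_rep_bounded and q = stine_rep_qmap
  note eqI = space_op_eqI[OF S.pre_hilbert_space_axioms]
  have "stine_rep K \<phi> (a + c) = (\<lambda>x\<in>carrier space. stine_rep K \<phi> a x \<oplus>\<^bsub>space\<^esub> stine_rep K \<phi> c x)" for a c
  proof (rule eqI[OF b S.op_add_bounded[OF b b]])
    fix f assume f: "f \<in> FS"
    have s: "lmul a f + lmul c f \<in> FS"
      using abelian_group.axioms(1)[OF Module.module.axioms(2)[OF module_free_space], THEN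
        abelian_monoid.a_closed, OF lmul_carrier[OF f] lmul_carrier[OF f]] by simp
    have "qmap (lmul (a + c) f) = qmap (lmul a f + lmul c f)"
      by (rule qmap_eqI[OF lmul_carrier[OF f] s form_lmul_add[OF _ f]])
    then show "stine_rep K \<phi> (a + c) (qmap f) =
        (\<lambda>x\<in>carrier space. stine_rep K \<phi> a x \<oplus>\<^bsub>space\<^esub> stine_rep K \<phi> c x) (qmap f)"
      using f qmap_carrier[OF f] by (simp only: q restrict_apply if_True qmap_add lmul_carrier)
  qed
  moreover have "stine_rep K \<phi> (c *\<^sub>C a) = (\<lambda>x\<in>carrier space. c \<odot>\<^bsub>space\<^esub> stine_rep K \<phi> a x)" for a c
  proof (rule eqI[OF b])
    show "(\<lambda>x\<in>carrier space. c \<odot>\<^bsub>space\<^esub> stine_rep K \<phi> a x) \<in> bounded_ops space space"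
      by (rule S.op_smult_bounded[OF b])
    fix f assume f: "f \<in> FS"
    have s: "Poly_Mapping.map ((*) c) (lmul a f) \<in> FS"
      using Module.module.smult_closed[OF module_free_space _ lmul_carrier[OF f], of c] by simp
    have "qmap (lmul (c *\<^sub>C a) f) = qmap (Poly_Mapping.map ((*) c) (lmul a f))"
      by (rule qmap_eqI[OF lmul_carrier[OF f] s form_lmul_scale[OF _ f]])
    then show "stine_rep K \<phi> (c *\<^sub>C a) (qmap f) =
        (\<lambda>x\<in>carrier space. c \<odot>\<^bsub>space\<^esub> stine_rep K \<phi> a x) (qmap f)"
      using f qmap_carrier[OF f] linear_mapsD(3)[OF qmap_linear lmul_carrier[OF f], of c]
      by (simp only: q restrict_apply if_True free_space_simps)
  qed
  moreover have "stine_rep K \<phi> (a * c) = compose (carrier space) (stine_rep K \<phi> a) (stine_rep K \<phi> c)" for a c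
  proof (rule eqI[OF b compose_bounded[OF S.pre_hilbert_space_axioms S.pre_hilbert_space_axioms b b]])
    fix f assume f: "f \<in> FS"
    show "stine_rep K \<phi> (a * c) (qmap f) =
        compose (carrier space) (stine_rep K \<phi> a) (stine_rep K \<phi> c) (qmap f)"
      unfolding compose_eq[OF qmap_carrier[OF f]] q[OF f] q[OF lmul_carrier[OF f]] lmul_mult[OF f] ..
  qed
  moreover have "stine_rep K \<phi> 1 = id_op space"
  proof (rule eqI[OF b id_op_bounded[OF S.pre_hilbert_space_axioms]])
    fix f assume f: "f \<in> FS"
    show "stine_rep K \<phi> 1 (qmap f) = id_op space (qmap f)"
      using qmap_carrier[OF f] by (simp only: q[OF f] lmul_one[OF f] id_op_def restrict_apply if_True)
  qed
  moreover have "stine_rep K \<phi> (cstar a) = adjoint_op space space (stine_rep K \<phi> a)" for a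
  proof (rule eqI[OF b adjoint_op_bounded[OF S.hilbert_space_axioms S.pre_hilbert_space_axioms b]])
    fix f assume f: "f \<in> FS"
    note A = adjoint_op_bounded[OF S.hilbert_space_axioms S.pre_hilbert_space_axioms b]
    show "stine_rep K \<phi> (cstar a) (qmap f) = adjoint_op space space (stine_rep K \<phi> a) (qmap f)"
    \<comment> \<open>The adjoint is known only through inner products, so its values are in turn
      compared by pairing with the dense range.\<close>
    proof (rule S.eq_if_cinner_dense[OF qmap_dense qmap_range bounded_opsD(3)[OF b qmap_carrier[OF f]]
          bounded_opsD(3)[OF A qmap_carrier[OF f]]])
      fix z assume "z \<in> qmap ` FS"
      then obtain g where g: "g \<in> FS" "z = qmap g" by blast
      show "\<langle>stine_rep K \<phi> (cstar a) (qmap f), z\<rangle>\<^bsub>space\<^esub> =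
          \<langle>adjoint_op space space (stine_rep K \<phi> a) (qmap f), z\<rangle>\<^bsub>space\<^esub>"
        unfolding g(2) adjoint_op_cinner[OF S.hilbert_space_axioms S.pre_hilbert_space_axioms b
            qmap_carrier[OF g(1)] qmap_carrier[OF f], symmetric] q[OF f] q[OF g(1)]
          cinner_qmap[OF lmul_carrier[OF f] g(1)] cinner_qmap[OF f lmul_carrier[OF g(1)]]
          form_lmul_left[OF f g(1)] cstar_cstar ..
    qed
  qed
  ultimately show ?thesis
    by (simp add: star_hom_def ring_hom_def b)
qed

section \<open>The anchor operator and minimality\<close>

lemma qmap_relation:
  assumes "f - g \<in> bilinear_relations cstar_alg K"
    and f: "f \<in> FS" and g: "g \<in> FS"
  shows "qmap f = qmap g"
  by (rule qmap_eqI[OF f g])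
    (use bilinear_relations_null(2)[OF assms(1)] in \<open>simp add: sesqui_diff_right\<close>)

lemma stine_anchor_eq: "w \<in> carrier K \<Longrightarrow> stine_anchor K \<phi> w = qmap (gen (1, w))"
  by (simp add: stine_anchor_def qmap_def pure_tensor_def tensor_class_def)

text \<open>The squared norm of the class of \<open>1 \<otimes> w\<close> is
  \<open>\<langle>w, \<phi> 1 w\<rangle>\<close>, so the bound is the square root of one for
  \<open>\<phi> 1\<close>. Linearity comes from the tensor relations.\<close>

lemma stine_anchor_bounded: "stine_anchor K \<phi> \<in> bounded_ops K space"
proof -
  obtain C where C: "0 < C" "\<And>x. x \<in> carrier K \<Longrightarrow> hnorm K (\<phi> 1 x) \<le> C * hnorm K x"
    using bounded_ops_bound[OF pre_hilbert_space_axioms phi_bounded] by blast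
  show ?thesis
  proof (rule bounded_opsI[where C = "sqrt C"])
    show "stine_anchor K \<phi> \<in> linear_maps K space"
    proof (rule linear_mapsI)
      fix v w c assume v: "v \<in> carrier K"
      show "stine_anchor K \<phi> v \<in> carrier space"
        unfolding stine_anchor_eq[OF v] by (rule qmap_carrier[OF single_carrier[OF v]])
      have cv: "c \<odot> v \<in> carrier K" using v by simp
      have "gen (1, c \<odot> v) - Poly_Mapping.single (1, v) c \<in> bilinear_relations cstar_alg K"
        unfolding bilinear_relations_def using v by auto
      from qmap_relation[OF this single_carrier[OF cv] single_carrier[OF v]]
      show "stine_anchor K \<phi> (c \<odot> v) = c \<odot>\<^bsub>space\<^esub> stine_anchor K \<phi> v"
        by (simp only: stine_anchor_eq[OF v] stine_anchor_eq[OF cv] qmap_single[OF v, of 1 c])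
      assume w: "w \<in> carrier K"
      have vw: "v \<oplus> w \<in> carrier K" using v w by simp
      have s: "gen (1, v) + gen (1, w) \<in> FS"
        using keys_add[of "gen (1, v)" "gen (1, w)"] v w by auto
      have "gen (1, v \<oplus> w) - gen (1, v) - gen (1, w) \<in> bilinear_relations cstar_alg K"
        unfolding bilinear_relations_def using v w by auto
      then have "gen (1, v \<oplus> w) - (gen (1, v) + gen (1, w)) \<in> bilinear_relations cstar_alg K"
        by (simp add: diff_diff_eq)
      from qmap_relation[OF this single_carrier[OF vw] s]
      show "stine_anchor K \<phi> (v \<oplus> w) = stine_anchor K \<phi> v \<oplus>\<^bsub>space\<^esub> stine_anchor K \<phi> w"
        by (simp only: stine_anchor_eq v w vw qmap_add[OF single_carrier[OF v] single_carrier[OF w]])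
    qed
    fix w assume w: "w \<in> carrier K"
    have "Re (form (gen (1, w)) (gen (1, w))) = Re \<langle>w, \<phi> 1 w\<rangle>"
      by (simp add: sesqui_single kern_def)
    also have "\<dots> \<le> hnorm K w * hnorm K (\<phi> 1 w)"
      using complex_Re_le_cmod[of "\<langle>w, \<phi> 1 w\<rangle>"] cinner_bound[OF w phi_carrier[OF w]] order.trans by blast
    also have "\<dots> \<le> hnorm K w * (C * hnorm K w)"
      using C(2)[OF w] w by (intro mult_left_mono) simp_all
    finally have "Re (form (gen (1, w)) (gen (1, w))) \<le> C * (hnorm K w)\<^sup>2"
      by (simp add: power2_eq_square mult_ac)
    then have "sqrt (Re (form (gen (1, w)) (gen (1, w)))) \<le> sqrt (C * (hnorm K w)\<^sup>2)"
      by (rule real_sqrt_le_mono)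
    then show "hnorm space (stine_anchor K \<phi> w) \<le> sqrt C * hnorm K w"
      using w by (simp add: stine_anchor_eq[OF w] hnorm_qmap[OF single_carrier[OF w]] real_sqrt_mult
        del: free_space_simps)
  qed (simp add: stine_anchor_def)
qed

text \<open>The source of minimality: the vectors whose span has to be dense are the classes of pure
  tensors, and these span the range of \<open>qmap\<close>.\<close>

lemma stine_rep_anchor:
  "v \<in> carrier K \<Longrightarrow> stine_rep K \<phi> a (stine_anchor K \<phi> v) = qmap (gen (a, v))"
  by (simp add: stine_anchor_eq stine_rep_qmap[OF single_carrier] lmul_single del: free_space_simps)

text \<open>Moving the adjoint of the anchor to the other side leaves the form between
  \<open>1 \<otimes> z\<close> and \<open>a \<otimes> v\<close>, which is
  \<open>\<langle>z, \<phi> a v\<rangle>\<close>.\<close>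

lemma stine_minimal_stinespring_rep: "minimal_stinespring_rep K \<phi> (stine K \<phi>)"
proof -
  let ?V = "stine_anchor K \<phi>" and ?\<pi> = "stine_rep K \<phi>"
  note V = stine_anchor_bounded
  note A = adjoint_op_bounded[OF hilbert_space_axioms S.pre_hilbert_space_axioms V]
  have "\<phi> a = compose (carrier K) (adjoint_op K space ?V) (compose (carrier K) (?\<pi> a) ?V)" for a
  proof (rule bounded_ops_eqI[OF phi_bounded])
    show "compose (carrier K) (adjoint_op K space ?V) (compose (carrier K) (?\<pi> a) ?V) \<in> bounded_ops K K"
      by (intro compose_bounded[of K space] pre_hilbert_space_axioms S.pre_hilbert_space_axioms A V
        stine_rep_bounded)
    fix v assume v: "v \<in> carrier K"
    have "\<phi> a v = adjoint_op K space ?V (?\<pi> a (?V v))"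
      unfolding stine_rep_anchor[OF v]
    proof (rule vector_eqI[OF phi_carrier[OF v] bounded_opsD(3)[OF A qmap_carrier[OF single_carrier[OF v]]]])
      fix z assume z: "z \<in> carrier K"
      have "\<langle>z, adjoint_op K space ?V (qmap (gen (a, v)))\<rangle> = \<langle>?V z, qmap (gen (a, v))\<rangle>\<^bsub>space\<^esub>"
        by (rule adjoint_op_cinner_right[OF hilbert_space_axioms S.pre_hilbert_space_axioms V z
          qmap_carrier[OF single_carrier[OF v]]])
      also have "\<dots> = form (gen (1, z)) (gen (a, v))"
        unfolding stine_anchor_eq[OF z] by (rule cinner_qmap[OF single_carrier[OF z] single_carrier[OF v]])
      also have "\<dots> = \<langle>z, \<phi> a v\<rangle>" by (simp add: sesqui_single kern_def)
      finally show "\<langle>z, \<phi> a v\<rangle> = \<langle>z, adjoint_op K space ?V (qmap (gen (a, v)))\<rangle>" ..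
    qed
    then show "\<phi> a v = compose (carrier K) (adjoint_op K space ?V) (compose (carrier K) (?\<pi> a) ?V) v"
      by (simp add: compose_eq[OF v])
  qed
  moreover have "htopology space closure_of vspan space {?\<pi> a (?V v) | a v. v \<in> carrier K} = carrier space"
  proof -
    let ?D = "{?\<pi> a (?V v) | a v. v \<in> carrier K}"
    have D: "?D \<subseteq> carrier space"
      using bounded_opsD(3)[OF stine_rep_bounded] bounded_opsD(3)[OF V] by blast
    note sub = submodule_vspan[OF S.module_axioms D]
    note sub' = submoduleD[OF sub]
    have "qmap ` FS \<subseteq> vspan space ?D"
    proof (rule image_subsetI)
      fix f assume "f \<in> FS"
      then show "qmap f \<in> vspan space ?D"
      proof (induction rule: free_space_induct)
        case zero
        then show ?case using sub'(2) by (simp add: qmap_zero)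
      next
        case (single p c)
        obtain a v where p: "p = (a, v)" by (cases p)
        have v: "v \<in> carrier K" using single p by simp
        have "qmap (gen (a, v)) \<in> ?D" using stine_rep_anchor[OF v, of a] v by blast
        then have "qmap (gen (a, v)) \<in> vspan space ?D" by (rule subsetD[OF vspan_superset])
        then show ?case unfolding p qmap_single[OF v, of a c] by (rule sub'(4))
      next
        case (add f g)
        show ?case unfolding qmap_add[OF add(1,2)] by (rule sub'(3)[OF add(3,4)])
      qed
    qed
    from dense_in_mono[OF qmap_dense this] show ?thesis
      unfolding S.dense_iff[OF sub'(1)] dense_in_def .
  qed
  ultimately show ?thesis
    using hilbert_space_axioms S.hilbert_space_axioms stine_rep_hom V
    by (simp add: minimal_stinespring_rep_def stine_def)
qed

end

section \<open>Uniqueness of minimal Stinespring representations\<close>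

locale minimal_rep = ocp K \<phi> for K :: "'k hilb" and \<phi> :: "'a::cstar_algebra \<Rightarrow> 'k \<Rightarrow> 'k" +
  fixes H :: "'h hilb" and \<pi> :: "'a \<Rightarrow> 'h \<Rightarrow> 'h" and V :: "'k \<Rightarrow> 'h"
  assumes minimal_rep: "minimal_stinespring_rep K \<phi> (K, H, \<pi>, V)"
begin

sublocale H: hilbert_space H
  using minimal_rep by (simp add: minimal_stinespring_rep_def)

lemma pi_hom: "\<pi> \<in> star_hom cstar_alg (op_alg H)" and V_bounded: "V \<in> bounded_ops K H"
  using minimal_rep by (simp_all add: minimal_stinespring_rep_def)

lemma phi_eq: "\<phi> a = compose (carrier K) (adjoint_op K H V) (compose (carrier K) (\<pi> a) V)"
  using minimal_rep by (simp add: minimal_stinespring_rep_def)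

lemma pi_bounded: "\<pi> a \<in> bounded_ops H H"
  and pi_mult: "\<pi> (a * b) = compose (carrier H) (\<pi> a) (\<pi> b)"
  and pi_one: "\<pi> 1 = id_op H" and pi_star: "\<pi> (cstar a) = adjoint_op H H (\<pi> a)"
  using pi_hom by (simp_all add: star_hom_def ring_hom_def Pi_iff)

text \<open>The counterpart of \<open>qmap\<close> for the given representation. Both maps pull the
  inner product back to the same form, so \<open>qmap f \<mapsto> rmap f\<close> is isometric in
  both directions.\<close>

definition rmap :: "('a \<times> 'k \<Rightarrow>\<^sub>0 complex) \<Rightarrow> 'h" where
  "rmap = free_lift H (\<lambda>(a, v). \<pi> a (V v))"

lemma piV_carrier: "v \<in> carrier K \<Longrightarrow> \<pi> a (V v) \<in> carrier H"
  using bounded_opsD(3)[OF pi_bounded bounded_opsD(3)[OF V_bounded]] .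

lemma rmap_linear: "rmap \<in> linear_maps (free_space gens) H"
  unfolding rmap_def by (rule free_lift_linear[OF H.module_axioms]) (auto simp: piV_carrier)

lemma rmap_single: "v \<in> carrier K \<Longrightarrow> rmap (Poly_Mapping.single (a, v) c) = c \<odot>\<^bsub>H\<^esub> \<pi> a (V v)"
  unfolding rmap_def
  by (subst free_lift_single[OF H.module_axioms, where X = gens]) (auto simp: piV_carrier)

lemma rmap_gen: "v \<in> carrier K \<Longrightarrow> rmap (gen (a, v)) = \<pi> a (V v)"
  using H.smult_one[OF piV_carrier] by (simp add: rmap_single)

lemma rmap_carrier: "f \<in> FS \<Longrightarrow> rmap f \<in> carrier H"
  using linear_mapsD(1)[OF rmap_linear] .

lemma rmap_add: "\<lbrakk>f \<in> FS; g \<in> FS\<rbrakk> \<Longrightarrow>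
    rmap (f + g) = rmap f \<oplus>\<^bsub>H\<^esub> rmap g"
  using linear_mapsD(2)[OF rmap_linear, of f g] by simp

lemma rmap_zero: "rmap 0 = \<zero>\<^bsub>H\<^esub>"
  using linear_maps_zero[OF module_free_space H.module_axioms rmap_linear] by simp

text \<open>\<open>\<pi> a\<close> crosses the inner product as \<open>\<pi> (cstar a)\<close> and
  \<open>V\<close> as its adjoint, which leaves the Stinespring factorisation of
  \<open>\<phi> (cstar a * b)\<close>.\<close>

lemma cinner_piV:
  assumes v: "v \<in> carrier K" and w: "w \<in> carrier K"
  shows "\<langle>\<pi> a (V v), \<pi> b (V w)\<rangle>\<^bsub>H\<^esub> = kern (a, v) (b, w)"
proof -
  note Vv = bounded_opsD(3)[OF V_bounded v] and Vw = bounded_opsD(3)[OF V_bounded w]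
  have "\<langle>\<pi> a (V v), \<pi> b (V w)\<rangle>\<^bsub>H\<^esub> = \<langle>V v, \<pi> (cstar a) (\<pi> b (V w))\<rangle>\<^bsub>H\<^esub>"
    unfolding pi_star
    by (rule adjoint_op_cinner_right[OF H.hilbert_space_axioms H.pre_hilbert_space_axioms pi_bounded Vv
      piV_carrier[OF w], symmetric])
  also have "\<dots> = \<langle>V v, \<pi> (cstar a * b) (V w)\<rangle>\<^bsub>H\<^esub>"
    unfolding pi_mult compose_eq[OF Vw] ..
  also have "\<dots> = \<langle>v, adjoint_op K H V (\<pi> (cstar a * b) (V w))\<rangle>\<^bsub>K\<^esub>"
    by (rule adjoint_op_cinner_right[OF hilbert_space_axioms H.pre_hilbert_space_axioms V_bounded v
      piV_carrier[OF w], symmetric])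
  also have "\<dots> = \<langle>v, \<phi> (cstar a * b) w\<rangle>\<^bsub>K\<^esub>"
    by (subst phi_eq) (simp add: compose_eq[OF w])
  finally show ?thesis by (simp add: kern_def)
qed

lemma cinner_rmap:
  "\<lbrakk>f \<in> FS; g \<in> FS\<rbrakk> \<Longrightarrow>
    \<langle>rmap f, rmap g\<rangle>\<^bsub>H\<^esub> = form f g"
proof -
  interpret F: Module.module complex_field "free_space gens" by (rule module_free_space)
  assume f: "f \<in> FS" and g: "g \<in> FS"
  let ?P = "\<lambda>f g. f \<in> FS \<longrightarrow> g \<in> FS \<longrightarrow> \<langle>rmap f, rmap g\<rangle>\<^bsub>H\<^esub> = form f g"
  have "?P f g"
    using f
  proof (induction rule: free_space_induct)
    case zero
    then show ?case by (simp add: rmap_zero rmap_carrier del: free_space_simps)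
  next
    case (add f f')
    then show ?case
      by (simp add: rmap_add rmap_carrier sesqui_add_left H.form_add_left del: free_space_simps)
  next
    case (single p c)
    obtain a v where p: "p = (a, v)" by (cases p)
    have v: "v \<in> carrier K" using single p by simp
    note pc = single_carrier[OF v, of a c]
    from g show ?case
    proof (induction rule: free_space_induct)
      case zero
      then show ?case using rmap_carrier[OF pc] by (simp add: p rmap_zero del: free_space_simps)
    next
      case (add g g')
      then show ?case using rmap_carrier[OF pc]
        by (simp add: p rmap_add rmap_carrier sesqui_add_right H.form_add_right pc del: free_space_simps)
    next
      case (single q d)
      obtain b w where q: "q = (b, w)" by (cases q)
      have w: "w \<in> carrier K" using single q by simp
      show ?case
        using v w by (simp add: p q rmap_single piV_carrier sesqui_single cinner_piV
          H.form_smult_left H.form_smult_right)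
    qed
  qed
  then show ?thesis using f g by blast
qed

text \<open>The place where minimality of the given representation enters: the range of
  \<open>rmap\<close> is a subspace that contains all \<open>\<pi> a (V v)\<close>, hence their
  dense span.\<close>

lemma rmap_dense: "dense_in H (rmap ` FS)"
proof -
  let ?D = "{\<pi> a (V v) | a v. v \<in> carrier K}"
  have "?D \<subseteq> carrier H" using piV_carrier by blast
  note sub = submoduleD(1)[OF submodule_vspan[OF H.module_axioms this]]
  have "?D \<subseteq> rmap ` FS"
  proof clarify
    fix a v assume "v \<in> carrier K"
    then show "\<pi> a (V v) \<in> rmap ` FS"
      by (metis rmap_gen single_carrier imageI)
  qed
  then have "vspan H ?D \<subseteq> rmap ` FS"
    by (rule vspan_least[OF submodule_image[OF module_free_space H.module_axioms rmap_linear]])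
  moreover have "dense_in H (vspan H ?D)"
    using minimal_rep unfolding minimal_stinespring_rep_def minimal_anrep.simps H.dense_iff[OF sub] dense_in_def
    by (rule conjunct2)
  ultimately show ?thesis by (rule dense_in_mono[rotated])
qed

lemma rmap_range: "rmap ` FS \<subseteq> carrier H"
  using rmap_carrier by blast

lemma hnorm_rmap: "f \<in> FS \<Longrightarrow> hnorm H (rmap f) = hnorm space (qmap f)"
  by (simp only: hnorm_qmap hnorm_def[of H] cinner_rmap)

text \<open>On a generator the value is forced: \<open>L\<close> carries the class of
  \<open>a \<otimes> v\<close>, which is \<open>stine_rep K \<phi> a\<close> applied to the anchor
  of v, to \<open>\<pi> a\<close> applied to the image of that anchor, and this image is
  \<open>V v\<close>.\<close>

lemma intertwiner_qmap:
  assumes iso: "anrep_morphism (stine K \<phi>) (K, H, \<pi>, V) (id_op K, L)"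
    and f: "f \<in> FS"
  shows "L (qmap f) = rmap f"
proof -
  have L: "L \<in> bounded_ops space H"
    and inter: "\<And>a. compose (carrier space) L (stine_rep K \<phi> a) = compose (carrier space) (\<pi> a) L"
    and anchor: "compose (carrier K) L (stine_anchor K \<phi>) = compose (carrier K) V (id_op K)"
    using iso by (simp_all add: stine_def)
  show ?thesis
  proof (rule bounded_linear_qmap_eqI[OF H.module_axioms bounded_opsD(1)[OF L] rmap_linear _ f])
    fix a v assume v: "v \<in> carrier K"
    note Sv = bounded_opsD(3)[OF stine_anchor_bounded v]
    have "L (qmap (gen (a, v))) = L (stine_rep K \<phi> a (stine_anchor K \<phi> v))"
      by (simp only: stine_rep_anchor[OF v])
    also have "\<dots> = \<pi> a (L (stine_anchor K \<phi> v))"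
      using fun_cong[OF inter[of a], of "stine_anchor K \<phi> v"] by (simp only: compose_eq[OF Sv])
    also have "L (stine_anchor K \<phi> v) = V v"
      using fun_cong[OF anchor, of v] v by (simp add: compose_eq id_op_def)
    finally show "L (qmap (gen (a, v))) = rmap (gen (a, v))" by (simp only: rmap_gen[OF v])
  qed
qed

lemma rmap_lmul: "f \<in> FS \<Longrightarrow> rmap (lmul a f) = \<pi> a (rmap f)"
proof (induction rule: free_space_induct)
  case zero
  show ?case
    using linear_maps_zero[OF H.module_axioms H.module_axioms bounded_opsD(1)[OF pi_bounded]]
    by (simp add: rmap_zero)
next
  case (single p c)
  obtain b v where p: "p = (b, v)" by (cases p)
  have v: "v \<in> carrier K" using single p by simp
  show ?case
    using bounded_opsD(5)[OF pi_bounded piV_carrier[OF v], of a c b]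
    by (simp add: p lmul_single[OF v] rmap_single[OF v] pi_mult compose_eq bounded_opsD(3)[OF V_bounded v])
next
  case (add f g)
  then show ?case
    using bounded_opsD(4)[OF pi_bounded rmap_carrier[OF add(1)] rmap_carrier[OF add(2)]]
    by (simp only: lmul_add rmap_add lmul_carrier)
qed

lemma unitary_intertwiner:
  obtains L where "anrep_iso (stine K \<phi>) (K, H, \<pi>, V) (id_op K, L)" "unitary_op space H L"
proof -
  note pS = S.pre_hilbert_space_axioms and pH = H.pre_hilbert_space_axioms and pK = pre_hilbert_space_axioms
  note hS = S.hilbert_space_axioms and hH = H.hilbert_space_axioms and hK = hilbert_space_axioms
  \<comment> \<open>Norms of \<open>qmap f\<close> and \<open>rmap f\<close> agree, so the extension
    works with constant 1 in either direction, and the two extensions invert each other on dense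
    ranges.\<close>
  obtain L where L: "L \<in> bounded_ops space H" "\<And>f. f \<in> FS \<Longrightarrow> L (qmap f) = rmap f"
    using bounded_extension[OF module_free_space pS hH qmap_linear rmap_linear _ qmap_dense, where C = 1]
      hnorm_rmap by auto
  obtain L' where L': "L' \<in> bounded_ops H space" "\<And>f. f \<in> FS \<Longrightarrow> L' (rmap f) = qmap f"
    using bounded_extension[OF module_free_space pH hS rmap_linear qmap_linear _ rmap_dense, where C = 1]
      hnorm_rmap by auto
  have id1: "compose (carrier space) L' L = id_op space"
  proof (rule space_op_eqI[OF pS compose_bounded[OF pS pH L'(1) L(1)] id_op_bounded[OF pS]])
    fix f assume f: "f \<in> FS"
    show "compose (carrier space) L' L (qmap f) = id_op space (qmap f)"
      using qmap_carrier[OF f] by (simp add: compose_eq L(2)[OF f] L'(2)[OF f] id_op_def)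
  qed
  have id2: "compose (carrier H) L L' = id_op H"
  proof (rule bounded_ops_eq_dense[OF pH pH rmap_dense rmap_range compose_bounded[OF pH pS L(1) L'(1)] id_op_bounded[OF pH]])
    fix x assume "x \<in> rmap ` FS"
    then obtain f where f: "f \<in> FS" "x = rmap f" by blast
    show "compose (carrier H) L L' x = id_op H x"
      using rmap_carrier[OF f(1)] by (simp add: f(2) compose_eq L(2)[OF f(1)] L'(2)[OF f(1)] id_op_def)
  qed
  have L'L: "L' (L x) = x" if "x \<in> carrier space" for x
    using fun_cong[OF id1, of x] that by (simp add: compose_eq id_op_def)
  have LL': "L (L' y) = y" if "y \<in> carrier H" for y
    using fun_cong[OF id2, of y] that by (simp add: compose_eq id_op_def)
  note A = adjoint_op_bounded[OF hS pH L(1)]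
  \<comment> \<open>Compared on the two dense ranges, where both pairings reduce to
    \<open>form f g\<close>.\<close>
  have adj: "adjoint_op space H L = L'"
  proof (rule bounded_ops_eq_dense[OF pH pS rmap_dense rmap_range A L'(1)])
    fix x assume "x \<in> rmap ` FS"
    then obtain f where f: "f \<in> FS" "x = rmap f" by blast
    show "adjoint_op space H L x = L' x"
      unfolding f(2) L'(2)[OF f(1)]
    proof (rule S.eq_if_cinner_dense[OF qmap_dense qmap_range bounded_opsD(3)[OF A rmap_carrier[OF f(1)]]
          qmap_carrier[OF f(1)]])
      fix z assume "z \<in> qmap ` FS"
      then obtain g where g: "g \<in> FS" "z = qmap g" by blast
      show "\<langle>adjoint_op space H L (rmap f), z\<rangle>\<^bsub>space\<^esub> = \<langle>qmap f, z\<rangle>\<^bsub>space\<^esub>"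
        unfolding g(2) adjoint_op_cinner[OF hS pH L(1) qmap_carrier[OF g(1)] rmap_carrier[OF f(1)], symmetric]
          L(2)[OF g(1)] cinner_rmap[OF f(1) g(1)] cinner_qmap[OF f(1) g(1)] ..
    qed
  qed
  have unitary: "unitary_op space H L"
    using L(1) id1 id2 by (simp add: unitary_op_def adj)
  have inter: "L (stine_rep K \<phi> a x) = \<pi> a (L x)" if x: "x \<in> carrier space" for a x
  proof -
    have "compose (carrier space) L (stine_rep K \<phi> a) = compose (carrier space) (\<pi> a) L"
    proof (rule space_op_eqI[OF pH compose_bounded[OF pS pS L(1) stine_rep_bounded] compose_bounded[OF pS pH pi_bounded L(1)]])
      fix f assume f: "f \<in> FS"
      show "compose (carrier space) L (stine_rep K \<phi> a) (qmap f) = compose (carrier space) (\<pi> a) L (qmap f)"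
        unfolding compose_eq[OF qmap_carrier[OF f]] stine_rep_qmap[OF f] L(2)[OF f]
          L(2)[OF lmul_carrier[OF f]] rmap_lmul[OF f] ..
    qed
    from fun_cong[OF this, of x] show ?thesis by (simp only: compose_eq[OF x])
  qed
  \<comment> \<open>The class of \<open>1 \<otimes> w\<close> goes to \<open>\<pi> 1 (V w)\<close>,
    and \<open>\<pi>\<close> is unital.\<close>
  have anchor: "L (stine_anchor K \<phi> w) = V w" if w: "w \<in> carrier K" for w
    using bounded_opsD(3)[OF V_bounded w]
    by (simp add: stine_anchor_eq[OF w] L(2)[OF single_carrier[OF w]] rmap_gen[OF w] pi_one id_op_def
      del: free_space_simps)
  note AS = adjoint_op_bounded[OF hK pS stine_anchor_bounded]
    and AV = adjoint_op_bounded[OF hK pH V_bounded]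
  \<comment> \<open>The adjoint condition on morphisms follows from the anchor condition because the
    adjoint of \<open>L\<close> is its inverse, which takes \<open>V z\<close> back to the
    Stinespring anchor of z.\<close>
  have coanchor: "adjoint_op K space (stine_anchor K \<phi>) x = adjoint_op K H V (L x)"
    if x: "x \<in> carrier space" for x
  proof (rule vector_eqI[OF bounded_opsD(3)[OF AS x] bounded_opsD(3)[OF AV bounded_opsD(3)[OF L(1) x]]])
    fix z assume z: "z \<in> carrier K"
    note Sz = bounded_opsD(3)[OF stine_anchor_bounded z]
    have "\<langle>z, adjoint_op K H V (L x)\<rangle>\<^bsub>K\<^esub> = \<langle>V z, L x\<rangle>\<^bsub>H\<^esub>"
      by (rule adjoint_op_cinner_right[OF hK pH V_bounded z bounded_opsD(3)[OF L(1) x]])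
    also have "\<dots> = \<langle>L' (V z), x\<rangle>\<^bsub>space\<^esub>"
      unfolding adj[symmetric] by (rule adjoint_op_cinner[OF hS pH L(1) x bounded_opsD(3)[OF V_bounded z]])
    also have "L' (V z) = stine_anchor K \<phi> z" using L'L[OF Sz] by (simp only: anchor[OF z])
    also have "\<langle>stine_anchor K \<phi> z, x\<rangle>\<^bsub>space\<^esub> = \<langle>z, adjoint_op K space (stine_anchor K \<phi>) x\<rangle>\<^bsub>K\<^esub>"
      by (rule adjoint_op_cinner_right[OF hK pS stine_anchor_bounded z x, symmetric])
    finally show "\<langle>z, adjoint_op K space (stine_anchor K \<phi>) x\<rangle>\<^bsub>K\<^esub> = \<langle>z, adjoint_op K H V (L x)\<rangle>\<^bsub>K\<^esub>" ..
  qed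
  have compose_cong: "compose X f g = compose X f' g'"
    if "\<And>x. x \<in> X \<Longrightarrow> f (g x) = f' (g' x)" for X and f :: "'y \<Rightarrow> 'z" and g :: "'x \<Rightarrow> 'y" and f' :: "'w \<Rightarrow> 'z" and g'
    using that by (auto simp: compose_def)
  have idK: "id_op K w = w" if "w \<in> carrier K" for w using that by (simp add: id_op_def)
  have F: "anrep_morphism (stine K \<phi>) (K, H, \<pi>, V) (id_op K, L)"
    unfolding stine_def anrep_morphism.simps
    by (intro conjI allI id_op_bounded[OF pK] L(1) compose_cong)
      (simp_all only: inter anchor idK coanchor[symmetric] bounded_opsD(3)[OF AS])
  \<comment> \<open>The equations for the inverse are those for \<open>L\<close>, read at
    \<open>L' y\<close> and simplified by \<open>L (L' y) = y\<close>.\<close>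
  have G: "anrep_morphism (K, H, \<pi>, V) (stine K \<phi>) (id_op K, L')"
    unfolding stine_def anrep_morphism.simps
  proof (intro conjI allI id_op_bounded[OF pK] L'(1) compose_cong)
    show "L' (\<pi> a y) = stine_rep K \<phi> a (L' y)" if y: "y \<in> carrier H" for a y
    proof -
      note c = bounded_opsD(3)[OF L'(1) y]
      have "L' (\<pi> a y) = L' (\<pi> a (L (L' y)))" by (simp only: LL'[OF y])
      also have "\<dots> = L' (L (stine_rep K \<phi> a (L' y)))" by (simp only: inter[OF c])
      also have "\<dots> = stine_rep K \<phi> a (L' y)" by (rule L'L[OF bounded_opsD(3)[OF stine_rep_bounded c]])
      finally show ?thesis .
    qed
    show "L' (V w) = stine_anchor K \<phi> (id_op K w)" if w: "w \<in> carrier K" for w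
      using L'L[OF bounded_opsD(3)[OF stine_anchor_bounded w]] by (simp only: anchor[OF w] idK[OF w])
    show "id_op K (adjoint_op K H V y) = adjoint_op K space (stine_anchor K \<phi>) (L' y)"
      if y: "y \<in> carrier H" for y
      using coanchor[OF bounded_opsD(3)[OF L'(1) y]]
      by (simp only: LL'[OF y] idK[OF bounded_opsD(3)[OF AV y]])
  qed
  have "compose (carrier K) (id_op K) (id_op K) = id_op K"
    by (auto simp: compose_def id_op_def fun_eq_iff)
  then have "anrep_comp (stine K \<phi>) (id_op K, L') (id_op K, L) = anrep_id (stine K \<phi>)"
    "anrep_comp (K, H, \<pi>, V) (id_op K, L) (id_op K, L') = anrep_id (K, H, \<pi>, V)"
    by (simp_all add: stine_def id1 id2)
  then have "anrep_iso (stine K \<phi>) (K, H, \<pi>, V) (id_op K, L)"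
    unfolding anrep_iso_def using F G by blast
  then show ?thesis using unitary that by blast
qed

lemma intertwiner_unique:
  assumes "anrep_iso (stine K \<phi>) (K, H, \<pi>, V) (id_op K, L)"
    "anrep_iso (stine K \<phi>) (K, H, \<pi>, V) (id_op K, L')"
  shows "L = L'"
proof -
  have m: "anrep_morphism (stine K \<phi>) (K, H, \<pi>, V) (id_op K, L)"
    "anrep_morphism (stine K \<phi>) (K, H, \<pi>, V) (id_op K, L')"
    using assms by (simp_all add: anrep_iso_def)
  then have "L \<in> bounded_ops space H" "L' \<in> bounded_ops space H"
    by (simp_all add: stine_def)
  then show ?thesis
    by (rule space_op_eqI[OF H.pre_hilbert_space_axioms])
      (simp only: intertwiner_qmap[OF m(1)] intertwiner_qmap[OF m(2)])
qed

end

lemma unitary_id_op: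
  assumes "hilbert_space K" shows "unitary_op K K (id_op K)"
proof -
  interpret hilbert_space K by fact
  note b = id_op_bounded[OF pre_hilbert_space_axioms]
  have "adjoint_op K K (id_op K) = id_op K"
    by (rule adjoint_op_eqI[OF assms pre_hilbert_space_axioms b b]) (simp add: id_op_def)
  moreover have "compose (carrier K) (id_op K) (id_op K) = id_op K"
    by (auto simp: compose_def id_op_def fun_eq_iff)
  ultimately show ?thesis using b by (simp add: unitary_op_def)
qed

theorem corollary6p9:
  fixes K :: "'k hilb"
    and \<phi> :: "'a::cstar_algebra \<Rightarrow> 'k \<Rightarrow> 'k"
  assumes "ocp_map K \<phi>"
  shows "minimal_stinespring_rep K \<phi> (stine K \<phi>) \<and>
    (\<forall>(H :: 'h hilb) \<pi> V. minimal_stinespring_rep K \<phi> (K, H, \<pi>, V) \<longrightarrow>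
      (\<exists>!(T, L). anrep_iso (stine K \<phi>) (K, H, \<pi>, V) (T, L) \<and> T = id_op K) \<and>
      (\<forall>T L. anrep_iso (stine K \<phi>) (K, H, \<pi>, V) (T, L) \<and> T = id_op K \<longrightarrow>
        unitary_op K K T \<and> unitary_op (stine_space K \<phi>) H L))"
proof (intro conjI allI impI)
  have ocp: "ocp K \<phi>"
    using assms by (simp add: ocp_map_def ocp_def ocp_axioms_def)
  then show "minimal_stinespring_rep K \<phi> (stine K \<phi>)"
    by (rule ocp.stine_minimal_stinespring_rep)
  fix H :: "'h hilb" and \<pi> V
  assume "minimal_stinespring_rep K \<phi> (K, H, \<pi>, V)"
  with ocp interpret minimal_rep K \<phi> H \<pi> V
    by (simp add: minimal_rep_def minimal_rep_axioms_def)
  obtain L where L: "anrep_iso (stine K \<phi>) (K, H, \<pi>, V) (id_op K, L)" "unitary_op (stine_space K \<phi>) H L"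
    by (rule unitary_intertwiner)
  show "\<exists>!(T, L). anrep_iso (stine K \<phi>) (K, H, \<pi>, V) (T, L) \<and> T = id_op K"
    by (rule ex1I[of _ "(id_op K, L)"]) (use L(1) intertwiner_unique in auto)
  fix T L' assume "anrep_iso (stine K \<phi>) (K, H, \<pi>, V) (T, L') \<and> T = id_op K"
  \<comment> \<open>By uniqueness any such isomorphism is the constructed one, so it inherits
    unitarity.\<close>
  then show "unitary_op K K T" "unitary_op (stine_space K \<phi>) H L'"
    using intertwiner_unique[OF _ L(1), of L'] L(2) unitary_id_op[OF hilbert_space_axioms] by auto
qed

end
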